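(* Suppose that there is a positive, nondecreasing function $\ell$ on $(0,\infty)$, slowly varying at $\infty$, such that $$\sum_{n=1}^\infty\frac{1}{n\,\ell(n)}<\infty\qquad\text{and}\qquad \sum_{n=1}^{\infty} n^{-3/2}\sqrt{\ell(n)}\,\log(n)\,\|E(S_n\mid\mathcal{F}_0)\|<\infty.$$ Let $F_n$ be a regular conditional distribution function for $S_n/\sqrt n$ given $\mathcal{F}_0$, that is, $F_n(\omega;z)=P\left[\frac{S_n}{\sqrt n}\le z\,\middle|\,\mathcal{F}_0\right](\omega)$ for $\omega\in\Omega$ and $-\infty<z<\infty$. Then, for $P$-almost every $\omega$, $F_n(\omega;\cdot)$ converges weakly to $\Phi_\sigma$ as $n\to\infty$, where $\Phi_\sigma$ denotes the normal distribution with mean $0$ and variance $\sigma^2=\lim_{n\to\infty}\frac1nE(S_n^2)$.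
   Context: Setting: $(W_k)_{k\in\mathbb{Z}}$ is a (strictly) stationary, ergodic Markov chain on a probability space $(\Omega,\mathcal{A},P)$ endowed with an ergodic, measure-preserving transformation $\theta$ such that $W_k\circ\theta=W_{k+1}$ for all $k$. $X_k=g(W_k)$, where $g$ is a real measurable function with $E(X_0)=0$ and $E(X_0^2)<\infty$; $S_n=X_1+\cdots+X_n$; $\mathcal{F}_k=\sigma(\ldots,W_{k-1},W_k)$; $\|\cdot\|$ is the norm in $L^2(P)$. It is known that if $\sum_n n^{-3/2}\|E(S_n\mid\mathcal{F}_0)\|<\infty$ (which is implied by the hypothesis of the claim), then $\sigma^2:=\lim_{n\to\infty}\frac1nE(S_n^2)$ exists and is finite. If $\sigma=0$, $\Phi_\sigma$ is the point mass at $0$. *)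

theory Defs
  imports "HOL-Probability.Probability"
begin

section \<open>Ergodic transformations, stationary processes, Markov chains\<close>

definition ergodic_mpt :: "'a measure \<Rightarrow> ('a \<Rightarrow> 'a) \<Rightarrow> bool" where
  "ergodic_mpt M T \<longleftrightarrow>
     T \<in> measurable M M \<and> distr M M T = M \<and>
     (\<forall>A\<in>sets M. T -` A \<inter> space M = A \<longrightarrow> measure M A = 0 \<or> measure M A = 1)"

definition path_law :: "'a measure \<Rightarrow> 's measure \<Rightarrow> (int \<Rightarrow> 'a \<Rightarrow> 's) \<Rightarrow> (int \<Rightarrow> 's) measure" where
  "path_law M N W = distr M (\<Pi>\<^sub>M k\<in>UNIV. N) (\<lambda>\<omega> k. W k \<omega>)"

text \<open>Invariance of the law of the whole path under the left shift is strict stationarity.\<close>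

definition stationary_ergodic_process ::
    "'a measure \<Rightarrow> 's measure \<Rightarrow> (int \<Rightarrow> 'a \<Rightarrow> 's) \<Rightarrow> bool" where
  "stationary_ergodic_process M N W \<longleftrightarrow>
     (\<forall>k. W k \<in> measurable M N) \<and> ergodic_mpt (path_law M N W) (\<lambda>x k. x (k + 1))"

text \<open>Only the space and the \<open>\<sigma>\<close>-algebra of \<open>past\<close> matter; as a measure it is zero.\<close>

definition past :: "'a measure \<Rightarrow> 's measure \<Rightarrow> (int \<Rightarrow> 'a \<Rightarrow> 's) \<Rightarrow> int \<Rightarrow> 'a measure" where
  "past M N W k = sigma (space M) {W j -` A \<inter> space M | j A. j \<le> k \<and> A \<in> sets N}"

definition real_cond_prob :: "'a measure \<Rightarrow> 'a measure \<Rightarrow> ('a \<Rightarrow> bool) \<Rightarrow> 'a \<Rightarrow> real" where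
  "real_cond_prob M G Q = real_cond_exp M G (indicator {\<omega> \<in> space M. Q \<omega>})"

definition markov_chain :: "'a measure \<Rightarrow> 's measure \<Rightarrow> (int \<Rightarrow> 'a \<Rightarrow> 's) \<Rightarrow> bool" where
  "markov_chain M N W \<longleftrightarrow>
     (\<forall>k. W k \<in> measurable M N) \<and>
     (\<forall>k. \<forall>A\<in>sets N. AE \<omega> in M.
        real_cond_prob M (past M N W k) (\<lambda>\<omega>. W (k + 1) \<omega> \<in> A) \<omega> =
        real_cond_prob M (vimage_algebra (space M) (W k) N) (\<lambda>\<omega>. W (k + 1) \<omega> \<in> A) \<omega>)"

section \<open>Partial sums, the \<open>L\<^sup>2\<close> norm, slow variation\<close>

definition partial_sum :: "('s \<Rightarrow> real) \<Rightarrow> (int \<Rightarrow> 'a \<Rightarrow> 's) \<Rightarrow> nat \<Rightarrow> 'a \<Rightarrow> real" where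
  "partial_sum g W n \<omega> = (\<Sum>k=1..n. g (W (int k) \<omega>))"

text \<open>The value is meaningful only for square-integrable \<open>f\<close>.\<close>

definition l2_norm :: "'a measure \<Rightarrow> ('a \<Rightarrow> real) \<Rightarrow> real" where
  "l2_norm M f = sqrt (\<integral>\<omega>. (f \<omega>)\<^sup>2 \<partial>M)"

definition slowly_varying :: "(real \<Rightarrow> real) \<Rightarrow> bool" where
  "slowly_varying l \<longleftrightarrow> (\<forall>c>0. ((\<lambda>x. l (c * x) / l x) \<longlongrightarrow> 1) at_top)"

section \<open>Regular conditional distribution functions and centred normal laws\<close>

definition regular_cond_cdf ::
    "'a measure \<Rightarrow> 'a measure \<Rightarrow> ('a \<Rightarrow> real) \<Rightarrow> ('a \<Rightarrow> real \<Rightarrow> real) \<Rightarrow> bool" where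
  "regular_cond_cdf M G Y F \<longleftrightarrow>
     (\<forall>\<omega>\<in>space M. \<exists>\<mu>. real_distribution \<mu> \<and> F \<omega> = cdf \<mu>) \<and>
     (\<forall>z. (\<lambda>\<omega>. F \<omega> z) \<in> borel_measurable G \<and>
          (AE \<omega> in M. F \<omega> z = real_cond_prob M G (\<lambda>\<omega>. Y \<omega> \<le> z) \<omega>))"

text \<open>The parameter \<open>v\<close> is the variance, whereas \<^const>\<open>normal_density\<close> takes the
  standard deviation.\<close>

definition centred_normal :: "real \<Rightarrow> real measure" where
  "centred_normal v =
     (if v = 0 then return borel 0 else density lborel (\<lambda>x. ennreal (normal_density 0 (sqrt v) x)))"

end

theory Submission
  imports Defs
begin

text \<open>By subadditivity of \<open>\<parallel>E(S\<^sub>n | F\<^sub>0)\<parallel>\<close> the summability of \<open>n\<^sup>-\<^sup>3\<^sup>/\<^sup>2 log n \<parallel>E(S\<^sub>n | F\<^sub>0)\<parallel>\<close>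
  becomes a dyadic condition, under which \<open>S\<^sub>n = M\<^sub>n + R\<^sub>n\<close> for a martingale \<open>M\<^sub>n\<close> with stationary
  differences (an \<open>L\<^sup>2\<close> limit of explicit approximations) and with \<open>\<parallel>R\<^sub>n\<parallel> / \<surd>n\<close> summable
  along powers of two. Chaining over dyadic blocks and the maximal ergodic inequality turn this into
  \<open>R\<^sub>n = o(\<surd>n)\<close> almost surely.

  For a bounded martingale difference, McLeish's product \<open>\<Prod>(1 + i s D\<^sub>k)\<close> has conditional
  expectation \<open>1\<close>, and Birkhoff's theorem gives the conditional characteristic functions. Truncation
  removes the boundedness, the error being controlled almost surely by Hopf's maximal inequality for
  the operator \<open>f \<mapsto> E(f \<circ> \<theta> | F\<^sub>0)\<close>. Tightness of the conditional laws then allows one to restrict to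
  countably many arguments of the characteristic functions.\<close>

subsection \<open>Square-integrable functions\<close>

text \<open>The conclusion concerns almost every point, so an error that vanishes in
  \<open>L^2\<close> or in probability is not enough: every error needs a bound simultaneous in n.
  This is what the logarithm pays for. If \<open>\<delta> k\<close> is the norm of the difference of
  two consecutive dyadic approximations of the martingale difference, the remainder at time 2^j
  carries the tail of the series of \<open>\<delta>\<close> from j on. Summability of
  \<open>\<delta>\<close> would only make these tails tend to zero, whereas chaining needs them
  summable in j, that is, it needs the series of (k + 1) \<open>\<delta> k\<close> to converge, and
  k is log(2^k) up to a constant. Conditional second moments are handled through T f = E(f o
  \<open>\<theta>\<close> | F). Since F grows along the orbit, the powers of T are f |-> E(f o
  \<open>\<theta>\<close>^k | F), so Hopf's inequality for f = D^2 bounds E(M_n^2 | F) / n for all n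
  together. It serves for the truncation error and again for tightness, which is called for because
  the null set in the convergence of a characteristic function depends on its argument.\<close>

definition square_integrable :: "'a measure \<Rightarrow> ('a \<Rightarrow> real) \<Rightarrow> bool" where
  "square_integrable M f \<longleftrightarrow> f \<in> borel_measurable M \<and> integrable M (\<lambda>x. (f x)\<^sup>2)"

lemma square_integrableD [dest]:
  assumes "square_integrable M f"
  shows "f \<in> borel_measurable M" "integrable M (\<lambda>x. (f x)\<^sup>2)"
  using assms by (auto simp: square_integrable_def)

lemma square_integrable_mult:
  assumes "square_integrable M f" "square_integrable M g"
  shows "integrable M (\<lambda>x. f x * g x)"
proof (rule Bochner_Integration.integrable_bound)
  show "integrable M (\<lambda>x. (f x)\<^sup>2 + (g x)\<^sup>2)"
    using assms by (auto intro: Bochner_Integration.integrable_add)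
  have "\<bar>a * b\<bar> \<le> a\<^sup>2 + b\<^sup>2" for a b :: real
  proof -
    have "2 * \<bar>a * b\<bar> \<le> a\<^sup>2 + b\<^sup>2"
      using sum_squares_bound[of "\<bar>a\<bar>" "\<bar>b\<bar>"] by (simp add: abs_mult mult.assoc)
    then show ?thesis using abs_ge_zero[of "a * b"] by linarith
  qed
  then show "AE x in M. norm (f x * g x) \<le> norm ((f x)\<^sup>2 + (g x)\<^sup>2)"
    by (auto intro: order_trans)
  show "(\<lambda>x. f x * g x) \<in> borel_measurable M"
    using assms by (auto intro!: borel_measurable_times)
qed

lemma square_integrable_add:
  assumes "square_integrable M f" "square_integrable M g"
  shows "square_integrable M (\<lambda>x. f x + g x)"
  using assms square_integrable_mult[OF assms]
  by (auto simp: square_integrable_def power2_sum mult.assoc)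

lemma square_integrable_cmult:
  assumes "square_integrable M f"
  shows "square_integrable M (\<lambda>x. c * f x)"
  using assms by (auto simp: square_integrable_def power_mult_distrib)

lemma square_integrable_divide:
  assumes "square_integrable M f"
  shows "square_integrable M (\<lambda>x. f x / c)"
  using square_integrable_cmult[OF assms, of "1 / c"] by simp

lemma square_integrable_diff:
  assumes "square_integrable M f" "square_integrable M g"
  shows "square_integrable M (\<lambda>x. f x - g x)"
  using square_integrable_add[OF assms(1) square_integrable_cmult[OF assms(2), of "-1"]] by simp

lemma square_integrable_sum:
  assumes "\<And>i. i \<in> I \<Longrightarrow> square_integrable M (f i)"
  shows "square_integrable M (\<lambda>x. \<Sum>i\<in>I. f i x)"
  using assms
proof (induction I rule: infinite_finite_induct)
  case (insert i I)
  then show ?case by (simp add: square_integrable_add)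
qed (simp_all add: square_integrable_def)

lemma square_integrable_bound:
  assumes "square_integrable M f" "g \<in> borel_measurable M" "\<And>x. x \<in> space M \<Longrightarrow> \<bar>g x\<bar> \<le> \<bar>f x\<bar>"
  shows "square_integrable M g"
proof -
  have "integrable M (\<lambda>x. (g x)\<^sup>2)"
    by (rule Bochner_Integration.integrable_bound[OF square_integrableD(2)[OF assms(1)]])
       (use assms in \<open>auto intro!: AE_I2 simp: abs_le_square_iff\<close>)
  with assms(2) show ?thesis by (simp add: square_integrable_def)
qed

lemma l2_norm_nonneg [simp]: "0 \<le> l2_norm M f"
  by (simp add: l2_norm_def)

lemma l2_norm_power2: "(l2_norm M f)\<^sup>2 = (\<integral>x. (f x)\<^sup>2 \<partial>M)"
  by (simp add: l2_norm_def)

lemma l2_norm_cmult: "l2_norm M (\<lambda>x. c * f x) = \<bar>c\<bar> * l2_norm M f"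
  by (simp add: l2_norm_def power_mult_distrib real_sqrt_mult)

lemma l2_norm_divide: "l2_norm M (\<lambda>x. f x / c) = l2_norm M f / \<bar>c\<bar>"
  using l2_norm_cmult[of M "1 / c" f] by simp

lemma l2_norm_cong_AE:
  assumes "AE x in M. f x = g x" "f \<in> borel_measurable M" "g \<in> borel_measurable M"
  shows "l2_norm M f = l2_norm M g"
  unfolding l2_norm_def using assms by (auto intro!: arg_cong[where f = sqrt] integral_cong_AE)

lemma l2_norm_cong:
  assumes "\<And>x. x \<in> space M \<Longrightarrow> f x = g x"
  shows "l2_norm M f = l2_norm M g"
  unfolding l2_norm_def using assms by (auto intro!: arg_cong[where f = sqrt] Bochner_Integration.integral_cong)

text \<open>The integral of (f - t g)^2 is a nonnegative quadratic polynomial in \<open>t\<close>;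
  its value at the minimiser \<open>c / b\<close> is the Cauchy-Schwarz inequality. If
  \<open>b = 0\<close> the polynomial is affine, and a nonzero slope would produce the value
  -1.\<close>

lemma integral_mult_le_l2_norm:
  assumes f: "square_integrable M f" and g: "square_integrable M g"
  shows "(\<integral>x. f x * g x \<partial>M) \<le> l2_norm M f * l2_norm M g"
proof -
  define a b c where "a = (\<integral>x. (f x)\<^sup>2 \<partial>M)" and "b = (\<integral>x. (g x)\<^sup>2 \<partial>M)" and "c = (\<integral>x. f x * g x \<partial>M)"
  have int: "integrable M (\<lambda>x. f x * g x)" "integrable M (\<lambda>x. (f x)\<^sup>2)" "integrable M (\<lambda>x. (g x)\<^sup>2)"
    using assms by (auto intro: square_integrable_mult)
  have quad: "0 \<le> a - 2 * t * c + t\<^sup>2 * b" for t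
  proof -
    have "0 \<le> (\<integral>x. (f x - t * g x)\<^sup>2 \<partial>M)" by simp
    also have "(\<integral>x. (f x - t * g x)\<^sup>2 \<partial>M) = (\<integral>x. (f x)\<^sup>2 - 2 * t * (f x * g x) + t\<^sup>2 * (g x)\<^sup>2 \<partial>M)"
      by (simp add: power2_diff power_mult_distrib algebra_simps)
    also have "\<dots> = a - 2 * t * c + t\<^sup>2 * b"
      using int by (simp add: a_def b_def c_def)
    finally show ?thesis .
  qed
  have "b \<ge> 0" "a \<ge> 0" by (auto simp: a_def b_def)
  have "c\<^sup>2 \<le> a * b"
  proof (cases "b = 0")
    case True
    have "c = 0"
    proof (rule ccontr)
      assume "c \<noteq> 0"
      have "a - 2 * ((a + 1) / (2 * c)) * c = -1" using \<open>c \<noteq> 0\<close> by (simp add: field_simps)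
      then show False using quad[of "(a + 1) / (2 * c)"] True by simp
    qed
    then show ?thesis using True by simp
  next
    case False
    then have "b > 0" using \<open>b \<ge> 0\<close> by simp
    have "0 \<le> a - 2 * (c / b) * c + (c / b)\<^sup>2 * b" by (rule quad)
    also have "\<dots> = a - c\<^sup>2 / b" using \<open>b > 0\<close> by (simp add: field_simps power2_eq_square)
    finally show ?thesis using \<open>b > 0\<close> by (simp add: field_simps)
  qed
  then have "\<bar>c\<bar> \<le> sqrt (a * b)" by (rule real_le_rsqrt[of "\<bar>c\<bar>", simplified])
  then show ?thesis by (simp add: l2_norm_def a_def b_def c_def real_sqrt_mult)
qed

lemma l2_norm_add:
  assumes f: "square_integrable M f" and g: "square_integrable M g"
  shows "l2_norm M (\<lambda>x. f x + g x) \<le> l2_norm M f + l2_norm M g"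
proof -
  have int: "integrable M (\<lambda>x. f x * g x)" "integrable M (\<lambda>x. (f x)\<^sup>2)" "integrable M (\<lambda>x. (g x)\<^sup>2)"
    using assms by (auto intro: square_integrable_mult)
  have "(l2_norm M (\<lambda>x. f x + g x))\<^sup>2 = (\<integral>x. (f x)\<^sup>2 + (g x)\<^sup>2 + 2 * (f x * g x) \<partial>M)"
    by (simp add: l2_norm_power2 power2_sum mult.assoc)
  also have "\<dots> = (l2_norm M f)\<^sup>2 + (l2_norm M g)\<^sup>2 + 2 * (\<integral>x. f x * g x \<partial>M)"
    using int by (simp add: l2_norm_power2)
  also have "\<dots> \<le> (l2_norm M f + l2_norm M g)\<^sup>2"
    using integral_mult_le_l2_norm[OF assms] by (simp add: power2_sum)
  finally show ?thesis by (rule power2_le_imp_le) simp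
qed

lemma l2_norm_diff:
  assumes f: "square_integrable M f" and g: "square_integrable M g"
  shows "l2_norm M (\<lambda>x. f x - g x) \<le> l2_norm M f + l2_norm M g"
  using l2_norm_add[OF f square_integrable_cmult[OF g, of "-1"]] l2_norm_cmult[of M "-1" g] by simp

lemma l2_norm_sum:
  assumes "\<And>i. i \<in> I \<Longrightarrow> square_integrable M (f i)"
  shows "l2_norm M (\<lambda>x. \<Sum>i\<in>I. f i x) \<le> (\<Sum>i\<in>I. l2_norm M (f i))"
  using assms
proof (induction I rule: infinite_finite_induct)
  case (insert i I)
  have "l2_norm M (\<lambda>x. f i x + (\<Sum>j\<in>I. f j x)) \<le> l2_norm M (f i) + l2_norm M (\<lambda>x. \<Sum>j\<in>I. f j x)"
    using insert by (intro l2_norm_add square_integrable_sum) auto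
  with insert show ?case by (simp add: insert.IH) (smt (verit) insert.IH insert.prems insertCI)
qed (simp_all add: l2_norm_def)

lemma l2_norm_eq_0:
  assumes "l2_norm M f = 0" "square_integrable M f"
  shows "AE x in M. f x = 0"
  using assms integral_nonneg_eq_0_iff_AE[of M "\<lambda>x. (f x)\<^sup>2"] by (auto simp: l2_norm_def)

section \<open>Probability spaces: series in \<open>L^2\<close> and almost sure selection of an
  index\<close>

context prob_space
begin

lemma square_integrable_integrable:
  assumes "square_integrable M f"
  shows "integrable M f"
proof -
  have "square_integrable M (\<lambda>_. 1)" by (simp add: square_integrable_def)
  from square_integrable_mult[OF assms this] show ?thesis by simp
qed

lemma integral_abs_le_l2_norm:
  assumes "square_integrable M f"
  shows "(\<integral>x. \<bar>f x\<bar> \<partial>M) \<le> l2_norm M f"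
proof -
  have "square_integrable M (\<lambda>_. 1)" by (simp add: square_integrable_def)
  moreover have "square_integrable M (\<lambda>x. \<bar>f x\<bar>)" using assms by (auto simp: square_integrable_def)
  ultimately have "(\<integral>x. \<bar>f x\<bar> * 1 \<partial>M) \<le> l2_norm M (\<lambda>x. \<bar>f x\<bar>) * l2_norm M (\<lambda>_. 1)"
    by (intro integral_mult_le_l2_norm)
  then show ?thesis by (simp add: l2_norm_def prob_space)
qed

text \<open>The series converges absolutely almost everywhere because its terms are summable in \<open>L\<^sup>1\<close>.\<close>

lemma l2_suminf:
  assumes sq: "\<And>k. square_integrable M (f k)"
    and sum: "summable (\<lambda>k. l2_norm M (f k))"
  shows "square_integrable M (\<lambda>x. \<Sum>k. f k x)"
    and "l2_norm M (\<lambda>x. \<Sum>k. f k x) \<le> (\<Sum>k. l2_norm M (f k))"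
    and "AE x in M. summable (\<lambda>k. f k x)"
proof -
  have [measurable]: "f k \<in> borel_measurable M" for k using sq by auto
  have "(\<integral>\<^sup>+x. (\<Sum>k. ennreal \<bar>f k x\<bar>) \<partial>M) = (\<Sum>k. \<integral>\<^sup>+x. ennreal \<bar>f k x\<bar> \<partial>M)"
    by (rule nn_integral_suminf) auto
  also have "\<dots> \<le> (\<Sum>k. ennreal (l2_norm M (f k)))"
  proof (intro suminf_le)
    fix k
    have "(\<integral>\<^sup>+x. ennreal \<bar>f k x\<bar> \<partial>M) = ennreal (\<integral>x. \<bar>f k x\<bar> \<partial>M)"
      using square_integrable_integrable[OF sq] by (intro nn_integral_eq_integral) auto
    then show "(\<integral>\<^sup>+x. ennreal \<bar>f k x\<bar> \<partial>M) \<le> ennreal (l2_norm M (f k))"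
      using integral_abs_le_l2_norm[OF sq, of k] by (simp add: ennreal_leI)
  qed auto
  also have "\<dots> = ennreal (\<Sum>k. l2_norm M (f k))"
    using sum by (intro suminf_ennreal2) auto
  also have "\<dots> < \<infinity>" by simp
  finally have "AE x in M. (\<Sum>k. ennreal \<bar>f k x\<bar>) \<noteq> \<infinity>"
    by (intro nn_integral_noteq_infinite) auto
  then have ae: "AE x in M. summable (\<lambda>k. \<bar>f k x\<bar>)"
    by eventually_elim (auto intro!: summable_suminf_not_top)
  then show "AE x in M. summable (\<lambda>k. f k x)"
    by eventually_elim (rule summable_rabs_cancel)
  define s where "s n x = (\<Sum>k<n. f k x)" for n x
  have sq_s: "square_integrable M (s n)" for n
    unfolding s_def by (intro square_integrable_sum sq)
  have [measurable]: "s n \<in> borel_measurable M" for n unfolding s_def by measurable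
  have lim: "AE x in M. (\<lambda>n. ennreal ((s n x)\<^sup>2)) \<longlonglongrightarrow> ennreal ((\<Sum>k. f k x)\<^sup>2)"
    using ae
  proof eventually_elim
    case (elim x)
    then have "(\<lambda>n. s n x) \<longlonglongrightarrow> (\<Sum>k. f k x)"
      unfolding s_def by (intro summable_LIMSEQ) (rule summable_rabs_cancel)
    then show ?case by (intro tendsto_ennrealI tendsto_power)
  qed
  define C where "C = (\<Sum>k. l2_norm M (f k))"
  have "C \<ge> 0" unfolding C_def using sum by (intro suminf_nonneg) auto
  have bd: "(\<integral>\<^sup>+x. ennreal ((s n x)\<^sup>2) \<partial>M) \<le> ennreal (C\<^sup>2)" for n
  proof -
    have "l2_norm M (s n) \<le> (\<Sum>k<n. l2_norm M (f k))"
      unfolding s_def by (intro l2_norm_sum sq)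
    also have "\<dots> \<le> C" unfolding C_def using sum by (intro sum_le_suminf) auto
    finally have "(l2_norm M (s n))\<^sup>2 \<le> C\<^sup>2" by (intro power_mono) auto
    moreover have "(\<integral>\<^sup>+x. ennreal ((s n x)\<^sup>2) \<partial>M) = ennreal (\<integral>x. (s n x)\<^sup>2 \<partial>M)"
      using sq_s[of n] by (intro nn_integral_eq_integral) auto
    ultimately show ?thesis by (simp add: l2_norm_power2 ennreal_leI)
  qed
  have "(\<integral>\<^sup>+x. ennreal ((\<Sum>k. f k x)\<^sup>2) \<partial>M) = (\<integral>\<^sup>+x. liminf (\<lambda>n. ennreal ((s n x)\<^sup>2)) \<partial>M)"
  proof (rule nn_integral_cong_AE)
    show "AE x in M. ennreal ((\<Sum>k. f k x)\<^sup>2) = liminf (\<lambda>n. ennreal ((s n x)\<^sup>2))"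
      using lim
    proof eventually_elim
      case (elim x)
      from lim_imp_Liminf[OF sequentially_bot elim] show ?case by (rule sym)
    qed
  qed
  \<comment> \<open>Fatou's lemma carries the uniform bound \<open>C\<close> from the partial sums
    over to the limit, which yields square integrability and the norm estimate at once.\<close>
  also have "\<dots> \<le> liminf (\<lambda>n. \<integral>\<^sup>+x. ennreal ((s n x)\<^sup>2) \<partial>M)"
    by (rule nn_integral_liminf) auto
  also have "\<dots> \<le> ennreal (C\<^sup>2)"
    by (rule Liminf_le) (auto simp: bd)
  finally have nn: "(\<integral>\<^sup>+x. ennreal ((\<Sum>k. f k x)\<^sup>2) \<partial>M) \<le> ennreal (C\<^sup>2)" .
  then have int: "integrable M (\<lambda>x. (\<Sum>k. f k x)\<^sup>2)"
    by (intro integrableI_bounded) (auto simp: le_less_trans)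
  then show "square_integrable M (\<lambda>x. \<Sum>k. f k x)"
    by (auto simp: square_integrable_def)
  have "(l2_norm M (\<lambda>x. \<Sum>k. f k x))\<^sup>2 \<le> C\<^sup>2"
    using nn int by (simp add: l2_norm_power2 nn_integral_eq_integral)
  then show "l2_norm M (\<lambda>x. \<Sum>k. f k x) \<le> (\<Sum>k. l2_norm M (f k))"
    using \<open>C \<ge> 0\<close> unfolding C_def by (rule power2_le_imp_le)
qed

text \<open>The event that \<open>P\<close> fails for every \<open>n >= n0\<close> lies in each
  single failure event, so its probability is below every term of a null sequence. Unlike
  Borel-Cantelli this asks for one good index only. It turns weak type inequalities, whose levels or
  truncations vary with \<open>n\<close>, into almost sure statements.\<close>

lemma AE_exists_small:
  assumes ev: "\<And>n. {x \<in> space M. \<not> P n x} \<in> sets M"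
    and lim: "(\<lambda>n. prob {x \<in> space M. \<not> P n x}) \<longlonglongrightarrow> 0"
  shows "AE x in M. \<exists>n\<ge>n0. P n x"
proof -
  define B where "B = (\<Inter>n\<in>{n0..}. {x \<in> space M. \<not> P n x})"
  have B: "B \<in> sets M" unfolding B_def using ev by (intro sets.countable_INT') auto
  have "prob B \<le> prob {x \<in> space M. \<not> P n x}" if "n \<ge> n0" for n
    using that ev B by (intro finite_measure_mono) (auto simp: B_def)
  then have "eventually (\<lambda>n. prob B \<le> prob {x \<in> space M. \<not> P n x}) sequentially"
    by (auto simp: eventually_sequentially)
  from tendsto_lowerbound[OF lim this] have "prob B = 0"
    using measure_nonneg[of M B] by simp
  then have "AE x in M. x \<notin> B" using B by (simp add: emeasure_eq_measure AE_iff_measurable[OF B] AE_not_in null_setsI)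
  with AE_space show ?thesis by eventually_elim (auto simp: B_def)
qed

end

subsection \<open>The maximal ergodic inequality and Birkhoff's theorem\<close>

text \<open>Garsia's argument, for an abstract positive operator \<open>T\<close> preserving integrals. It is applied
  to composition with a measure preserving map and to the operator \<open>f \<mapsto> E(f \<circ> \<theta> | F)\<close>.\<close>

lemma garsia_maximal:
  fixes s :: "nat \<Rightarrow> 'a \<Rightarrow> real" and T :: "('a \<Rightarrow> real) \<Rightarrow> 'a \<Rightarrow> real"
  assumes int_s: "\<And>k. integrable M (s k)" and int_f: "integrable M f"
    and s_0: "\<And>x. s 0 x = 0"
    and step: "\<And>k. AE x in M. s (Suc k) x \<le> f x + T (s k) x"
    and T_mono: "\<And>g h. integrable M g \<Longrightarrow> integrable M h \<Longrightarrow> (\<And>x. g x \<le> h x) \<Longrightarrow> AE x in M. T g x \<le> T h x"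
    and T_pos: "\<And>g. integrable M g \<Longrightarrow> (\<And>x. 0 \<le> g x) \<Longrightarrow> AE x in M. 0 \<le> T g x"
    and T_int: "\<And>g. integrable M g \<Longrightarrow> integrable M (T g)"
    and T_eq: "\<And>g. integrable M g \<Longrightarrow> (\<integral>x. T g x \<partial>M) = (\<integral>x. g x \<partial>M)"
  shows "0 \<le> (\<integral>x. indicator {x \<in> space M. \<exists>k\<le>N. 0 < s k x} x * f x \<partial>M)"
proof -
  define m where "m x = Max ((\<lambda>k. s k x) ` {..N})" for x
  have [measurable]: "s k \<in> borel_measurable M" for k using int_s by auto
  have m_ge: "s k x \<le> m x" if "k \<le> N" for k x
    unfolding m_def using that by (intro Max_ge) auto
  have m_pos: "0 \<le> m x" for x using m_ge[of 0 x] s_0 by simp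
  have m_ex: "\<exists>k\<le>N. m x = s k x" for x
  proof -
    have "m x \<in> (\<lambda>k. s k x) ` {..N}" unfolding m_def by (intro Max_in) auto
    then show ?thesis by auto
  qed
  have [measurable]: "m \<in> borel_measurable M"
    unfolding m_def by (intro borel_measurable_Max) auto
  have int_m: "integrable M m"
  proof (rule Bochner_Integration.integrable_bound)
    show "integrable M (\<lambda>x. \<Sum>k\<le>N. \<bar>s k x\<bar>)" using int_s by auto
    show "AE x in M. norm (m x) \<le> norm (\<Sum>k\<le>N. \<bar>s k x\<bar>)"
    proof (rule AE_I2)
      fix x
      obtain k where k: "k \<le> N" "m x = s k x" using m_ex by blast
      then have "\<bar>m x\<bar> \<le> (\<Sum>k\<le>N. \<bar>s k x\<bar>)" by (auto intro!: member_le_sum)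
      then show "norm (m x) \<le> norm (\<Sum>k\<le>N. \<bar>s k x\<bar>)" by simp
    qed
  qed fact
  define A where "A = {x \<in> space M. \<exists>k\<le>N. 0 < s k x}"
  have [measurable]: "A \<in> sets M" unfolding A_def by measurable
  have int_A: "integrable M (\<lambda>x. indicator A x * f x)"
    using integrable_mult_indicator[OF \<open>A \<in> sets M\<close> int_f] by simp
  have "AE x in M. \<forall>k. s (Suc k) x \<le> f x + T (s k) x"
    using step by (simp add: AE_all_countable)
  moreover have "AE x in M. \<forall>k\<in>{..N}. T (s k) x \<le> T m x"
    using m_ge by (intro AE_finite_allI T_mono int_s int_m) auto
  moreover have "AE x in M. 0 \<le> T m x"
    using m_pos by (intro T_pos int_m) auto
  \<comment> \<open>The heart of the argument. On \<open>A\<close> the maximum is positive, hence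
    attained at some \<open>Suc i\<close> because \<open>s 0 = 0\<close>, and
    \<open>s i <= m\<close> passes through \<open>T\<close>. Off \<open>A\<close> the maximum is 0
    and \<open>T m\<close> is nonnegative. After integration the two integrals of \<open>m\<close>
    cancel.\<close>
  ultimately have "AE x in M. m x \<le> indicator A x * f x + T m x"
    using AE_space
  proof eventually_elim
    case (elim x)
    obtain k where k: "k \<le> N" "m x = s k x" using m_ex by blast
    show ?case
    proof (cases "x \<in> A")
      case True
      then obtain k' where "k' \<le> N" "0 < s k' x" by (auto simp: A_def)
      then have "0 < m x" using m_ge[of k' x] by simp
      then obtain i where i: "k = Suc i" using k s_0 by (cases k) auto
      have "m x \<le> f x + T (s i) x" using elim(1) k i by simp
      also have "T (s i) x \<le> T m x" using elim(2) k i by simp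
      finally show ?thesis using True by simp
    next
      case False
      then have "s k x \<le> 0" using k elim by (auto simp: A_def not_less)
      then show ?thesis using False elim k by simp
    qed
  qed
  then have "(\<integral>x. m x \<partial>M) \<le> (\<integral>x. indicator A x * f x + T m x \<partial>M)"
    using int_m T_int int_A by (intro integral_mono_AE) auto
  also have "\<dots> = (\<integral>x. indicator A x * f x \<partial>M) + (\<integral>x. m x \<partial>M)"
    using int_m T_int int_A T_eq by simp
  finally show ?thesis by (simp add: A_def)
qed

locale measure_preserving = prob_space M for M :: "'a measure" +
  fixes \<theta> :: "'a \<Rightarrow> 'a"
  assumes meas: "\<theta> \<in> measurable M M" and distr_theta: "distr M M \<theta> = M"
begin

lemma iter_measurable [measurable]: "\<theta> ^^ n \<in> measurable M M"
proof (induction n)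
  case (Suc n)
  then show ?case using meas by (auto intro: measurable_comp)
qed auto

lemma iter_space: "x \<in> space M \<Longrightarrow> (\<theta> ^^ n) x \<in> space M"
  using measurable_space[OF iter_measurable] .

lemma distr_iter: "distr M M (\<theta> ^^ n) = M"
proof (induction n)
  case (Suc n)
  have "distr M M (\<theta> ^^ Suc n) = distr (distr M M (\<theta> ^^ n)) M \<theta>"
    using meas by (simp add: distr_distr)
  also have "\<dots> = M" by (simp only: Suc distr_theta)
  finally show ?case .
qed (simp add: id_def)

lemma measure_preserving_iter: "measure_preserving M (\<theta> ^^ n)"
  by unfold_locales (auto simp: distr_iter)

lemma borel_measurable_iter [measurable (raw)]:
  "f \<in> borel_measurable M \<Longrightarrow> (\<lambda>x. f ((\<theta> ^^ n) x)) \<in> borel_measurable M"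
  using measurable_compose[OF iter_measurable] .

lemma integral_iter:
  fixes f :: "'a \<Rightarrow> real"
  assumes "f \<in> borel_measurable M"
  shows "(\<integral>x. f ((\<theta> ^^ n) x) \<partial>M) = (\<integral>x. f x \<partial>M)"
  using integral_distr[OF iter_measurable assms, of n] by (simp add: distr_iter)

lemma integrable_iter:
  fixes f :: "'a \<Rightarrow> real"
  assumes "integrable M f"
  shows "integrable M (\<lambda>x. f ((\<theta> ^^ n) x))"
  using integrable_distr[OF iter_measurable, of n f] assms by (simp add: distr_iter)

lemma AE_iter:
  assumes "AE x in M. P x"
  shows "AE x in M. P ((\<theta> ^^ n) x)"
proof (rule AE_distrD[OF iter_measurable])
  show "AE x in distr M M (\<theta> ^^ n). P x" unfolding distr_iter by (rule assms)
qed

lemma square_integrable_iter: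
  assumes "square_integrable M f"
  shows "square_integrable M (\<lambda>x. f ((\<theta> ^^ n) x))"
  using assms integrable_iter[of "\<lambda>x. (f x)\<^sup>2" n]
  by (auto simp: square_integrable_def intro: borel_measurable_iter)

lemma l2_norm_iter:
  assumes "f \<in> borel_measurable M"
  shows "l2_norm M (\<lambda>x. f ((\<theta> ^^ n) x)) = l2_norm M f"
  using integral_iter[of "\<lambda>x. (f x)\<^sup>2" n] assms by (simp add: l2_norm_def)



lemma maximal_ergodic:
  assumes f: "integrable M f"
  shows "0 \<le> (\<integral>x. indicator {x \<in> space M. \<exists>k\<le>N. real k * c < (\<Sum>i<k. f ((\<theta> ^^ i) x))} x * (f x - c) \<partial>M)"
proof -
  define s where "s k x = (\<Sum>i<k. f ((\<theta> ^^ i) x)) - real k * c" for k x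
  have "0 \<le> (\<integral>x. indicator {x \<in> space M. \<exists>k\<le>N. 0 < s k x} x * (f x - c) \<partial>M)"
  proof (rule garsia_maximal[where T = "\<lambda>g x. g (\<theta> x)"])
    show "integrable M (s k)" for k
      unfolding s_def using integrable_iter[OF f] by simp
    show "AE x in M. s (Suc k) x \<le> f x - c + s k (\<theta> x)" for k
      unfolding s_def sum.lessThan_Suc_shift
      by (simp add: funpow_Suc_right algebra_simps del: funpow.simps(2))
    show "integrable M (\<lambda>x. g (\<theta> x))" if "integrable M g" for g :: "'a \<Rightarrow> real"
      using integrable_iter[OF that, of 1] by simp
    show "(\<integral>x. g (\<theta> x) \<partial>M) = (\<integral>x. g x \<partial>M)" if "integrable M g" for g :: "'a \<Rightarrow> real"
      using integral_iter[of g 1] that by auto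
  qed (use f in \<open>auto simp: s_def\<close>)
  then show ?thesis by (simp add: s_def)
qed

lemma maximal_ergodic_weak_type:
  assumes f: "integrable M f" "\<And>x. 0 \<le> f x" and c: "0 < c"
  shows "prob {x \<in> space M. \<exists>k. real k * c < (\<Sum>i<k. f ((\<theta> ^^ i) x))} \<le> (\<integral>x. f x \<partial>M) / c"
proof -
  define A where "A N = {x \<in> space M. \<exists>k\<le>N. real k * c < (\<Sum>i<k. f ((\<theta> ^^ i) x))}" for N :: nat
  have [measurable]: "f \<in> borel_measurable M" using f by auto
  have [measurable]: "A N \<in> sets M" for N unfolding A_def by measurable
  have A_le: "prob (A N) \<le> (\<integral>x. f x \<partial>M) / c" for N
  proof -
    have int: "integrable M (\<lambda>x. indicator (A N) x * f x)"
      using integrable_mult_indicator[OF \<open>A N \<in> sets M\<close> f(1)] by simp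
    have ind: "integrable M (indicat_real (A N))"
      by (intro integrable_real_indicator) (auto simp: less_top[symmetric])
    have "0 \<le> (\<integral>x. indicator (A N) x * (f x - c) \<partial>M)"
      unfolding A_def by (rule maximal_ergodic[OF f(1)])
    also have "\<dots> = (\<integral>x. indicator (A N) x * f x \<partial>M) - c * prob (A N)"
      using int ind by (simp add: right_diff_distrib mult.commute[of _ c])
    also have "(\<integral>x. indicator (A N) x * f x \<partial>M) \<le> (\<integral>x. f x \<partial>M)"
      using f int by (intro integral_mono) (auto simp: indicator_def)
    finally show ?thesis using c by (simp add: field_simps)
  qed
  have "(\<lambda>N. prob (A N)) \<longlonglongrightarrow> prob (\<Union>N. A N)"
    by (rule finite_Lim_measure_incseq) (auto simp: incseq_def A_def intro: order_trans)
  then have "prob (\<Union>N. A N) \<le> (\<integral>x. f x \<partial>M) / c"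
    by (rule LIMSEQ_le_const2) (use A_le in auto)
  also have "(\<Union>N. A N) = {x \<in> space M. \<exists>k. real k * c < (\<Sum>i<k. f ((\<theta> ^^ i) x))}"
    by (auto simp: A_def)
  finally show ?thesis .
qed

end

locale ergodic_system = measure_preserving +
  assumes ergodic: "A \<in> sets M \<Longrightarrow> \<theta> -` A \<inter> space M = A \<Longrightarrow> prob A = 0 \<or> prob A = 1"
begin

text \<open>That the sums centred at \<open>c\<close> are unbounded above is a shift invariant
  event, so it has probability 0 or 1. If it had probability 1, the events of the maximal inequality
  would exhaust the space and give 0 <= E f - c, against the choice of \<open>c\<close>.\<close>

lemma birkhoff_upper:
  assumes f: "integrable M f" and c: "(\<integral>x. f x \<partial>M) < c"
  shows "AE x in M. \<exists>C. \<forall>n. (\<Sum>i<n. f ((\<theta> ^^ i) x)) \<le> real n * c + C"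
proof -
  have [measurable]: "f \<in> borel_measurable M" using f by auto
  define s where "s n x = (\<Sum>i<n. f ((\<theta> ^^ i) x)) - real n * c" for n x
  have [measurable]: "s n \<in> borel_measurable M" for n unfolding s_def by measurable
  define B where "B = {x \<in> space M. \<forall>C::nat. \<exists>n. real C < s n x}"
  have [measurable]: "B \<in> sets M" unfolding B_def by measurable
  have s_shift: "s n (\<theta> x) = s (Suc n) x - (f x - c)" for n x
    unfolding s_def sum.lessThan_Suc_shift
    by (simp add: funpow_Suc_right algebra_simps del: funpow.simps(2))
  have unbdd: "x \<in> B \<longleftrightarrow> x \<in> space M \<and> (\<forall>C. \<exists>n. C < s n x)" for x
    unfolding B_def by (auto, metis reals_Archimedean2 less_trans)
  have "\<theta> x \<in> B \<longleftrightarrow> x \<in> B" if "x \<in> space M" for x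
  proof -
    have "\<theta> x \<in> space M" using iter_space[OF that, of 1] by simp
    moreover have "(\<forall>C. \<exists>n. C < s n (\<theta> x)) \<longleftrightarrow> (\<forall>C. \<exists>n. C < s n x)"
    proof safe
      fix C assume "\<forall>C. \<exists>n. C < s n (\<theta> x)"
      then obtain n where "C - (f x - c) < s n (\<theta> x)" by blast
      then have "C < s (Suc n) x" unfolding s_shift by simp
      then show "\<exists>n. C < s n x" by blast
    next
      fix C assume "\<forall>C. \<exists>n. C < s n x"
      \<comment> \<open>The maximum with 0 excludes \<open>n = 0\<close>, where the centred sum
        vanishes, so that a predecessor exists.\<close>
      then obtain n where n: "max 0 (C + (f x - c)) < s n x" by blast
      then obtain k where "n = Suc k" by (cases n) (auto simp: s_def)
      then have "C < s k (\<theta> x)" using n unfolding s_shift by simp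
      then show "\<exists>n. C < s n (\<theta> x)" by blast
    qed
    ultimately show ?thesis using that by (simp add: unbdd)
  qed
  then have "\<theta> -` B \<inter> space M = B" using sets.sets_into_space[OF \<open>B \<in> sets M\<close>] by auto
  then have "prob B = 0 \<or> prob B = 1" using ergodic by simp
  moreover have "prob B \<noteq> 1"
  proof
    assume B1: "prob B = 1"
    define A where "A N = {x \<in> space M. \<exists>k\<le>N. 0 < s k x}" for N :: nat
    have [measurable]: "A N \<in> sets M" for N unfolding A_def by measurable
    have int: "integrable M (\<lambda>x. f x - c)" using f by simp
    have "(\<lambda>N. \<integral>x. indicator (A N) x * (f x - c) \<partial>M) \<longlonglongrightarrow> (\<integral>x. indicator (\<Union>N. A N) x * (f x - c) \<partial>M)"
      using set_integral_cont_up[of A M "\<lambda>x. f x - c"] integrable_mult_indicator[OF _ int, of "\<Union>N. A N"]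
      by (auto simp: set_lebesgue_integral_def set_integrable_def incseq_def A_def intro: order_trans)
    moreover have "0 \<le> (\<integral>x. indicator (A N) x * (f x - c) \<partial>M)" for N
      using maximal_ergodic[OF f, of N c] by (simp add: A_def s_def)
    ultimately have "0 \<le> (\<integral>x. indicator (\<Union>N. A N) x * (f x - c) \<partial>M)"
      by (intro LIMSEQ_le_const[where X = "\<lambda>N. \<integral>x. indicator (A N) x * (f x - c) \<partial>M"]) auto
    also have "\<dots> = (\<integral>x. f x - c \<partial>M)"
    proof (rule integral_cong_AE)
      have "AE x in M. x \<in> B" using B1 by (simp add: prob_eq_1)
      then show "AE x in M. indicator (\<Union>N. A N) x * (f x - c) = f x - c"
      proof eventually_elim
        case (elim x)
        then obtain n where "0 < s n x" by (auto simp: unbdd)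
        then have "x \<in> (\<Union>N. A N)" using elim by (auto simp: A_def unbdd)
        then show ?case by simp
      qed
    qed auto
    also have "\<dots> < 0" using f c by (simp add: prob_space)
    finally show False by simp
  qed
  ultimately have "AE x in M. x \<notin> B" by (simp add: AE_not_in null_setsI emeasure_eq_measure)
  with AE_space show ?thesis
  proof eventually_elim
    case (elim x)
    then obtain C where "\<And>n. s n x \<le> C" by (auto simp: unbdd not_less)
    then show ?case unfolding s_def by (intro exI[of _ C] allI) (simp add: algebra_simps)
  qed
qed

theorem birkhoff:
  assumes f: "integrable M f"
  shows "AE x in M. (\<lambda>n. (\<Sum>i<n. f ((\<theta> ^^ i) x)) / real n) \<longlonglongrightarrow> (\<integral>x. f x \<partial>M)"
proof -
  define a where "a = (\<integral>x. f x \<partial>M)"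
  have "AE x in M. \<forall>m::nat. \<exists>C. \<forall>n. (\<Sum>i<n. f ((\<theta> ^^ i) x)) \<le> real n * (a + 1 / real (Suc m)) + C"
    unfolding AE_all_countable using f by (auto intro!: birkhoff_upper simp: a_def)
  moreover have "AE x in M. \<forall>m::nat. \<exists>C. \<forall>n. (\<Sum>i<n. - f ((\<theta> ^^ i) x)) \<le> real n * (- a + 1 / real (Suc m)) + C"
    unfolding AE_all_countable using f
    by (intro allI birkhoff_upper[of "\<lambda>x. - f x"]) (auto simp: a_def)
  ultimately show ?thesis
  proof eventually_elim
    case (elim x)
    show ?case unfolding a_def[symmetric]
    proof (rule LIMSEQ_I)
      fix r :: real assume r: "0 < r"
      obtain m :: nat where m: "1 / real (Suc m) < r / 2"
        using nat_approx_posE[of "r/2"] r by auto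
      define S where "S n = (\<Sum>i<n. f ((\<theta> ^^ i) x))" for n
      obtain C1 where C1: "\<And>n. S n \<le> real n * (a + 1 / real (Suc m)) + C1"
        using elim(1) unfolding S_def by blast
      obtain C2 where C2: "\<And>n. - S n \<le> real n * (- a + 1 / real (Suc m)) + C2"
        using elim(2) unfolding S_def sum_negf by blast
      obtain N :: nat where N: "max \<bar>C1\<bar> \<bar>C2\<bar> / (r / 2) < real N" using reals_Archimedean2 by blast
      show "\<exists>N. \<forall>n\<ge>N. norm ((\<Sum>i<n. f ((\<theta> ^^ i) x)) / real n - a) < r"
      proof (intro exI[of _ "Suc N"] allI impI)
        fix n assume n: "Suc N \<le> n"
        then have "max \<bar>C1\<bar> \<bar>C2\<bar> / (r / 2) < real n" using N by linarith
        then have bd: "max \<bar>C1\<bar> \<bar>C2\<bar> < real n * (r / 2)" using r by (simp add: field_simps)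
        have n0: "real n > 0" using n by simp
        have "real n * (1 / real (Suc m)) \<le> real n * (r / 2)" using m n0 by (intro mult_left_mono) auto
        moreover have "C1 \<le> max \<bar>C1\<bar> \<bar>C2\<bar>" "C2 \<le> max \<bar>C1\<bar> \<bar>C2\<bar>" by auto
        ultimately have "S n - real n * a < real n * r" "- (S n - real n * a) < real n * r"
          using C1[of n] C2[of n] bd unfolding distrib_left mult_minus_right by linarith+
        then have "\<bar>S n - real n * a\<bar> < real n * r" by linarith
        moreover have "S n / real n - a = (S n - real n * a) / real n" using n0 by (simp add: field_simps)
        ultimately show "norm ((\<Sum>i<n. f ((\<theta> ^^ i) x)) / real n - a) < r"
          using n0 by (simp add: S_def[symmetric] field_simps abs_mult)
      qed
    qed
  qed
qed

text \<open>Up to a factor (n + 1) / n, the term is a difference of two consecutive averages, which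
  have the same limit.\<close>

corollary iter_over_n_tendsto_0:
  assumes f: "integrable M f"
  shows "AE x in M. (\<lambda>n. f ((\<theta> ^^ n) x) / real n) \<longlonglongrightarrow> 0"
  using birkhoff[OF f]
proof eventually_elim
  case (elim x)
  define a where "a = (\<integral>x. f x \<partial>M)"
  define S where "S n = (\<Sum>i<n. f ((\<theta> ^^ i) x))" for n
  have S: "(\<lambda>n. S n / real n) \<longlonglongrightarrow> a" using elim by (simp add: S_def a_def)
  have "(\<lambda>n. S (Suc n) / real (Suc n) * (real (Suc n) / real n) - S n / real n) \<longlonglongrightarrow> a * 1 - a"
    by (intro tendsto_intros LIMSEQ_Suc[OF S] LIMSEQ_Suc_n_over_n S)
  then have "(\<lambda>n. S (Suc n) / real (Suc n) * (real (Suc n) / real n) - S n / real n) \<longlonglongrightarrow> 0"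
    by simp
  moreover have "S (Suc n) / real (Suc n) * (real (Suc n) / real n) - S n / real n = f ((\<theta> ^^ n) x) / real n" for n
  proof -
    have "S (Suc n) / real (Suc n) * (real (Suc n) / real n) = S (Suc n) / real n"
      by (simp del: of_nat_Suc)
    then show ?thesis by (simp add: S_def diff_divide_distrib[symmetric])
  qed
  ultimately show ?case by simp
qed

end

subsection \<open>Almost sure \<open>o(\<surd>n)\<close> bounds for sums along an orbit\<close>

lemma ennreal_le_suminf: "f i \<le> (\<Sum>i. f i :: ennreal)"
  using sum_le_suminf[of f "{i}"] by simp

text \<open>A decomposition into the layers c 2^i. Values up to \<open>c\<close> contribute at most
  \<open>c\<close>; where the function exceeds c 2^i it is charged c 2^(i+1), and the tail bound
  4^(-i) leaves a geometric series with sum 4 c.\<close>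

lemma (in prob_space) nn_integral_le_of_weak_L2:
  fixes \<xi> :: "'a \<Rightarrow> ennreal"
  assumes [measurable]: "\<xi> \<in> borel_measurable M" and c: "0 < c"
    and tail: "\<And>t. 0 < t \<Longrightarrow> prob {x \<in> space M. ennreal t < \<xi> x} \<le> c\<^sup>2 / t\<^sup>2"
  shows "(\<integral>\<^sup>+x. \<xi> x \<partial>M) \<le> ennreal (5 * c)"
proof -
  define A where "A i = {x \<in> space M. ennreal (c * 2 ^ i) < \<xi> x}" for i :: nat
  have [measurable]: "A i \<in> sets M" for i unfolding A_def by measurable
  have pointwise: "\<xi> x \<le> ennreal c + (\<Sum>i. ennreal (c * 2 ^ Suc i) * indicator (A i) x)"
    if x: "x \<in> space M" for x
  proof (rule dense_le)
    fix y assume y: "y < \<xi> x"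
    then obtain r where r: "y = ennreal r" "0 \<le> r" by (cases y) auto
    show "y \<le> ennreal c + (\<Sum>i. ennreal (c * 2 ^ Suc i) * indicator (A i) x)"
    proof (cases "r \<le> c")
      case True
      then have "y \<le> ennreal c" using r by (simp add: ennreal_leI)
      then show ?thesis by (rule order_trans) simp
    next
      case False
      obtain n where "r / c < 2 ^ n" using real_arch_pow[of 2 "r / c"] by auto
      then have ex: "\<exists>n. r \<le> c * 2 ^ n" using c by (auto simp: field_simps intro!: exI[of _ n])
      \<comment> \<open>The least level above \<open>r\<close>: the preceding level lies below
        \<open>y\<close>, so \<open>x\<close> is in the corresponding \<open>A i\<close>, while the
        charge c 2^(i+1) still covers \<open>r\<close>. One term of the series is enough.\<close>
      define n where "n = (LEAST n. r \<le> c * 2 ^ n)"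
      have n: "r \<le> c * 2 ^ n" using LeastI_ex[OF ex] by (simp add: n_def)
      obtain i where i: "n = Suc i" using n False by (cases n) auto
      have "\<not> r \<le> c * 2 ^ i" using not_less_Least[of i "\<lambda>n. r \<le> c * 2 ^ n"] i by (simp add: n_def)
      then have "ennreal (c * 2 ^ i) \<le> y" using r by (simp add: ennreal_leI)
      then have "x \<in> A i" using y x by (auto simp: A_def)
      then have "y \<le> ennreal (c * 2 ^ Suc i) * indicator (A i) x"
        using n r i by (simp add: ennreal_leI)
      also have "\<dots> \<le> (\<Sum>i. ennreal (c * 2 ^ Suc i) * indicator (A i) x)"
        by (rule ennreal_le_suminf)
      finally show ?thesis by (rule order_trans) simp
    qed
  qed
  have "(\<integral>\<^sup>+x. \<xi> x \<partial>M) \<le> (\<integral>\<^sup>+x. ennreal c + (\<Sum>i. ennreal (c * 2 ^ Suc i) * indicator (A i) x) \<partial>M)"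
    using pointwise by (rule nn_integral_mono)
  also have "\<dots> = ennreal c + (\<Sum>i. ennreal (c * 2 ^ Suc i) * emeasure M (A i))"
    by (subst nn_integral_add) (auto simp: nn_integral_suminf nn_integral_cmult emeasure_space_1)
  also have "(\<Sum>i. ennreal (c * 2 ^ Suc i) * emeasure M (A i)) \<le> (\<Sum>i. ennreal (2 * c * (1 / 2) ^ i))"
  proof (rule suminf_le)
    fix i
    have "c * 2 ^ Suc i * prob (A i) \<le> c * 2 ^ Suc i * (c\<^sup>2 / (c * 2 ^ i)\<^sup>2)"
      unfolding A_def using c by (intro mult_left_mono tail) auto
    also have "\<dots> = 2 * c * (1 / 2) ^ i"
      using c by (simp add: power2_eq_square field_simps)
    finally show "ennreal (c * 2 ^ Suc i) * emeasure M (A i) \<le> ennreal (2 * c * (1 / 2) ^ i)"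
      using c by (simp add: emeasure_eq_measure ennreal_mult[symmetric] ennreal_leI)
  qed auto
  also have "(\<Sum>i. ennreal (2 * c * (1 / 2) ^ i)) = ennreal (4 * c)"
    using c by (subst suminf_ennreal2) (auto simp: suminf_mult suminf_geometric intro!: summable_mult summable_geometric)
  finally show ?thesis using c by (simp add: ennreal_plus[symmetric] del: ennreal_plus)
qed

text \<open>A weak type (1,1) bound for the averages of Z^2 is a weak \<open>L^2\<close> bound for
  their square roots, whose supremum is therefore integrable. A constant above the norm is allowed
  so that it can be positive even when \<open>Z\<close> vanishes.\<close>

lemma (in measure_preserving) nn_integral_maximal_sqrt:
  assumes Z: "square_integrable M Z" and c: "l2_norm M Z \<le> c" "0 < c"
  shows "(\<integral>\<^sup>+x. (SUP n. ennreal (sqrt ((\<Sum>i<n. (Z ((\<theta> ^^ i) x))\<^sup>2) / real n))) \<partial>M) \<le> ennreal (5 * c)"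
proof (rule nn_integral_le_of_weak_L2)
  have [measurable]: "Z \<in> borel_measurable M" using Z by auto
  show "(\<lambda>x. SUP n. ennreal (sqrt ((\<Sum>i<n. (Z ((\<theta> ^^ i) x))\<^sup>2) / real n))) \<in> borel_measurable M"
    by measurable
  fix t :: real assume t: "0 < t"
  have "prob {x \<in> space M. ennreal t < (SUP n. ennreal (sqrt ((\<Sum>i<n. (Z ((\<theta> ^^ i) x))\<^sup>2) / real n)))}
    \<le> prob {x \<in> space M. \<exists>n. real n * t\<^sup>2 < (\<Sum>i<n. (Z ((\<theta> ^^ i) x))\<^sup>2)}"
  proof (rule finite_measure_mono)
    show "{x \<in> space M. ennreal t < (SUP n. ennreal (sqrt ((\<Sum>i<n. (Z ((\<theta> ^^ i) x))\<^sup>2) / real n)))}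
      \<subseteq> {x \<in> space M. \<exists>n. real n * t\<^sup>2 < (\<Sum>i<n. (Z ((\<theta> ^^ i) x))\<^sup>2)}"
    proof safe
      fix x assume "ennreal t < (SUP n. ennreal (sqrt ((\<Sum>i<n. (Z ((\<theta> ^^ i) x))\<^sup>2) / real n)))"
      then obtain n where "ennreal t < ennreal (sqrt ((\<Sum>i<n. (Z ((\<theta> ^^ i) x))\<^sup>2) / real n))"
        by (auto simp: less_SUP_iff)
      then have n: "t < sqrt ((\<Sum>i<n. (Z ((\<theta> ^^ i) x))\<^sup>2) / real n)"
        using t by (simp add: ennreal_less_iff)
      then have "t\<^sup>2 < (\<Sum>i<n. (Z ((\<theta> ^^ i) x))\<^sup>2) / real n"
        using t by (smt (verit) real_sqrt_le_iff real_sqrt_unique)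
      moreover have "n > 0" using n t by (cases n) auto
      ultimately have "real n * t\<^sup>2 < (\<Sum>i<n. (Z ((\<theta> ^^ i) x))\<^sup>2)" by (simp add: field_simps)
      then show "\<exists>n. real n * t\<^sup>2 < (\<Sum>i<n. (Z ((\<theta> ^^ i) x))\<^sup>2)" ..
    qed
  qed measurable
  also have "\<dots> \<le> (\<integral>x. (Z x)\<^sup>2 \<partial>M) / t\<^sup>2"
    using t Z by (intro maximal_ergodic_weak_type) auto
  also have "\<dots> \<le> c\<^sup>2 / t\<^sup>2"
    using c unfolding l2_norm_power2[symmetric] by (intro divide_right_mono power_mono) auto
  finally show "prob {x \<in> space M. ennreal t < (SUP n. ennreal (sqrt ((\<Sum>i<n. (Z ((\<theta> ^^ i) x))\<^sup>2) / real n)))}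
    \<le> c\<^sup>2 / t\<^sup>2" .
qed fact

text \<open>Passing from \<open>n\<close> to the even number 2 (n div 2) costs at most one increment
  of scale 0. What remains is the same problem for \<open>\<lambda>k. u (2 * k)\<close>, one scale
  coarser, so each scale is paid for once.\<close>

lemma dyadic_chaining:
  fixes u :: "nat \<Rightarrow> real"
  assumes "u 0 = 0" "n \<le> 2 ^ r"
    and "\<And>j q. j \<le> r \<Longrightarrow> q < 2 ^ (r - j) \<Longrightarrow> \<bar>u (Suc q * 2 ^ j) - u (q * 2 ^ j)\<bar> \<le> b j"
  shows "\<bar>u n\<bar> \<le> (\<Sum>j\<le>r. b j)"
  using assms
proof (induction r arbitrary: u n b)
  case 0
  have "\<bar>u 1\<bar> \<le> b 0" using 0(3)[of 0 0] 0(1) by simp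
  moreover have "n = 0 \<or> n = 1" using 0(2) by auto
  ultimately show ?case using 0(1) by auto
next
  case (Suc r)
  have step: "\<bar>u (Suc q) - u q\<bar> \<le> b 0" if "q < 2 ^ Suc r" for q
    using Suc.prems(3)[of 0 q] that by simp
  define k where "k = n div 2"
  have "\<bar>u (2 * k)\<bar> \<le> (\<Sum>j\<le>r. b (Suc j))"
  proof (rule Suc.IH[of "\<lambda>k. u (2 * k)"])
    fix j q :: nat assume "j \<le> r" "q < 2 ^ (r - j)"
    then show "\<bar>u (2 * (Suc q * 2 ^ j)) - u (2 * (q * 2 ^ j))\<bar> \<le> b (Suc j)"
      using Suc.prems(3)[of "Suc j" q] by (simp add: algebra_simps)
  qed (use Suc.prems in \<open>auto simp: k_def\<close>)
  moreover have "\<bar>u n - u (2 * k)\<bar> \<le> b 0"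
  proof (cases "even n")
    case True
    then show ?thesis using step[of 0] by (simp add: k_def)
  next
    case False
    then have "n = Suc (2 * k)" by (simp add: k_def)
    then show ?thesis using step[of "2 * k"] Suc.prems(2) by simp
  qed
  ultimately show ?case unfolding sum.atMost_Suc_shift by simp
qed

text \<open>The finitely many small indices contribute a constant, negligible against sqrt N; every
  other \<open>w q\<close> is below e/2 sqrt q and hence below e/2 sqrt N.\<close>

lemma Max_over_sqrt_tendsto_0:
  fixes w :: "nat \<Rightarrow> real"
  assumes pos: "\<And>q. 0 \<le> w q" and lim: "(\<lambda>q. w q / sqrt (real q)) \<longlonglongrightarrow> 0"
  shows "(\<lambda>N. Max (w ` {..<N}) / sqrt (real N)) \<longlonglongrightarrow> 0"
proof (rule LIMSEQ_I)
  fix e :: real assume e: "0 < e"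
  from LIMSEQ_D[OF lim, of "e / 2"] e
  obtain q0 where q0: "\<And>q. q0 \<le> q \<Longrightarrow> norm (w q / sqrt (real q) - 0) < e / 2" by auto
  define C where "C = (\<Sum>q<Suc q0. w q)"
  have "0 \<le> C" unfolding C_def using pos by (intro sum_nonneg) auto
  obtain N0 :: nat where N0: "(C / (e / 2))\<^sup>2 < real N0" using reals_Archimedean2 by blast
  show "\<exists>no. \<forall>N\<ge>no. norm (Max (w ` {..<N}) / sqrt (real N) - 0) < e"
  proof (intro exI[of _ "Suc N0"] allI impI)
    fix N assume N: "Suc N0 \<le> N"
    then have "(C / (e / 2))\<^sup>2 \<le> real N" using N0 by simp
    then have "C / (e / 2) \<le> sqrt (real N)" by (rule real_le_rsqrt)
    then have C: "C \<le> e / 2 * sqrt (real N)" using e by (simp add: field_simps)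
    have ne: "{..<N} \<noteq> {}" using N by (auto simp: lessThan_empty_iff)
    have "w q \<le> e / 2 * sqrt (real N)" if "q < N" for q
    proof (cases "q < Suc q0")
      case True
      then have "w q \<le> C" unfolding C_def using pos by (intro member_le_sum) auto
      then show ?thesis using C by simp
    next
      case False
      then have "w q \<le> e / 2 * sqrt (real q)" using q0[of q] pos[of q] by (simp add: field_simps)
      also have "\<dots> \<le> e / 2 * sqrt (real N)" using that e by (intro mult_left_mono) auto
      finally show ?thesis .
    qed
    then have "Max (w ` {..<N}) \<le> e / 2 * sqrt (real N)" using ne by (intro Max.boundedI) auto
    also have "\<dots> < e * sqrt (real N)" using e N by simp
    finally have "Max (w ` {..<N}) < e * sqrt (real N)" .
    moreover have "0 \<le> Max (w ` {..<N})" using pos[of 0] ne N by (intro Max_ge_iff[THEN iffD2]) auto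
    ultimately show "norm (Max (w ` {..<N}) / sqrt (real N) - 0) < e"
      using N by (simp add: field_simps)
  qed
qed

text \<open>Starting at time 0 gives the cocycle identity \<open>orbit_sum_add\<close> without
  corrections. A sum starting at time 1 is the orbit sum of f o \<open>\<theta>\<close>.\<close>

definition orbit_sum :: "('a \<Rightarrow> 'a) \<Rightarrow> ('a \<Rightarrow> real) \<Rightarrow> nat \<Rightarrow> 'a \<Rightarrow> real" where
  "orbit_sum \<theta> f n x = (\<Sum>k<n. f ((\<theta> ^^ k) x))"

lemma orbit_sum_add: "orbit_sum \<theta> f (m + n) x = orbit_sum \<theta> f m x + orbit_sum \<theta> f n ((\<theta> ^^ m) x)"
proof (induction n)
  case (Suc n)
  have "(\<theta> ^^ (m + n)) x = (\<theta> ^^ n) ((\<theta> ^^ m) x)"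
    by (metis add.commute comp_apply funpow_add)
  with Suc show ?case by (simp add: orbit_sum_def)
qed (simp add: orbit_sum_def)

lemma (in measure_preserving) square_integrable_orbit_sum:
  "square_integrable M f \<Longrightarrow> square_integrable M (orbit_sum \<theta> f n)"
  unfolding orbit_sum_def by (intro square_integrable_sum square_integrable_iter)

lemma (in measure_preserving) orbit_sum_measurable [measurable]:
  "f \<in> borel_measurable M \<Longrightarrow> orbit_sum \<theta> f n \<in> borel_measurable M"
  unfolding orbit_sum_def by measurable

text \<open>Chaining over dyadic blocks: the block maxima of length \<open>2 ^ j\<close> are dominated by the maximal
  function of the square of the \<open>2 ^ j\<close>-th partial sum, whose weak norms are summable, and each of
  them is negligible by Birkhoff's theorem.\<close>

theorem (in ergodic_system) orbit_sum_over_sqrt_tendsto_0: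
  assumes f: "square_integrable M f"
    and sum: "summable (\<lambda>j. l2_norm M (orbit_sum \<theta> f (2 ^ j)) / sqrt (2 ^ j))"
  shows "AE x in M. (\<lambda>n. orbit_sum \<theta> f n x / sqrt (real n)) \<longlonglongrightarrow> 0"
proof -
  define Z where "Z j = orbit_sum \<theta> f (2 ^ j)" for j :: nat
  have Z: "square_integrable M (Z j)" for j
    unfolding Z_def using f by (rule square_integrable_orbit_sum)
  have [measurable]: "Z j \<in> borel_measurable M" for j using Z by auto
  \<comment> \<open>The power \<open>T j\<close> preserves the measure but need not be ergodic. The
    maximal inequality, which asks only for invariance, is applied to \<open>T j\<close>, and
    Birkhoff's theorem to \<open>\<theta>\<close> itself.\<close>
  define T where "T j = \<theta> ^^ (2 ^ j)" for j :: nat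
  have T_pow: "(T j ^^ q) x = (\<theta> ^^ (q * 2 ^ j)) x" for j q x
    unfolding T_def by (simp add: funpow_mult mult.commute)
  define \<xi> where "\<xi> j x = (SUP n. ennreal (sqrt ((\<Sum>i<n. (Z j ((T j ^^ i) x))\<^sup>2) / real n)))" for j x
  have [measurable]: "\<xi> j \<in> borel_measurable M" for j unfolding \<xi>_def T_pow by measurable
  \<comment> \<open>The added 1 makes \<open>c j\<close> positive. After division by sqrt(2^j) it
    contributes a convergent geometric series.\<close>
  define c where "c j = l2_norm M (Z j) + 1" for j
  define d where "d j = l2_norm M (Z j) / sqrt (2 ^ j) + (1 / sqrt 2) ^ j" for j
  have sum_d: "summable d"
    unfolding d_def using sum by (intro summable_add summable_geometric) (auto simp: Z_def)
  have c_nonneg: "0 \<le> c j" for j by (simp add: c_def)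
  have d_eq: "d j = c j / sqrt (2 ^ j)" for j
    by (simp add: d_def c_def add_divide_distrib power_one_over real_sqrt_power)
  have d_nonneg: "0 \<le> d j" for j by (simp add: d_def)
  have int_xi: "(\<integral>\<^sup>+x. \<xi> j x \<partial>M) \<le> ennreal (5 * c j)" for j
  proof -
    interpret T: measure_preserving M "T j" unfolding T_def by (rule measure_preserving_iter)
    show ?thesis unfolding \<xi>_def
      by (rule T.nn_integral_maximal_sqrt[OF Z]) (auto simp: c_def intro: add_nonneg_pos)
  qed
  have "(\<integral>\<^sup>+x. (\<Sum>j. ennreal (1 / sqrt (2 ^ j)) * \<xi> j x) \<partial>M) = (\<Sum>j. ennreal (1 / sqrt (2 ^ j)) * (\<integral>\<^sup>+x. \<xi> j x \<partial>M))"
    by (simp add: nn_integral_suminf nn_integral_cmult)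
  also have "\<dots> \<le> (\<Sum>j. ennreal (5 * d j))"
  proof (rule suminf_le)
    fix j
    have "ennreal (1 / sqrt (2 ^ j)) * (\<integral>\<^sup>+x. \<xi> j x \<partial>M) \<le> ennreal (1 / sqrt (2 ^ j)) * ennreal (5 * c j)"
      by (intro mult_left_mono int_xi) auto
    also have "\<dots> = ennreal (5 * d j)"
      using c_nonneg[of j] by (simp add: ennreal_mult[symmetric] d_eq)
    finally show "ennreal (1 / sqrt (2 ^ j)) * (\<integral>\<^sup>+x. \<xi> j x \<partial>M) \<le> ennreal (5 * d j)" .
  qed auto
  also have "\<dots> = ennreal (\<Sum>j. 5 * d j)"
    by (rule suminf_ennreal2) (simp_all add: d_nonneg sum_d)
  finally have "AE x in M. (\<Sum>j. ennreal (1 / sqrt (2 ^ j)) * \<xi> j x) \<noteq> \<infinity>"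
    by (intro nn_integral_noteq_infinite) (auto simp: top_unique)
  moreover have "AE x in M. \<forall>j. (\<lambda>n. (Z j ((\<theta> ^^ n) x))\<^sup>2 / real n) \<longlonglongrightarrow> 0"
    unfolding AE_all_countable using Z by (auto intro!: iter_over_n_tendsto_0)
  ultimately show ?thesis
  proof eventually_elim
    case (elim x)
    define w where "w j q = \<bar>Z j ((\<theta> ^^ (q * 2 ^ j)) x)\<bar>" for j q
    \<comment> \<open>Scales above \<open>r\<close> get the value 0, so that the sum over
      \<open>j <= r\<close> becomes a full series dominated by the sequence \<open>b\<close>, which
      does not depend on \<open>r\<close>: the setting of Tannery's theorem.\<close>
    define v where "v j r = (if j \<le> r then Max (w j ` {..<2 ^ (r - j)}) / sqrt (2 ^ r) else 0)" for j r :: nat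
    have fin: "\<xi> j x \<noteq> \<infinity>" for j
    proof
      assume "\<xi> j x = \<infinity>"
      then have "ennreal (1 / sqrt (2 ^ j)) * \<xi> j x = \<infinity>" by (simp add: ennreal_mult_top)
      moreover have "ennreal (1 / sqrt (2 ^ j)) * \<xi> j x \<le> (\<Sum>j. ennreal (1 / sqrt (2 ^ j)) * \<xi> j x)"
        by (rule ennreal_le_suminf)
      ultimately show False using elim(1) by (simp add: top_unique)
    qed
    define b where "b j = 1 / sqrt (2 ^ j) * enn2real (\<xi> j x)" for j
    have "ennreal (b j) = ennreal (1 / sqrt (2 ^ j)) * \<xi> j x" for j
      unfolding b_def using fin[of j] by (subst ennreal_mult) (auto simp: ennreal_enn2real_if)
    then have sum_b: "summable b"
      using elim(1) by (intro summable_suminf_not_top) (auto simp: b_def)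
    have w_nonneg: "0 \<le> w j q" for j q by (simp add: w_def)
    have w_le: "w j q \<le> sqrt N * enn2real (\<xi> j x)" if "q < N" for j q N
    proof -
      have "(w j q)\<^sup>2 \<le> (\<Sum>i<N. (Z j ((T j ^^ i) x))\<^sup>2)"
        unfolding w_def power2_abs T_pow using that
        by (intro member_le_sum[where f = "\<lambda>i. (Z j ((\<theta> ^^ (i * 2 ^ j)) x))\<^sup>2"]) auto
      also have "\<dots> = real N * ((\<Sum>i<N. (Z j ((T j ^^ i) x))\<^sup>2) / real N)" using that by simp
      finally have "w j q \<le> sqrt (real N * ((\<Sum>i<N. (Z j ((T j ^^ i) x))\<^sup>2) / real N))"
        by (rule real_le_rsqrt)
      also have "\<dots> = sqrt N * sqrt ((\<Sum>i<N. (Z j ((T j ^^ i) x))\<^sup>2) / real N)"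
        by (rule real_sqrt_mult)
      also have "sqrt ((\<Sum>i<N. (Z j ((T j ^^ i) x))\<^sup>2) / real N) \<le> enn2real (\<xi> j x)"
      proof -
        have "ennreal (sqrt ((\<Sum>i<N. (Z j ((T j ^^ i) x))\<^sup>2) / real N)) \<le> \<xi> j x"
          unfolding \<xi>_def by (rule SUP_upper) simp
        also have "\<xi> j x = ennreal (enn2real (\<xi> j x))" using fin[of j] by (simp add: ennreal_enn2real_if)
        finally show ?thesis by (simp add: ennreal_le_iff)
      qed
      finally show ?thesis by (simp add: mult_left_mono)
    qed
    have v_nonneg: "0 \<le> v j r" for j r
    proof -
      have "0 \<le> w j 0" by (rule w_nonneg)
      also have "w j 0 \<le> Max (w j ` {..<2 ^ (r - j)})" by (intro Max_ge) auto
      finally show ?thesis by (simp add: v_def)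
    qed
    have v_le: "v j r \<le> b j" for j r
    proof (cases "j \<le> r")
      case True
      have "Max (w j ` {..<2 ^ (r - j)}) \<le> sqrt (2 ^ (r - j)) * enn2real (\<xi> j x)"
        using w_le[of _ "2 ^ (r - j)" j] by (intro Max.boundedI) (auto simp: lessThan_empty_iff)
      moreover have "sqrt (2 ^ r) = sqrt (2 ^ (r - j)) * sqrt (2 ^ j)"
        using True by (simp add: real_sqrt_mult[symmetric] power_add[symmetric])
      ultimately show ?thesis using True by (simp add: v_def b_def field_simps)
    next
      case False
      then show ?thesis by (simp add: v_def b_def)
    qed
    have v_lim: "(\<lambda>r. v j r) \<longlonglongrightarrow> 0" for j
    proof -
      \<comment> \<open>The starting points of the blocks at scale \<open>j\<close> form a
        subsequence of the orbit times, and \<open>q\<close> differs from the time q 2^j by a factor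
        that is constant for fixed \<open>j\<close>.\<close>
      have sub: "strict_mono (\<lambda>q. q * 2 ^ j :: nat)" by (auto simp: strict_mono_def)
      have "(\<lambda>q. (Z j ((\<theta> ^^ (q * 2 ^ j)) x))\<^sup>2 / real (q * 2 ^ j)) \<longlonglongrightarrow> 0"
        using LIMSEQ_subseq_LIMSEQ[OF elim(2)[rule_format, of j] sub] by (simp add: comp_def)
      then have "(\<lambda>q. sqrt ((Z j ((\<theta> ^^ (q * 2 ^ j)) x))\<^sup>2 / real (q * 2 ^ j) * 2 ^ j)) \<longlonglongrightarrow> sqrt (0 * 2 ^ j)"
        by (intro tendsto_intros)
      moreover have "sqrt ((Z j ((\<theta> ^^ (q * 2 ^ j)) x))\<^sup>2 / real (q * 2 ^ j) * 2 ^ j) = w j q / sqrt (real q)" for q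
        by (simp add: w_def real_sqrt_divide)
      ultimately have "(\<lambda>q. w j q / sqrt (real q)) \<longlonglongrightarrow> 0" by simp
      from Max_over_sqrt_tendsto_0[OF w_nonneg this]
      have "(\<lambda>N. Max (w j ` {..<N}) / sqrt (real N)) \<longlonglongrightarrow> 0" .
      moreover have "filterlim (\<lambda>r. 2 ^ (r - j) :: nat) at_top sequentially"
      proof -
        have "filterlim (\<lambda>r. 2 ^ r :: nat) at_top sequentially"
          by (intro filterlim_subseq) (auto simp: strict_mono_def)
        moreover have "filterlim (\<lambda>r. r - j) at_top sequentially" by (rule filterlim_minus_const_nat_at_top)
        ultimately show ?thesis by (rule filterlim_compose)
      qed
      ultimately have "(\<lambda>r. Max (w j ` {..<2 ^ (r - j)}) / sqrt (real (2 ^ (r - j)))) \<longlonglongrightarrow> 0"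
        by (rule filterlim_compose)
      then have "(\<lambda>r. Max (w j ` {..<2 ^ (r - j)}) / sqrt (real (2 ^ (r - j))) * (1 / sqrt (2 ^ j))) \<longlonglongrightarrow> 0 * (1 / sqrt (2 ^ j))"
        by (intro tendsto_intros)
      moreover have "eventually (\<lambda>r. Max (w j ` {..<2 ^ (r - j)}) / sqrt (real (2 ^ (r - j))) * (1 / sqrt (2 ^ j)) = v j r) sequentially"
        using eventually_ge_at_top[of j]
      proof eventually_elim
        case (elim r)
        then have "sqrt (2 ^ r) = sqrt (2 ^ (r - j)) * sqrt (2 ^ j)"
          by (simp add: real_sqrt_mult[symmetric] power_add[symmetric])
        then show ?case using elim by (simp add: v_def)
      qed
      ultimately show ?thesis by (simp add: tendsto_cong)
    qed
    have "eventually (\<lambda>(j, r). norm (v j r) \<le> b j) (at_top \<times>\<^sub>F sequentially)"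
      by (rule always_eventually) (use v_le v_nonneg in auto)
    from tannerys_theorem[OF v_lim this sum_b sequentially_bot]
    have "(\<lambda>r. \<Sum>j. v j r) \<longlonglongrightarrow> (\<Sum>j. 0)" by blast
    then have V: "(\<lambda>r. \<Sum>j. v j r) \<longlonglongrightarrow> 0" by simp
    define u where "u n = orbit_sum \<theta> f n x" for n
    have u_le: "\<bar>u n\<bar> \<le> sqrt (2 ^ r) * (\<Sum>j. v j r)" if "n \<le> 2 ^ r" for n r
    proof -
      have "\<bar>u n\<bar> \<le> (\<Sum>j\<le>r. sqrt (2 ^ r) * v j r)"
      proof (rule dyadic_chaining[OF _ that])
        fix j q :: nat assume j: "j \<le> r" and q: "q < 2 ^ (r - j)"
        have "u (Suc q * 2 ^ j) - u (q * 2 ^ j) = Z j ((\<theta> ^^ (q * 2 ^ j)) x)"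
          using orbit_sum_add[of \<theta> f "q * 2 ^ j" "2 ^ j" x] by (simp add: u_def Z_def add.commute)
        then have "\<bar>u (Suc q * 2 ^ j) - u (q * 2 ^ j)\<bar> = w j q" by (simp add: w_def)
        also have "\<dots> \<le> Max (w j ` {..<2 ^ (r - j)})" using q by (intro Max_ge) auto
        also have "\<dots> = sqrt (2 ^ r) * v j r" using j by (simp add: v_def)
        finally show "\<bar>u (Suc q * 2 ^ j) - u (q * 2 ^ j)\<bar> \<le> sqrt (2 ^ r) * v j r" .
      qed (simp add: u_def orbit_sum_def)
      also have "\<dots> = sqrt (2 ^ r) * (\<Sum>j\<le>r. v j r)" by (simp add: sum_distrib_left)
      also have "(\<Sum>j\<le>r. v j r) = (\<Sum>j. v j r)"
        by (rule suminf_finite[symmetric]) (auto simp: v_def)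
      finally show ?thesis .
    qed
    have "(\<lambda>n. u n / sqrt (real n)) \<longlonglongrightarrow> 0"
    proof (rule LIMSEQ_I)
      fix e :: real assume e: "0 < e"
      from LIMSEQ_D[OF V, of "e / 2"] e
      obtain r0 where r0: "\<And>r. r0 \<le> r \<Longrightarrow> norm ((\<Sum>j. v j r) - 0) < e / 2" by auto
      show "\<exists>no. \<forall>n\<ge>no. norm (u n / sqrt (real n) - 0) < e"
      proof (intro exI[of _ "2 ^ r0"] allI impI)
        fix n :: nat assume n: "2 ^ r0 \<le> n"
        then have "1 \<le> n" using order_trans[of 1 "2 ^ r0" n] by simp
        \<comment> \<open>Chaining up to scale \<open>Suc r\<close> costs sqrt(2^(r+1)) <= sqrt 2
          sqrt n. The bound e / 2 on the series absorbs the factor, as sqrt 2 < 2.\<close>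
        then obtain r where r: "2 ^ r \<le> n" "n < 2 ^ (r + 1)" using ex_power_ivl1[of 2 n] by auto
        then have "(2::nat) ^ r0 < 2 ^ (r + 1)" using n by linarith
        then have "r0 < r + 1" by (rule power_less_imp_less_exp[rotated]) simp
        then have "r0 \<le> Suc r" by simp
        have "\<bar>u n\<bar> \<le> sqrt (2 ^ Suc r) * (\<Sum>j. v j (Suc r))" using r by (intro u_le) auto
        also have "\<dots> \<le> sqrt (2 ^ Suc r) * (e / 2)"
          using r0[OF \<open>r0 \<le> Suc r\<close>] by (intro mult_left_mono) auto
        also have "\<dots> \<le> sqrt (2 * real n) * (e / 2)"
        proof (intro mult_right_mono)
          have "real (2 ^ r) \<le> real n" using r by (simp only: of_nat_le_iff)
          then show "sqrt (2 ^ Suc r) \<le> sqrt (2 * real n)" by simp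
        qed (use e in auto)
        also have "\<dots> = sqrt (real n) * (sqrt 2 * e / 2)" by (simp add: real_sqrt_mult)
        also have "\<dots> < sqrt (real n) * e"
          using e \<open>1 \<le> n\<close> sqrt2_less_2 by (intro mult_strict_left_mono) auto
        finally show "norm (u n / sqrt (real n) - 0) < e"
          using \<open>1 \<le> n\<close> by (simp add: field_simps)
      qed
    qed
    then show ?case by (simp add: u_def)
  qed
qed

subsection \<open>Series of subadditive sequences\<close>

lemma summable_dyadic_blocks:
  fixes w :: "nat \<Rightarrow> real"
  assumes w: "summable w" and pos: "\<And>i. 0 \<le> w i"
  shows "summable (\<lambda>j. \<Sum>i\<in>{2 ^ j..<2 ^ Suc j}. w i)"
proof (rule bounded_imp_summable)
  fix j
  have "(\<Sum>j\<le>n. \<Sum>i\<in>{2 ^ j..<2 ^ Suc j}. w i) = (\<Sum>i\<in>{1..<2 ^ Suc n}. w i)" for n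
  proof (induction n)
    case (Suc n)
    have "(\<Sum>i\<in>{1..<2 ^ Suc n}. w i) + (\<Sum>i\<in>{2 ^ Suc n..<2 ^ Suc (Suc n)}. w i) = (\<Sum>i\<in>{1..<2 ^ Suc (Suc n)}. w i)"
      by (rule sum.atLeastLessThan_concat) auto
    then show ?case using Suc by simp
  qed simp
  then show "(\<Sum>j\<le>j. \<Sum>i\<in>{2 ^ j..<2 ^ Suc j}. w i) \<le> (\<Sum>i. w i)"
    using w pos by (simp only:) (intro sum_le_suminf, auto)
qed (use pos in \<open>auto intro: sum_nonneg\<close>)

text \<open>Binary expansion: the leading power of two is split off by subadditivity. For
  \<open>i < 2 ^ j\<close> the powers below \<open>j\<close> suffice, and only
  \<open>i = 2 ^ j\<close> uses the last term.\<close>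

lemma subadditive_le_dyadic_sum:
  fixes a :: "nat \<Rightarrow> real"
  assumes nonneg: "\<And>n. 0 \<le> a n" and a0: "a 0 = 0" and subadd: "\<And>m n. a (m + n) \<le> a m + a n"
    and i: "i \<le> 2 ^ j"
  shows "a i \<le> (\<Sum>k\<le>j. a (2 ^ k))"
proof -
  have less: "a i \<le> (\<Sum>k<j. a (2 ^ k))" if "i < 2 ^ j" for i j
    using that
  proof (induction j arbitrary: i)
    case (Suc j)
    show ?case
    proof (cases "i < 2 ^ j")
      case True
      then show ?thesis using Suc.IH[of i] nonneg[of "2 ^ j"] by simp
    next
      case False
      have "a i = a (2 ^ j + (i - 2 ^ j))" using False by simp
      also have "\<dots> \<le> a (2 ^ j) + a (i - 2 ^ j)" by (rule subadd)
      also have "a (i - 2 ^ j) \<le> (\<Sum>k<j. a (2 ^ k))" using Suc.prems False by (intro Suc.IH) auto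
      finally show ?thesis by simp
    qed
  qed (simp add: a0)
  show ?thesis
  proof (cases "i = 2 ^ j")
    case True
    then show ?thesis using nonneg by (auto intro!: member_le_sum)
  next
    case False
    then show ?thesis using less[of i j] i nonneg[of "2 ^ j"] by (simp add: lessThan_Suc_atMost[symmetric])
  qed
qed

text \<open>Since \<open>a\<close> need not be monotone, its value at a power of two cannot be
  compared with neighbouring values directly. But a(2^(j+2)) <= a(i) + a(2^(j+2) - i), and when
  \<open>i\<close> runs through the block from 2^j to 2^(j+1), the complement stays in the next
  block. Averaging over \<open>i\<close> bounds the value by the means over two blocks. On a block
  the logarithm is at least j ln 2, which becomes the weight.\<close>

lemma summable_subadditive_dyadic:
  fixes a :: "nat \<Rightarrow> real"
  assumes nonneg: "\<And>n. 0 \<le> a n" and subadd: "\<And>m n. a (m + n) \<le> a m + a n"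
    and sum: "summable (\<lambda>n. real (Suc n) powr (-3/2) * ln (real (Suc n)) * a (Suc n))"
  shows "summable (\<lambda>j. real (Suc j) * (a (2 ^ j) / sqrt (2 ^ j)))"
proof -
  define w where "w n = real n powr (-3/2) * ln (real n) * a n" for n
  have w_nonneg: "0 \<le> w n" for n
    unfolding w_def using nonneg by (cases n) auto
  have "summable (\<lambda>n. w (Suc n))" using sum by (simp add: w_def)
  then have "summable w" by (rule summable_Suc_iff[THEN iffD1])
  then have blocks: "summable (\<lambda>j. \<Sum>i\<in>{2 ^ j..<2 ^ Suc j}. w i)"
    by (rule summable_dyadic_blocks) (rule w_nonneg)
  define G where "G j = (\<Sum>i\<in>{2 ^ j..<2 ^ Suc j}. a i)" for j :: nat
  have G_nonneg: "0 \<le> G j" for j unfolding G_def using nonneg by (intro sum_nonneg) auto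
  have pw: "(2 ^ Suc j) powr (-3/2) = 1 / (2 ^ Suc j * sqrt (2 ^ Suc j))" for j :: nat
  proof -
    have "(2 ^ Suc j) powr (-3/2) = ((2::real) ^ Suc j) powr (- (1 + 1 / 2))" by simp
    also have "\<dots> = 1 / (2 ^ Suc j * sqrt (2 ^ Suc j))"
      unfolding powr_minus powr_add by (simp add: powr_half_sqrt inverse_eq_divide)
    finally show ?thesis .
  qed
  have G_le: "real j * ln 2 * (G j / (2 ^ Suc j * sqrt (2 ^ Suc j))) \<le> (\<Sum>i\<in>{2 ^ j..<2 ^ Suc j}. w i)" for j
  proof -
    have "real j * ln 2 * (G j / (2 ^ Suc j * sqrt (2 ^ Suc j)))
      = (\<Sum>i\<in>{2 ^ j..<2 ^ Suc j}. (2 ^ Suc j) powr (-3/2) * (real j * ln 2) * a i)"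
      unfolding pw G_def by (simp add: sum_distrib_left sum_divide_distrib)
    also have "\<dots> \<le> (\<Sum>i\<in>{2 ^ j..<2 ^ Suc j}. w i)"
      unfolding w_def
    proof (intro sum_mono mult_right_mono mult_mono nonneg)
      fix i :: nat assume i: "i \<in> {2 ^ j..<2 ^ Suc j}"
      have i1: "2 ^ j \<le> real i" "real i \<le> 2 ^ Suc j" "0 < real i"
      proof -
        have "real (2 ^ j) \<le> real i" "real i \<le> real (2 ^ Suc j)"
          using i by (simp_all only: of_nat_le_iff atLeastLessThan_iff less_imp_le)
        then show "2 ^ j \<le> real i" "real i \<le> 2 ^ Suc j" by simp_all
        then show "0 < real i" by (smt (verit) zero_less_power)
      qed
      then show "(2 ^ Suc j) powr (-3/2) \<le> real i powr (-3/2)" by (intro powr_mono2') auto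
      have "real j * ln 2 = ln (2 ^ j)" by (simp add: ln_realpow)
      also have "\<dots> \<le> ln (real i)" using i1 by (intro ln_mono) auto
      finally show "real j * ln 2 \<le> ln (real i)" .
    qed auto
    finally show ?thesis .
  qed
  define g where "g j = real j * (G j / (2 ^ Suc j * sqrt (2 ^ Suc j)))" for j
  have "summable (\<lambda>j. ln 2 * g j)"
  proof (rule summable_comparison_test'[OF blocks, of 0])
    fix j :: nat
    have "0 \<le> ln 2 * g j" using G_nonneg[of j] by (simp add: g_def)
    then show "norm (ln 2 * g j) \<le> (\<Sum>i\<in>{2 ^ j..<2 ^ Suc j}. w i)"
      using G_le[of j] by (simp add: g_def mult_ac)
  qed
  then have sum_g: "summable g" by (simp add: summable_cmult_iff)
  have a_le: "2 ^ j * a (2 ^ (j + 2)) \<le> G j + G (Suc j)" for j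
  proof -
    have "2 ^ j * a (2 ^ (j + 2)) = (\<Sum>i\<in>{2 ^ j..<2 ^ Suc j :: nat}. a (2 ^ (j + 2)))" by simp
    also have "\<dots> \<le> (\<Sum>i\<in>{2 ^ j..<2 ^ Suc j}. a i + a (2 ^ (j + 2) - i))"
    proof (rule sum_mono)
      fix i :: nat assume "i \<in> {2 ^ j..<2 ^ Suc j}"
      then have "2 ^ (j + 2) = i + (2 ^ (j + 2) - i)" by auto
      then show "a (2 ^ (j + 2)) \<le> a i + a (2 ^ (j + 2) - i)" using subadd[of i "2 ^ (j + 2) - i"] by simp
    qed
    also have "\<dots> = G j + (\<Sum>i\<in>(\<lambda>i. 2 ^ (j + 2) - i) ` {2 ^ j..<2 ^ Suc j}. a i)"
      by (subst sum.reindex) (auto simp: G_def sum.distrib inj_on_def)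
    also have "(\<Sum>i\<in>(\<lambda>i. 2 ^ (j + 2) - i) ` {2 ^ j..<2 ^ Suc j}. a i) \<le> G (Suc j)"
      unfolding G_def using nonneg by (intro sum_mono2) auto
    finally show ?thesis by simp
  qed
  have "summable (\<lambda>j. 16 * (g j + g (Suc j)))"
    using sum_g by (intro summable_mult summable_add) (simp_all add: summable_Suc_iff)
  then have "summable (\<lambda>j. real (Suc (j + 2)) * (a (2 ^ (j + 2)) / sqrt (2 ^ (j + 2))))"
  \<comment> \<open>The weight in \<open>g\<close> vanishes at 0, and \<open>Suc (j + 2)\<close> is
    at most 4 j from \<open>j = 1\<close> on. The factor 16 turns j y / 8, a lower bound for
    \<open>g (Suc j)\<close>, into the required 2 j y.\<close>
  proof (rule summable_comparison_test'[of _ 1])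
    fix j :: nat assume j: "1 \<le> j"
    define s where "s = (2::real) ^ j"
    have s: "0 < s" by (simp add: s_def)
    define x y where "x = G j / (s * sqrt s)" and "y = G (Suc j) / (s * sqrt s)"
    have xy: "0 \<le> x" "0 \<le> y" using G_nonneg s by (simp_all add: x_def y_def)
    have sq: "sqrt (4 * s) = 2 * sqrt s" by (simp add: real_sqrt_mult)
    have gj: "g j = real j * x / (2 * sqrt 2)" "g (Suc j) = real (Suc j) * y / 8"
      using s sq by (simp_all add: g_def x_def y_def s_def[symmetric] real_sqrt_mult field_simps)
    have "a (2 ^ (j + 2)) / sqrt (2 ^ (j + 2)) \<le> ((G j + G (Suc j)) / s) / sqrt (4 * s)"
      using a_le[of j] s by (simp add: s_def field_simps)
    also have "\<dots> = (x + y) / 2"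
      unfolding sq using s by (simp add: x_def y_def field_simps)
    finally have "real (Suc (j + 2)) * (a (2 ^ (j + 2)) / sqrt (2 ^ (j + 2))) \<le> real (Suc (j + 2)) * ((x + y) / 2)"
      by (rule mult_left_mono) simp
    also have "\<dots> \<le> (4 * real j) * ((x + y) / 2)"
      using j xy by (intro mult_right_mono) auto
    also have "\<dots> \<le> 16 * (g j + g (Suc j))"
    proof -
      have "1 / 2 \<le> 1 / sqrt 2" using sqrt2_less_2 by (simp add: field_simps)
      then have "real j * x * (1 / 2) \<le> real j * x * (1 / sqrt 2)" using xy by (intro mult_left_mono) auto
      then have "real j * x / 4 \<le> g j" by (simp add: gj mult_ac)
      moreover have "real j * y / 8 \<le> g (Suc j)" using xy by (simp add: gj algebra_simps)
      moreover have "0 \<le> g j" using G_nonneg[of j] by (simp add: g_def)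
      ultimately show ?thesis using xy by (simp add: algebra_simps)
    qed
    finally show "norm (real (Suc (j + 2)) * (a (2 ^ (j + 2)) / sqrt (2 ^ (j + 2)))) \<le> 16 * (g j + g (Suc j))"
      using nonneg by simp
  qed
  then show ?thesis
    by (rule summable_iff_shift[where k = 2, THEN iffD1])
qed

text \<open>A Cauchy product with the series of (i + 1) (1 / sqrt 2)^i: for \<open>k <= j\<close>
  the factor 1 / sqrt(2^j) splits into 1 / sqrt(2^k) and (1 / sqrt 2)^(j-k), and j + 1 <= (k + 1) (j
  - k + 1).\<close>

lemma summable_dyadic_sums:
  fixes p :: "nat \<Rightarrow> real"
  assumes nonneg: "\<And>k. 0 \<le> p k" and sum: "summable (\<lambda>k. real (Suc k) * (p k / sqrt (2 ^ k)))"
  shows "summable (\<lambda>j. real (Suc j) * ((\<Sum>k\<le>j. p k) / sqrt (2 ^ j)))"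
proof -
  define q where "q i = real (Suc i) * (1 / sqrt 2) ^ i" for i
  have "(\<lambda>i. of_nat (Suc i) * (1 / sqrt 2) ^ i) sums (1 / (1 - 1 / sqrt 2)\<^sup>2)"
    by (rule geometric_deriv_sums) simp
  then have q: "summable q" unfolding q_def by (rule sums_summable)
  have q_nonneg: "0 \<le> q i" for i by (simp add: q_def)
  define r where "r k = real (Suc k) * (p k / sqrt (2 ^ k))" for k
  have r_nonneg: "0 \<le> r k" for k using nonneg by (simp add: r_def)
  have "summable r" unfolding r_def by (rule sum)
  then have "summable (\<lambda>k. norm (r k))" "summable (\<lambda>i. norm (q i))"
    using q r_nonneg q_nonneg by simp_all
  then have "summable (\<lambda>j. \<Sum>k\<le>j. r k * q (j - k))"
    by (rule summable_Cauchy_product)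
  then show ?thesis
  proof (rule summable_comparison_test'[of _ 0])
    fix j :: nat
    have "real (Suc j) * ((\<Sum>k\<le>j. p k) / sqrt (2 ^ j)) = (\<Sum>k\<le>j. real (Suc j) * (p k / sqrt (2 ^ j)))"
      by (simp add: sum_distrib_left sum_divide_distrib)
    also have "\<dots> \<le> (\<Sum>k\<le>j. r k * q (j - k))"
    proof (rule sum_mono)
      fix k assume "k \<in> {..j}"
      then have j: "j = k + (j - k)" by simp
      have "real (Suc j) \<le> real (Suc k) * real (Suc (j - k))"
        by (subst j) (simp add: algebra_simps del: of_nat_diff)
      then have "real (Suc j) * (p k / sqrt (2 ^ j)) \<le> real (Suc k) * real (Suc (j - k)) * (p k / sqrt (2 ^ j))"
        using nonneg[of k] by (intro mult_right_mono) auto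
      also have "\<dots> = real (Suc k) * real (Suc (j - k)) * (p k / (sqrt (2 ^ k) * sqrt 2 ^ (j - k)))"
        by (subst j) (simp add: power_add real_sqrt_mult real_sqrt_power del: le_add_diff_inverse)
      also have "\<dots> = r k * q (j - k)"
        by (simp add: r_def q_def power_one_over field_simps)
      finally show "real (Suc j) * (p k / sqrt (2 ^ j)) \<le> r k * q (j - k)" .
    qed
    finally show "norm (real (Suc j) * ((\<Sum>k\<le>j. p k) / sqrt (2 ^ j))) \<le> (\<Sum>k\<le>j. r k * q (j - k))"
      using nonneg by (simp add: sum_nonneg)
  qed
qed

text \<open>The term \<open>d k\<close> occurs in the tails with \<open>j <= k\<close>, that is k +
  1 times. Summation by parts makes this count precise for partial sums and avoids an exchange of
  double series.\<close>

lemma summable_tails: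
  fixes d :: "nat \<Rightarrow> real"
  assumes nonneg: "\<And>k. 0 \<le> d k" and sum: "summable (\<lambda>k. real (Suc k) * d k)"
  shows "summable (\<lambda>j. \<Sum>k. d (k + j))"
proof (rule bounded_imp_summable)
  have d: "summable d"
    by (rule summable_comparison_test'[OF sum, of 0]) (use nonneg in \<open>simp add: algebra_simps\<close>)
  show "0 \<le> (\<Sum>k. d (k + j))" for j
    using nonneg by (intro suminf_nonneg summable_ignore_initial_segment[OF d])
  define t where "t j = (\<Sum>k. d (k + j))" for j
  have t_Suc: "t j = d j + t (Suc j)" for j
    using suminf_split_initial_segment[OF summable_ignore_initial_segment[OF d, of j], of 1]
    by (simp add: t_def add.commute)
  have parts: "(\<Sum>j<N. t j) = real N * t N + (\<Sum>j<N. real (Suc j) * d j)" for N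
  proof (induction N)
    case (Suc N)
    then show ?case using t_Suc[of N] by (simp add: algebra_simps)
  qed simp
  fix n
  have "real (Suc n) * t (Suc n) = (\<Sum>k. real (Suc n) * d (k + Suc n))"
    unfolding t_def by (rule suminf_mult[symmetric]) (rule summable_ignore_initial_segment[OF d])
  also have "\<dots> \<le> (\<Sum>k. real (Suc (k + Suc n)) * d (k + Suc n))"
    using nonneg
    by (intro suminf_le mult_right_mono summable_mult summable_ignore_initial_segment[OF d]
        summable_ignore_initial_segment[OF sum]) auto
  finally have "real (Suc n) * t (Suc n) + (\<Sum>j<Suc n. real (Suc j) * d j) \<le> (\<Sum>k. real (Suc k) * d k)"
    using suminf_split_initial_segment[OF sum, of "Suc n"] by simp
  then show "(\<Sum>j\<le>n. \<Sum>k. d (k + j)) \<le> (\<Sum>k. real (Suc k) * d k)"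
    using parts[of "Suc n"] by (simp add: t_def lessThan_Suc_atMost)
qed

subsection \<open>Stationary martingale differences\<close>

text \<open>The condition \<open>increasing\<close> says that what is known at time 0 is known at
  time 1, as the preimage of \<open>B\<close> is the event \<open>B\<close> one step later. Together
  with \<open>\<theta>\<close>, the single algebra \<open>F\<close> encodes a filtration
  \<open>Fn n\<close>, and \<open>\<theta>\<close> may be non-invertible.\<close>

locale filtered_system = ergodic_system M \<theta> + finite_measure_subalgebra M F
  for M :: "'a measure" and \<theta> :: "'a \<Rightarrow> 'a" and F :: "'a measure" +
  assumes increasing: "A \<in> sets F \<Longrightarrow> \<exists>B\<in>sets F. A = \<theta> -` B \<inter> space M"
begin

abbreviation "ce \<equiv> real_cond_exp M F"

definition Fn :: "nat \<Rightarrow> 'a measure" where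
  "Fn n = vimage_algebra (space M) (\<theta> ^^ n) F"

lemma space_F: "space F = space M"
  using subalg by (simp add: subalgebra_def)

lemma sets_F: "A \<in> sets F \<Longrightarrow> A \<in> sets M"
  using subalg by (auto simp: subalgebra_def)

lemma F_measurable: "f \<in> borel_measurable F \<Longrightarrow> f \<in> borel_measurable M"
  by (rule measurable_from_subalg[OF subalg])

lemma space_Fn [simp]: "space (Fn n) = space M"
  by (simp add: Fn_def)

lemma sets_Fn: "sets (Fn n) = {(\<theta> ^^ n) -` B \<inter> space M | B. B \<in> sets F}"
  unfolding Fn_def by (rule sets_vimage_algebra2) (auto simp: space_F iter_space)

lemma sets_Fn_0: "sets (Fn 0) = sets F"
proof -
  have "B \<inter> space M = B" if "B \<in> sets F" for B using sets.sets_into_space[OF that] by (auto simp: space_F)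
  then show ?thesis unfolding sets_Fn by auto
qed

lemma sets_Fn_mono:
  assumes "m \<le> n"
  shows "sets (Fn m) \<subseteq> sets (Fn n)"
proof -
  have "sets (Fn n) \<subseteq> sets (Fn (Suc n))" for n
  proof
    fix A assume "A \<in> sets (Fn n)"
    then obtain B where B: "B \<in> sets F" "A = (\<theta> ^^ n) -` B \<inter> space M" by (auto simp: sets_Fn)
    obtain C where C: "C \<in> sets F" "B = \<theta> -` C \<inter> space M" using increasing[OF B(1)] by blast
    have "A = (\<theta> ^^ Suc n) -` C \<inter> space M" using B C by (auto simp: iter_space)
    with C show "A \<in> sets (Fn (Suc n))" by (auto simp: sets_Fn)
  qed
  then have "mono (\<lambda>n. sets (Fn n))" by (simp add: mono_iff_le_Suc)
  with assms show ?thesis by (auto dest: monoD)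
qed

lemma Fn_measurable_mono: "m \<le> n \<Longrightarrow> f \<in> borel_measurable (Fn m) \<Longrightarrow> f \<in> borel_measurable (Fn n)"
  using sets_Fn_mono[of m n] by (auto simp: measurable_def)

lemma F_measurable_Fn: "f \<in> borel_measurable F \<Longrightarrow> f \<in> borel_measurable (Fn n)"
  by (rule Fn_measurable_mono[OF le0]) (simp only: measurable_cong_sets[OF sets_Fn_0 refl])

lemma subalgebra_Fn: "subalgebra M (Fn n)"
proof -
  have "(\<theta> ^^ n) -` B \<inter> space M \<in> sets M" if "B \<in> sets F" for B
    using sets_F[OF that] by (rule measurable_sets[OF iter_measurable])
  then show ?thesis unfolding subalgebra_def sets_Fn by auto
qed

lemma subalgebra_Fn_F: "subalgebra (Fn n) F"
  using sets_Fn_mono[of 0 n] by (simp add: subalgebra_def space_F sets_Fn_0)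

lemma Fn_measurable_M: "f \<in> borel_measurable (Fn n) \<Longrightarrow> f \<in> borel_measurable M"
  by (rule measurable_from_subalg[OF subalgebra_Fn])

lemma iter_Fn_measurable:
  assumes "f \<in> borel_measurable (Fn m)"
  shows "(\<lambda>x. f ((\<theta> ^^ k) x)) \<in> borel_measurable (Fn (m + k))"
proof (rule measurable_compose[OF _ assms])
  have "(\<lambda>x. (\<theta> ^^ m) ((\<theta> ^^ k) x)) \<in> measurable (Fn (m + k)) F"
    unfolding Fn_def using measurable_vimage_algebra1[of "\<theta> ^^ (m + k)" "space M" F]
    by (simp add: funpow_add space_F iter_space comp_def)
  then show "\<theta> ^^ k \<in> measurable (Fn (m + k)) (Fn m)"
    unfolding Fn_def[of m] by (intro measurable_vimage_algebra2) (auto simp: iter_space)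
qed

lemma finite_measure_subalgebra_Fn: "finite_measure_subalgebra M (Fn n)"
  by unfold_locales (rule subalgebra_Fn)

text \<open>Stationarity of conditional expectations. Each event of \<open>Fn n\<close> is the
  preimage of some \<open>B\<close> in \<open>F\<close>, and invariance of the measure reduces the
  test integral over it to the one over \<open>B\<close>.\<close>

lemma ce_iter:
  assumes f: "integrable M f"
  shows "AE x in M. real_cond_exp M (Fn n) (\<lambda>x. f ((\<theta> ^^ n) x)) x = ce f ((\<theta> ^^ n) x)"
proof -
  interpret Fn: finite_measure_subalgebra M "Fn n" by (rule finite_measure_subalgebra_Fn)
  have [measurable]: "f \<in> borel_measurable M" using f by auto
  show ?thesis
  proof (rule Fn.real_cond_exp_charact)
    show "integrable M (\<lambda>x. f ((\<theta> ^^ n) x))" by (rule integrable_iter[OF f])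
    show "integrable M (\<lambda>x. ce f ((\<theta> ^^ n) x))" by (rule integrable_iter) (rule real_cond_exp_int[OF f])
    have "ce f \<in> borel_measurable (Fn 0)" by (rule F_measurable_Fn) simp
    from iter_Fn_measurable[OF this, of n] show "(\<lambda>x. ce f ((\<theta> ^^ n) x)) \<in> borel_measurable (Fn n)" by simp
    fix A assume "A \<in> sets (Fn n)"
    then obtain B where B: "B \<in> sets F" "A = (\<theta> ^^ n) -` B \<inter> space M" by (auto simp: sets_Fn)
    have [measurable]: "B \<in> sets M" using sets_F[OF B(1)] .
    have "(\<integral>x\<in>A. f ((\<theta> ^^ n) x) \<partial>M) = (\<integral>x. indicator B ((\<theta> ^^ n) x) * f ((\<theta> ^^ n) x) \<partial>M)"
      unfolding set_lebesgue_integral_def B(2)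
      by (intro Bochner_Integration.integral_cong) (auto simp: indicator_def)
    also have "\<dots> = (\<integral>x. indicator B x * f x \<partial>M)"
      by (rule integral_iter[of "\<lambda>x. indicator B x * f x"]) simp
    also have "\<dots> = (\<integral>x. indicator B x * ce f x \<partial>M)"
      using real_cond_exp_intA[OF f B(1)] by (simp add: set_lebesgue_integral_def)
    also have "\<dots> = (\<integral>x. indicator B ((\<theta> ^^ n) x) * ce f ((\<theta> ^^ n) x) \<partial>M)"
      by (rule integral_iter[of "\<lambda>x. indicator B x * ce f x", symmetric]) simp
    also have "\<dots> = (\<integral>x\<in>A. ce f ((\<theta> ^^ n) x) \<partial>M)"
      unfolding set_lebesgue_integral_def B(2)
      by (intro Bochner_Integration.integral_cong) (auto simp: indicator_def)
    finally show "(\<integral>x\<in>A. f ((\<theta> ^^ n) x) \<partial>M) = (\<integral>x\<in>A. ce f ((\<theta> ^^ n) x) \<partial>M)" .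
  qed
qed

text \<open>\<open>ce_iter\<close> rewrites the inner function as a conditional expectation given
  the larger algebra \<open>Fn n\<close>, and nesting removes it. Hence f |-> \<open>ce\<close> (f o
  \<open>\<theta>\<close>) can be iterated.\<close>

lemma ce_tower:
  assumes f: "integrable M f"
  shows "AE x in M. ce (\<lambda>x. ce f ((\<theta> ^^ n) x)) x = ce (\<lambda>x. f ((\<theta> ^^ n) x)) x"
proof -
  have [measurable]: "f \<in> borel_measurable M" using f by auto
  have "AE x in M. ce (\<lambda>x. ce f ((\<theta> ^^ n) x)) x = ce (real_cond_exp M (Fn n) (\<lambda>x. f ((\<theta> ^^ n) x))) x"
    by (rule real_cond_exp_cong) (use ce_iter[OF f, of n] in auto)
  moreover have "AE x in M. ce (real_cond_exp M (Fn n) (\<lambda>x. f ((\<theta> ^^ n) x))) x = ce (\<lambda>x. f ((\<theta> ^^ n) x)) x"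
    by (rule real_cond_exp_nested_subalg[OF subalgebra_Fn subalgebra_Fn_F integrable_iter[OF f]])
  ultimately show ?thesis by eventually_elim simp
qed

lemma ce_jensen_square:
  assumes f: "square_integrable M f"
  shows "AE x in M. (ce f x)\<^sup>2 \<le> ce (\<lambda>x. (f x)\<^sup>2) x"
  using real_cond_exp_jensens_inequality(2)[where X = f and I = UNIV and q = power2]
    square_integrable_integrable[OF f] f
  by (auto simp: convex_power2)

lemma square_integrable_ce:
  assumes f: "square_integrable M f"
  shows "square_integrable M (ce f)"
  using integrable_convex_cond_exp[where X = f and I = UNIV and q = power2]
    square_integrable_integrable[OF f] f
  by (auto simp: convex_power2 square_integrable_def)

lemma l2_norm_ce:
  assumes f: "square_integrable M f"
  shows "l2_norm M (ce f) \<le> l2_norm M f"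
proof -
  have "(\<integral>x. (ce f x)\<^sup>2 \<partial>M) \<le> (\<integral>x. ce (\<lambda>x. (f x)\<^sup>2) x \<partial>M)"
    using f square_integrable_ce[OF f] ce_jensen_square[OF f] by (intro integral_mono_AE real_cond_exp_int) auto
  also have "\<dots> = (\<integral>x. (f x)\<^sup>2 \<partial>M)" using f by (intro real_cond_exp_int) auto
  finally show ?thesis by (simp add: l2_norm_def)
qed

lemma ce_abs:
  assumes f: "integrable M f"
  shows "AE x in M. \<bar>ce f x\<bar> \<le> ce (\<lambda>x. \<bar>f x\<bar>) x"
proof -
  have "AE x in M. ce f x \<le> ce (\<lambda>x. \<bar>f x\<bar>) x" using f by (intro real_cond_exp_mono) auto
  moreover have "AE x in M. ce (\<lambda>x. - 1 * f x) x \<le> ce (\<lambda>x. \<bar>f x\<bar>) x" using f by (intro real_cond_exp_mono) auto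
  moreover have "AE x in M. ce (\<lambda>x. - 1 * f x) x = - 1 * ce f x" by (rule real_cond_exp_cmult[OF f])
  ultimately show ?thesis by eventually_elim auto
qed

text \<open>One function stands for the whole sequence: the increments are D o
  \<open>\<theta>\<close>^k, each known at time k + 1 and centred given time k, so that
  \<open>orbit_sum \<theta> D n\<close> is a martingale for \<open>Fn n\<close>.\<close>

definition martingale_difference :: "('a \<Rightarrow> real) \<Rightarrow> bool" where
  "martingale_difference D \<longleftrightarrow>
     D \<in> borel_measurable (Fn 1) \<and> square_integrable M D \<and> (AE x in M. ce D x = 0)"

lemma martingale_differenceD:
  assumes "martingale_difference D"
  shows "D \<in> borel_measurable (Fn 1)" "D \<in> borel_measurable M" "square_integrable M D" "integrable M D" "AE x in M. ce D x = 0"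
  using assms by (auto simp: martingale_difference_def intro: square_integrable_integrable)

lemma orbit_sum_Fn_measurable:
  assumes D: "D \<in> borel_measurable (Fn 1)"
  shows "orbit_sum \<theta> D n \<in> borel_measurable (Fn n)"
  unfolding orbit_sum_def
proof (rule borel_measurable_sum)
  fix k assume "k \<in> {..<n}"
  then show "(\<lambda>x. D ((\<theta> ^^ k) x)) \<in> borel_measurable (Fn n)"
    using iter_Fn_measurable[OF D, of k] by (intro Fn_measurable_mono[of "Suc k" n]) auto
qed

text \<open>The factor \<open>Y\<close>, known at time \<open>n\<close>, is pulled out of the
  conditional expectation of the increment given \<open>Fn n\<close>, which vanishes by
  \<open>ce_iter\<close>.\<close>

lemma martingale_difference_orthogonal:
  assumes D: "martingale_difference D" and Y: "Y \<in> borel_measurable (Fn n)"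
    and int: "integrable M (\<lambda>x. Y x * D ((\<theta> ^^ n) x))"
  shows "(\<integral>x. Y x * D ((\<theta> ^^ n) x) \<partial>M) = 0"
proof -
  note D = martingale_differenceD[OF D]
  interpret Fn: finite_measure_subalgebra M "Fn n" by (rule finite_measure_subalgebra_Fn)
  have [measurable]: "(\<lambda>x. D ((\<theta> ^^ n) x)) \<in> borel_measurable M" "Y \<in> borel_measurable M"
    using D Y by (auto intro: borel_measurable_iter Fn_measurable_M)
  have "(\<integral>x. Y x * D ((\<theta> ^^ n) x) \<partial>M) = (\<integral>x. Y x * real_cond_exp M (Fn n) (\<lambda>x. D ((\<theta> ^^ n) x)) x \<partial>M)"
    by (rule Fn.real_cond_exp_intg(2)[symmetric]) (use int Y in auto)
  also have "\<dots> = (\<integral>x. 0 \<partial>M)"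
  proof (rule integral_cong_AE)
    show "AE x in M. Y x * real_cond_exp M (Fn n) (\<lambda>x. D ((\<theta> ^^ n) x)) x = 0"
      using ce_iter[OF D(4), of n] AE_iter[OF D(5), of n] by eventually_elim simp
  qed auto
  finally show ?thesis by simp
qed

text \<open>The restriction to an event of \<open>F\<close> makes one induction serve both for the
  norm and for the conditional second moment. The cross term vanishes because the indicator of
  \<open>A\<close> is already known at time \<open>n\<close>.\<close>

lemma integral_square_martingale:
  assumes D: "martingale_difference D" and A: "A \<in> sets F"
  shows "(\<integral>x. indicator A x * (orbit_sum \<theta> D n x)\<^sup>2 \<partial>M) = (\<integral>x. indicator A x * orbit_sum \<theta> (\<lambda>x. (D x)\<^sup>2) n x \<partial>M)"
proof (induction n)
  case 0
  show ?case by (simp add: orbit_sum_def)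
next
  case (Suc n)
  note D' = martingale_differenceD[OF D]
  note [measurable] = D'(2) sets_F[OF A]
  have sq: "square_integrable M (orbit_sum \<theta> D n)" "square_integrable M (\<lambda>x. D ((\<theta> ^^ n) x))"
    using D' by (auto intro: square_integrable_orbit_sum square_integrable_iter)
  have int1: "integrable M (\<lambda>x. indicator A x * (orbit_sum \<theta> D n x)\<^sup>2)"
    using integrable_mult_indicator[OF sets_F[OF A] square_integrableD(2)[OF sq(1)]] by simp
  have int2: "integrable M (\<lambda>x. indicator A x * (D ((\<theta> ^^ n) x))\<^sup>2)"
    using integrable_mult_indicator[OF sets_F[OF A] square_integrableD(2)[OF sq(2)]] by simp
  have int3: "integrable M (\<lambda>x. (2 * indicator A x * orbit_sum \<theta> D n x) * D ((\<theta> ^^ n) x))"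
    using integrable_mult_indicator[OF sets_F[OF A] integrable_mult_right[OF square_integrable_mult[OF sq], of 2]]
    by (simp add: mult_ac)
  have int4: "integrable M (\<lambda>x. indicator A x * orbit_sum \<theta> (\<lambda>x. (D x)\<^sup>2) n x)"
  proof -
    have "integrable M (orbit_sum \<theta> (\<lambda>x. (D x)\<^sup>2) n)"
      unfolding orbit_sum_def using integrable_iter[OF square_integrableD(2)[OF D'(3)]] by simp
    from integrable_mult_indicator[OF sets_F[OF A] this] show ?thesis by simp
  qed
  have "indicator A \<in> borel_measurable (Fn n)" using A by (intro F_measurable_Fn) auto
  then have meas: "(\<lambda>x. 2 * indicator A x * orbit_sum \<theta> D n x) \<in> borel_measurable (Fn n)"
    using orbit_sum_Fn_measurable[OF D'(1), of n] by measurable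
  have "(\<integral>x. indicator A x * (orbit_sum \<theta> D (Suc n) x)\<^sup>2 \<partial>M)
    = (\<integral>x. indicator A x * (orbit_sum \<theta> D n x)\<^sup>2 + indicator A x * (D ((\<theta> ^^ n) x))\<^sup>2
       + (2 * indicator A x * orbit_sum \<theta> D n x) * D ((\<theta> ^^ n) x) \<partial>M)"
    by (intro Bochner_Integration.integral_cong) (auto simp: orbit_sum_def power2_sum algebra_simps)
  also have "\<dots> = (\<integral>x. indicator A x * (orbit_sum \<theta> D n x)\<^sup>2 \<partial>M) + (\<integral>x. indicator A x * (D ((\<theta> ^^ n) x))\<^sup>2 \<partial>M)"
    using int1 int2 int3 martingale_difference_orthogonal[OF D meas int3] by simp
  also have "\<dots> = (\<integral>x. indicator A x * orbit_sum \<theta> (\<lambda>x. (D x)\<^sup>2) (Suc n) x \<partial>M)"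
    using int2 int4 Suc by (simp add: orbit_sum_def distrib_left)
  finally show ?case .
qed

lemma l2_norm_martingale:
  assumes D: "martingale_difference D"
  shows "l2_norm M (orbit_sum \<theta> D n) = sqrt (real n) * l2_norm M D"
proof -
  note D' = martingale_differenceD[OF D]
  have "(\<integral>x. (orbit_sum \<theta> D n x)\<^sup>2 \<partial>M) = (\<integral>x. indicator (space M) x * (orbit_sum \<theta> D n x)\<^sup>2 \<partial>M)"
    by (intro Bochner_Integration.integral_cong) auto
  also have "\<dots> = (\<integral>x. indicator (space M) x * orbit_sum \<theta> (\<lambda>x. (D x)\<^sup>2) n x \<partial>M)"
    using sets.top[of F] by (intro integral_square_martingale[OF D]) (simp add: space_F)
  also have "\<dots> = (\<integral>x. orbit_sum \<theta> (\<lambda>x. (D x)\<^sup>2) n x \<partial>M)"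
    by (intro Bochner_Integration.integral_cong) auto
  also have "\<dots> = (\<Sum>k<n. \<integral>x. (D ((\<theta> ^^ k) x))\<^sup>2 \<partial>M)"
    unfolding orbit_sum_def using integrable_iter[OF square_integrableD(2)[OF D'(3)]]
    by (intro Bochner_Integration.integral_sum) auto
  also have "\<dots> = real n * (\<integral>x. (D x)\<^sup>2 \<partial>M)"
    using integral_iter[of "\<lambda>x. (D x)\<^sup>2"] D' by simp
  finally show ?thesis by (simp add: l2_norm_def real_sqrt_mult)
qed

lemma ce_square_martingale:
  assumes D: "martingale_difference D"
  shows "AE x in M. ce (\<lambda>x. (orbit_sum \<theta> D n x)\<^sup>2) x = (\<Sum>k<n. ce (\<lambda>x. (D ((\<theta> ^^ k) x))\<^sup>2) x)"
proof -
  note D' = martingale_differenceD[OF D]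
  have int: "integrable M (\<lambda>x. (D ((\<theta> ^^ k) x))\<^sup>2)" for k
    by (rule integrable_iter[OF square_integrableD(2)[OF D'(3)]])
  have int': "integrable M (orbit_sum \<theta> (\<lambda>x. (D x)\<^sup>2) n)" unfolding orbit_sum_def using int by simp
  have "AE x in M. ce (\<lambda>x. (orbit_sum \<theta> D n x)\<^sup>2) x = ce (orbit_sum \<theta> (\<lambda>x. (D x)\<^sup>2) n) x"
  proof (rule real_cond_exp_charact)
    fix A assume A: "A \<in> sets F"
    have "(\<integral>x\<in>A. (orbit_sum \<theta> D n x)\<^sup>2 \<partial>M) = (\<integral>x\<in>A. orbit_sum \<theta> (\<lambda>x. (D x)\<^sup>2) n x \<partial>M)"
      using integral_square_martingale[OF D A, of n] by (simp add: set_lebesgue_integral_def)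
    also have "\<dots> = (\<integral>x\<in>A. ce (orbit_sum \<theta> (\<lambda>x. (D x)\<^sup>2) n) x \<partial>M)"
      by (rule real_cond_exp_intA[OF int' A])
    finally show "(\<integral>x\<in>A. (orbit_sum \<theta> D n x)\<^sup>2 \<partial>M) = (\<integral>x\<in>A. ce (orbit_sum \<theta> (\<lambda>x. (D x)\<^sup>2) n) x \<partial>M)" .
  qed (use square_integrable_orbit_sum[OF D'(3)] int' real_cond_exp_int in auto)
  moreover have "AE x in M. ce (orbit_sum \<theta> (\<lambda>x. (D x)\<^sup>2) n) x = (\<Sum>k<n. ce (\<lambda>x. (D ((\<theta> ^^ k) x))\<^sup>2) x)"
    unfolding orbit_sum_def using int by (rule real_cond_exp_sum)
  ultimately show ?thesis by eventually_elim simp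
qed

lemma martingale_difference_diff:
  assumes D: "martingale_difference D" and D': "martingale_difference D'"
  shows "martingale_difference (\<lambda>x. D x - D' x)"
proof -
  note D = martingale_differenceD[OF D] and D' = martingale_differenceD[OF D']
  have "AE x in M. ce (\<lambda>x. D x - D' x) x = 0"
    using real_cond_exp_diff[OF D(4) D'(4)] D(5) D'(5) by eventually_elim simp
  with D D' show ?thesis by (auto simp: martingale_difference_def intro: square_integrable_diff)
qed

end

subsection \<open>Martingale approximation\<close>

locale adapted_system = filtered_system M \<theta> F for M :: "'a measure" and \<theta> F +
  fixes X :: "'a \<Rightarrow> real"
  assumes X_F: "X \<in> borel_measurable F" and X_sq: "square_integrable M X"
begin

text \<open>Composition with \<open>\<theta>\<close> makes the sum begin at time 1, the first time
  beyond the reach of \<open>F\<close>.\<close>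

definition S :: "nat \<Rightarrow> 'a \<Rightarrow> real" where
  "S = orbit_sum \<theta> (\<lambda>x. X (\<theta> x))"

definition e :: "nat \<Rightarrow> 'a \<Rightarrow> real" where
  "e n = ce (S n)"

definition a :: "nat \<Rightarrow> real" where
  "a n = l2_norm M (e n)"

lemma X_shift_sq: "square_integrable M (\<lambda>x. X (\<theta> x))"
  using square_integrable_iter[OF X_sq, of 1] by simp

lemma X_shift_Fn: "(\<lambda>x. X (\<theta> x)) \<in> borel_measurable (Fn 1)"
  using iter_Fn_measurable[OF F_measurable_Fn[OF X_F, of 0], of 1] by simp

lemma S_sq: "square_integrable M (S n)"
  unfolding S_def by (rule square_integrable_orbit_sum[OF X_shift_sq])

lemma S_add: "S (m + n) x = S m x + S n ((\<theta> ^^ m) x)"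
  unfolding S_def by (rule orbit_sum_add)

lemma e_F [measurable]: "e n \<in> borel_measurable F"
  by (simp add: e_def)

lemma e_M [measurable]: "e n \<in> borel_measurable M"
  by (rule F_measurable[OF e_F])

lemma e_sq: "square_integrable M (e n)"
  unfolding e_def by (rule square_integrable_ce[OF S_sq])

lemma e_0: "AE x in M. e 0 x = 0"
proof -
  have "S 0 = (\<lambda>_. 0)" by (auto simp: S_def orbit_sum_def)
  then show ?thesis unfolding e_def by (simp add: real_cond_exp_F_meas)
qed

lemma e_add: "AE x in M. e (m + n) x = e m x + ce (\<lambda>x. e n ((\<theta> ^^ m) x)) x"
proof -
  have int: "integrable M (S m)" "integrable M (S n)"
    by (rule square_integrable_integrable[OF S_sq])+
  have "AE x in M. ce (\<lambda>x. S m x + S n ((\<theta> ^^ m) x)) x = ce (S m) x + ce (\<lambda>x. S n ((\<theta> ^^ m) x)) x"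
    by (rule real_cond_exp_add[OF int(1) integrable_iter[OF int(2)]])
  moreover have "AE x in M. ce (\<lambda>x. ce (S n) ((\<theta> ^^ m) x)) x = ce (\<lambda>x. S n ((\<theta> ^^ m) x)) x"
    by (rule ce_tower[OF int(2)])
  moreover have "S (m + n) = (\<lambda>x. S m x + S n ((\<theta> ^^ m) x))"
    by (rule ext) (rule S_add)
  ultimately show ?thesis unfolding e_def by (auto elim!: eventually_elim2)
qed

lemma a_nonneg: "0 \<le> a n"
  by (simp add: a_def)

lemma a_0: "a 0 = 0"
  using l2_norm_cong_AE[OF e_0] by (simp add: a_def l2_norm_def)

lemma a_add: "a (m + n) \<le> a m + a n"
proof -
  have sq: "square_integrable M (\<lambda>x. e n ((\<theta> ^^ m) x))"
    by (rule square_integrable_iter[OF e_sq])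
  have "a (m + n) = l2_norm M (\<lambda>x. e m x + ce (\<lambda>x. e n ((\<theta> ^^ m) x)) x)"
    unfolding a_def by (rule l2_norm_cong_AE[OF e_add]) auto
  also have "\<dots> \<le> a m + l2_norm M (ce (\<lambda>x. e n ((\<theta> ^^ m) x)))"
    unfolding a_def by (rule l2_norm_add[OF e_sq square_integrable_ce[OF sq]])
  also have "l2_norm M (ce (\<lambda>x. e n ((\<theta> ^^ m) x))) \<le> l2_norm M (\<lambda>x. e n ((\<theta> ^^ m) x))"
    by (rule l2_norm_ce[OF sq])
  also have "\<dots> = a n" unfolding a_def by (rule l2_norm_iter) simp
  finally show ?thesis by simp
qed

text \<open>An approximate solution of Poisson's equation: since \<open>ce\<close> (e_i o
  \<open>\<theta>\<close>) = e_(i+1) - e_1, averaging over i < m gives \<open>ce\<close> (h_m o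
  \<open>\<theta>\<close>) = h_m - e_1 + e_m / m, where e_1 = \<open>ce\<close> (X o
  \<open>\<theta>\<close>).\<close>

definition h :: "nat \<Rightarrow> 'a \<Rightarrow> real" where
  "h m x = (\<Sum>i<m. e i x) / real m"

text \<open>The coboundary of \<open>h m\<close> corrects X o \<open>\<theta>\<close>, and the last
  term removes the defect in Poisson's equation, so that the conditional mean is exactly zero. The
  coboundary telescopes along orbits.\<close>

definition Dm :: "nat \<Rightarrow> 'a \<Rightarrow> real" where
  "Dm m x = X (\<theta> x) + h m (\<theta> x) - h m x - e m x / real m"

lemma h_sq: "square_integrable M (h m)"
  unfolding h_def by (intro square_integrable_divide square_integrable_sum e_sq)

lemma h_F [measurable]: "h m \<in> borel_measurable F"
  unfolding h_def by measurable

lemma h_shift_sq: "square_integrable M (\<lambda>x. h m (\<theta> x))"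
  using square_integrable_iter[OF h_sq, of m 1] by simp

lemma Dm_sq: "square_integrable M (Dm m)"
  unfolding Dm_def
  by (intro square_integrable_diff square_integrable_add square_integrable_divide X_shift_sq h_sq h_shift_sq e_sq)

lemma martingale_difference_Dm:
  assumes m: "m \<noteq> 0"
  shows "martingale_difference (Dm m)"
  unfolding martingale_difference_def
proof (intro conjI)
  show "square_integrable M (Dm m)" by (rule Dm_sq)
  have "(\<lambda>x. h m (\<theta> x)) \<in> borel_measurable (Fn 1)"
    using iter_Fn_measurable[OF F_measurable_Fn[OF h_F[of m], of 0], of 1] by simp
  then show "Dm m \<in> borel_measurable (Fn 1)"
    using F_measurable_Fn[OF h_F[of m], of 1] F_measurable_Fn[OF e_F[of m], of 1] X_shift_Fn
    unfolding Dm_def by measurable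
  note int = X_shift_sq[THEN square_integrable_integrable] h_sq[THEN square_integrable_integrable]
    h_shift_sq[THEN square_integrable_integrable] e_sq[THEN square_integrable_integrable]
  have e_shift: "integrable M (\<lambda>x. e i (\<theta> x))" for i
    using integrable_iter[OF int(4), of i 1] by simp
  have "AE x in M. ce (Dm m) x = ce (\<lambda>x. X (\<theta> x) + h m (\<theta> x) - h m x) x - ce (\<lambda>x. e m x / real m) x"
    unfolding Dm_def using int by (intro real_cond_exp_diff) auto
  moreover have "AE x in M. ce (\<lambda>x. X (\<theta> x) + h m (\<theta> x) - h m x) x = ce (\<lambda>x. X (\<theta> x) + h m (\<theta> x)) x - ce (h m) x"
    using int by (intro real_cond_exp_diff) auto
  moreover have "AE x in M. ce (\<lambda>x. X (\<theta> x) + h m (\<theta> x)) x = ce (\<lambda>x. X (\<theta> x)) x + ce (\<lambda>x. h m (\<theta> x)) x"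
    using int by (intro real_cond_exp_add) auto
  moreover have "AE x in M. ce (\<lambda>x. h m (\<theta> x)) x = ce (\<lambda>x. \<Sum>i<m. e i (\<theta> x)) x / real m"
    unfolding h_def using e_shift by (intro real_cond_exp_cdiv) auto
  moreover have "AE x in M. ce (\<lambda>x. \<Sum>i<m. e i (\<theta> x)) x = (\<Sum>i<m. ce (\<lambda>x. e i (\<theta> x)) x)"
    using e_shift by (rule real_cond_exp_sum)
  moreover have "AE x in M. \<forall>i. e (1 + i) x = e 1 x + ce (\<lambda>x. e i ((\<theta> ^^ 1) x)) x"
    unfolding AE_all_countable by (intro allI e_add)
  moreover have "AE x in M. ce (h m) x = h m x" using int by (intro real_cond_exp_F_meas) auto
  moreover have "AE x in M. ce (\<lambda>x. e m x / real m) x = e m x / real m" using int by (intro real_cond_exp_F_meas) auto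
  moreover have "AE x in M. e 1 x = ce (\<lambda>x. X (\<theta> x)) x" by (simp add: e_def S_def orbit_sum_def[abs_def])
  ultimately show "AE x in M. ce (Dm m) x = 0"
    using e_0
  proof eventually_elim
    case (elim x)
    have "ce (\<lambda>x. e i (\<theta> x)) x = e (Suc i) x - e 1 x" for i
      using elim(6)[rule_format, of i] by simp
    then have "(\<Sum>i<m. ce (\<lambda>x. e i (\<theta> x)) x) = (\<Sum>i<m. e (Suc i) x - e 1 x)"
      by (simp only:)
    also have "\<dots> = (\<Sum>i<m. e (Suc i) x - e i x) + (\<Sum>i<m. e i x) - real m * e 1 x"
      by (simp add: sum_subtractf)
    also have "(\<Sum>i<m. e (Suc i) x - e i x) = e m x"
      using elim(10) sum_lessThan_telescope[of "\<lambda>i. e i x" m] by simp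
    finally have "(\<Sum>i<m. ce (\<lambda>x. e i (\<theta> x)) x) / real m = e m x / real m + h m x - e 1 x"
      using m by (simp add: h_def field_simps)
    then show ?case using elim(1-5,7-9) by simp
  qed
qed

lemma orbit_sum_Dm:
  "orbit_sum \<theta> (Dm m) n x = S n x + h m ((\<theta> ^^ n) x) - h m x - (\<Sum>k<n. e m ((\<theta> ^^ k) x)) / real m"
  by (induction n) (simp_all add: orbit_sum_def S_def Dm_def add_divide_distrib)

text \<open>The error is \<open>h m\<close> at the two ends of the orbit plus \<open>n\<close>
  shifted copies of e_m / m. For \<open>n\<close> of the order of \<open>m\<close> it is thus
  governed by the norms of the \<open>e i\<close> with i <= m alone.\<close>

lemma l2_norm_S_minus_Dm:
  assumes m: "m \<noteq> 0" and B: "\<And>i. i < m \<Longrightarrow> a i \<le> B"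
  shows "l2_norm M (\<lambda>x. S n x - orbit_sum \<theta> (Dm m) n x) \<le> 2 * B + real n / real m * a m"
proof -
  define r where "r x = (\<Sum>k<n. e m ((\<theta> ^^ k) x)) / real m" for x
  have r_sq: "square_integrable M r"
    unfolding r_def by (intro square_integrable_divide square_integrable_sum square_integrable_iter e_sq)
  have "l2_norm M (\<lambda>x. S n x - orbit_sum \<theta> (Dm m) n x) = l2_norm M (\<lambda>x. (h m x - h m ((\<theta> ^^ n) x)) + r x)"
    by (rule l2_norm_cong) (simp add: orbit_sum_Dm r_def)
  also have "\<dots> \<le> l2_norm M (\<lambda>x. h m x - h m ((\<theta> ^^ n) x)) + l2_norm M r"
    by (intro l2_norm_add square_integrable_diff h_sq square_integrable_iter r_sq)
  also have "l2_norm M (\<lambda>x. h m x - h m ((\<theta> ^^ n) x)) \<le> l2_norm M (h m) + l2_norm M (\<lambda>x. h m ((\<theta> ^^ n) x))"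
    by (intro l2_norm_diff h_sq square_integrable_iter)
  also have "l2_norm M (\<lambda>x. h m ((\<theta> ^^ n) x)) = l2_norm M (h m)"
    using h_sq by (intro l2_norm_iter) auto
  also have "l2_norm M (h m) \<le> B"
  proof -
    have "l2_norm M (h m) = l2_norm M (\<lambda>x. \<Sum>i<m. e i x) / real m"
      unfolding h_def by (simp add: l2_norm_divide)
    also have "\<dots> \<le> (\<Sum>i<m. a i) / real m"
      unfolding a_def by (intro divide_right_mono l2_norm_sum e_sq) auto
    also have "\<dots> \<le> (\<Sum>i<m. B) / real m"
      using B by (intro divide_right_mono sum_mono) auto
    finally show ?thesis using m by simp
  qed
  also have "l2_norm M r \<le> real n / real m * a m"
  proof -
    have "l2_norm M r = l2_norm M (\<lambda>x. \<Sum>k<n. e m ((\<theta> ^^ k) x)) / real m"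
      unfolding r_def by (simp add: l2_norm_divide)
    also have "\<dots> \<le> (\<Sum>k<n. l2_norm M (\<lambda>x. e m ((\<theta> ^^ k) x))) / real m"
      by (intro divide_right_mono l2_norm_sum square_integrable_iter e_sq) auto
    also have "\<dots> = real n / real m * a m" by (simp add: l2_norm_iter a_def)
    finally show ?thesis .
  qed
  finally show ?thesis by simp
qed

text \<open>The differences of the approximating martingale differences are estimated through partial sums of
  length \<open>2 ^ j\<close>: orthogonality gains the factor \<open>\<surd>(2 ^ j)\<close>.\<close>

theorem martingale_approximation:
  assumes sum_a: "summable (\<lambda>n. real (Suc n) powr (-3/2) * ln (real (Suc n)) * a (Suc n))"
  obtains D where "martingale_difference D"
    and "summable (\<lambda>j. l2_norm M (orbit_sum \<theta> (\<lambda>x. X (\<theta> x) - D x) (2 ^ j)) / sqrt (2 ^ j))"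
    and "(\<lambda>n. l2_norm M (orbit_sum \<theta> (\<lambda>x. X (\<theta> x) - D x) n) / sqrt (real n)) \<longlonglongrightarrow> 0"
proof -
  define B where "B j = (\<Sum>k\<le>j. a (2 ^ k))" for j
  have B_nonneg: "0 \<le> B j" for j unfolding B_def by (intro sum_nonneg a_nonneg)
  have B_mono: "B j \<le> B (Suc j)" for j using a_nonneg by (simp add: B_def)
  have a_le_B: "a i \<le> B j" if "i \<le> 2 ^ j" for i j
    unfolding B_def by (rule subadditive_le_dyadic_sum[OF a_nonneg a_0 a_add that])
  have sum_B': "summable (\<lambda>j. real (Suc j) * (B j / sqrt (2 ^ j)))"
    unfolding B_def
    by (rule summable_dyadic_sums[OF a_nonneg summable_subadditive_dyadic[OF a_nonneg a_add sum_a]])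
  have sum_B: "summable (\<lambda>j. B j / sqrt (2 ^ j))"
    by (rule summable_comparison_test'[OF sum_B', of 0]) (use B_nonneg in \<open>simp add: field_simps\<close>)
  have approx: "l2_norm M (\<lambda>x. S n x - orbit_sum \<theta> (Dm (2 ^ j)) n x) \<le> 2 * B j + real n / 2 ^ j * B j" for n j
  proof -
    have "l2_norm M (\<lambda>x. S n x - orbit_sum \<theta> (Dm (2 ^ j)) n x) \<le> 2 * B j + real n / real (2 ^ j) * a (2 ^ j)"
      by (rule l2_norm_S_minus_Dm) (simp_all add: a_le_B)
    also have "real n / real (2 ^ j) * a (2 ^ j) \<le> real n / real (2 ^ j) * B j"
      by (intro mult_left_mono a_le_B) auto
    finally show ?thesis by simp
  qed
  define dd where "dd j x = Dm (2 ^ Suc j) x - Dm (2 ^ j) x" for j x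
  define \<delta> where "\<delta> j = l2_norm M (dd j)" for j
  have dd_sq: "square_integrable M (dd j)" for j unfolding dd_def by (intro square_integrable_diff Dm_sq)
  have dd_md: "martingale_difference (dd j)" for j
    unfolding dd_def by (intro martingale_difference_diff martingale_difference_Dm) auto
  have osq: "square_integrable M (\<lambda>x. S n x - orbit_sum \<theta> (Dm m) n x)" for n m
    by (intro square_integrable_diff S_sq square_integrable_orbit_sum Dm_sq)
  \<comment> \<open>The errors at the two levels are 3 \<open>B j\<close> and 5/2
    \<open>B (Suc j)\<close>, together at most 6 \<open>B (Suc j)\<close>. The factor sqrt 2
    converts sqrt(2^j) into sqrt(2^(j+1)).\<close>
  have delta_le: "\<delta> j \<le> 6 * sqrt 2 * (B (Suc j) / sqrt (2 ^ Suc j))" for j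
  proof -
    have "sqrt (2 ^ j) * \<delta> j = l2_norm M (orbit_sum \<theta> (dd j) (2 ^ j))"
      using l2_norm_martingale[OF dd_md[of j], of "2 ^ j"] by (simp add: \<delta>_def)
    also have "\<dots> = l2_norm M (\<lambda>x. (S (2 ^ j) x - orbit_sum \<theta> (Dm (2 ^ j)) (2 ^ j) x) - (S (2 ^ j) x - orbit_sum \<theta> (Dm (2 ^ Suc j)) (2 ^ j) x))"
      by (rule l2_norm_cong) (simp add: orbit_sum_def dd_def sum_subtractf)
    also have "\<dots> \<le> l2_norm M (\<lambda>x. S (2 ^ j) x - orbit_sum \<theta> (Dm (2 ^ j)) (2 ^ j) x)
        + l2_norm M (\<lambda>x. S (2 ^ j) x - orbit_sum \<theta> (Dm (2 ^ Suc j)) (2 ^ j) x)"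
      by (rule l2_norm_diff[OF osq osq])
    also have "\<dots> \<le> (2 * B j + B j) + (2 * B (Suc j) + 1 / 2 * B (Suc j))"
      using approx[of "2 ^ j" j] approx[of "2 ^ j" "Suc j"] by simp
    also have "\<dots> \<le> 6 * B (Suc j)" using B_mono[of j] B_nonneg[of "Suc j"] by simp
    finally show ?thesis by (simp add: real_sqrt_mult field_simps)
  qed
  have delta_nonneg: "0 \<le> \<delta> j" for j by (simp add: \<delta>_def)
  have sum_delta': "summable (\<lambda>j. real (Suc j) * \<delta> j)"
  proof (rule summable_comparison_test'[of _ 0])
    show "summable (\<lambda>j. 6 * sqrt 2 * (real (Suc (Suc j)) * (B (Suc j) / sqrt (2 ^ Suc j))))"
      using sum_B' by (intro summable_mult) (rule summable_Suc_iff[THEN iffD2])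
    fix j :: nat
    have "norm (real (Suc j) * \<delta> j) = real (Suc j) * \<delta> j" using delta_nonneg[of j] by simp
    also have "\<dots> \<le> real (Suc (Suc j)) * (6 * sqrt 2 * (B (Suc j) / sqrt (2 ^ Suc j)))"
      using delta_le[of j] delta_nonneg[of j] by (intro mult_mono) auto
    finally show "norm (real (Suc j) * \<delta> j) \<le> 6 * sqrt 2 * (real (Suc (Suc j)) * (B (Suc j) / sqrt (2 ^ Suc j)))"
      by (simp only: mult_ac)
  qed
  have sum_delta: "summable \<delta>"
    by (rule summable_comparison_test'[OF sum_delta', of 0]) (use delta_nonneg in \<open>simp add: algebra_simps\<close>)
  \<comment> \<open>This tail bounds the distance from \<open>Dm (2 ^ j)\<close> to the limit
    \<open>D\<close>. The weight \<open>Suc j\<close> in \<open>sum_delta'\<close> makes the tails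
    themselves summable.\<close>
  define \<tau> where "\<tau> j = (\<Sum>k. \<delta> (k + j))" for j
  have sum_tau: "summable \<tau>"
    unfolding \<tau>_def by (rule summable_tails[OF delta_nonneg sum_delta'])
  define D where "D x = Dm 1 x + (\<Sum>k. dd k x)" for x
  have sums: "square_integrable M (\<lambda>x. \<Sum>k. dd (k + j) x)" "l2_norm M (\<lambda>x. \<Sum>k. dd (k + j) x) \<le> \<tau> j"
    "AE x in M. summable (\<lambda>k. dd (k + j) x)" for j
    using l2_suminf[of "\<lambda>k. dd (k + j)"] dd_sq summable_ignore_initial_segment[OF sum_delta, of j]
    by (auto simp: \<delta>_def \<tau>_def)
  have D_sq: "square_integrable M D"
    unfolding D_def using sums(1)[of 0] by (intro square_integrable_add Dm_sq) simp
  have D_Fn: "D \<in> borel_measurable (Fn 1)"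
  proof -
    have [measurable]: "dd k \<in> borel_measurable (Fn 1)" "Dm 1 \<in> borel_measurable (Fn 1)" for k
      by (rule martingale_differenceD(1), rule dd_md)
        (rule martingale_differenceD(1), rule martingale_difference_Dm, simp)
    show ?thesis unfolding D_def by measurable
  qed
  have D_tail: "AE x in M. D x - Dm (2 ^ j) x = (\<Sum>k. dd (k + j) x)" for j
    using sums(3)[of 0]
  proof eventually_elim
    case (elim x)
    have "(\<Sum>k. dd k x) = (\<Sum>k. dd (k + j) x) + (\<Sum>k<j. dd k x)"
      using elim by (intro suminf_split_initial_segment) simp
    also have "(\<Sum>k<j. dd k x) = Dm (2 ^ j) x - Dm (2 ^ 0) x"
      unfolding dd_def by (rule sum_lessThan_telescope)
    finally show ?case by (simp add: D_def)
  qed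
  have [measurable]: "D \<in> borel_measurable M" "Dm m \<in> borel_measurable M" for m using D_sq Dm_sq by auto
  have D_norm: "l2_norm M (\<lambda>x. D x - Dm (2 ^ j) x) \<le> \<tau> j" for j
    using sums(1,2)[of j] l2_norm_cong_AE[OF D_tail[of j]] by auto
  have "tendsto \<tau> 0 sequentially" by (rule summable_LIMSEQ_zero[OF sum_tau])
  \<comment> \<open>Conditional expectation is a contraction and annihilates
    \<open>Dm (2 ^ j)\<close>, so the norm of \<open>ce D\<close> is below every tail.\<close>
  have "l2_norm M (ce D) \<le> \<tau> j" for j
  proof -
    have md: "martingale_difference (Dm (2 ^ j))" by (rule martingale_difference_Dm) simp
    have "AE x in M. ce D x = ce (\<lambda>x. D x - Dm (2 ^ j) x) x"
      using real_cond_exp_diff[OF square_integrable_integrable[OF D_sq] martingale_differenceD(4)[OF md]]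
        martingale_differenceD(5)[OF md] by eventually_elim simp
    then have "l2_norm M (ce D) = l2_norm M (ce (\<lambda>x. D x - Dm (2 ^ j) x))"
      by (rule l2_norm_cong_AE) auto
    also have "\<dots> \<le> l2_norm M (\<lambda>x. D x - Dm (2 ^ j) x)"
      by (intro l2_norm_ce square_integrable_diff D_sq Dm_sq)
    also have "\<dots> \<le> \<tau> j" by (rule D_norm)
    finally show ?thesis .
  qed
  then have "l2_norm M (ce D) \<le> 0"
    by (intro LIMSEQ_le_const[OF \<open>\<tau> \<longlonglongrightarrow> 0\<close>]) auto
  then have "l2_norm M (ce D) = 0" by (simp add: antisym)
  then have D_md: "martingale_difference D"
    using l2_norm_eq_0 square_integrable_ce[OF D_sq] D_sq D_Fn by (auto simp: martingale_difference_def)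
  define R where "R = orbit_sum \<theta> (\<lambda>x. X (\<theta> x) - D x)"
  \<comment> \<open>The level \<open>j\<close> is free. The choice n = 2^j gives 3
    \<open>B j\<close> and the summable bound; for 2^j <= n < 2^(j+1) the first two terms are at
    most 4 \<open>B j\<close>, which gives the limit along all \<open>n\<close>.\<close>
  have R_le: "l2_norm M (R n) \<le> 2 * B j + real n / 2 ^ j * B j + sqrt n * \<tau> j" for n j
  proof -
    have md: "martingale_difference (\<lambda>x. D x - Dm (2 ^ j) x)"
      by (intro martingale_difference_diff D_md martingale_difference_Dm) simp
    have "l2_norm M (R n) = l2_norm M (\<lambda>x. (S n x - orbit_sum \<theta> (Dm (2 ^ j)) n x) - orbit_sum \<theta> (\<lambda>x. D x - Dm (2 ^ j) x) n x)"
      by (rule l2_norm_cong) (simp add: R_def S_def orbit_sum_def sum_subtractf)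
    also have "\<dots> \<le> l2_norm M (\<lambda>x. S n x - orbit_sum \<theta> (Dm (2 ^ j)) n x) + l2_norm M (orbit_sum \<theta> (\<lambda>x. D x - Dm (2 ^ j) x) n)"
      using md by (intro l2_norm_diff osq square_integrable_orbit_sum) (rule martingale_differenceD)
    also have "l2_norm M (orbit_sum \<theta> (\<lambda>x. D x - Dm (2 ^ j) x) n) = sqrt n * l2_norm M (\<lambda>x. D x - Dm (2 ^ j) x)"
      by (rule l2_norm_martingale[OF md])
    also have "\<dots> \<le> sqrt n * \<tau> j" by (intro mult_left_mono D_norm) simp
    finally show ?thesis using approx[of n j] by simp
  qed
  show thesis
  proof (rule that[OF D_md])
    show "summable (\<lambda>j. l2_norm M (orbit_sum \<theta> (\<lambda>x. X (\<theta> x) - D x) (2 ^ j)) / sqrt (2 ^ j))"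
    proof (rule summable_comparison_test'[of _ 0])
      show "summable (\<lambda>j. 3 * (B j / sqrt (2 ^ j)) + \<tau> j)"
        by (intro summable_add summable_mult sum_B sum_tau)
      fix j
      have "l2_norm M (R (2 ^ j)) \<le> 3 * B j + sqrt (2 ^ j) * \<tau> j" using R_le[of "2 ^ j" j] by simp
      then show "norm (l2_norm M (orbit_sum \<theta> (\<lambda>x. X (\<theta> x) - D x) (2 ^ j)) / sqrt (2 ^ j)) \<le> 3 * (B j / sqrt (2 ^ j)) + \<tau> j"
        by (simp add: R_def field_simps)
    qed
    have lim: "(\<lambda>j. 4 * (B j / sqrt (2 ^ j)) + \<tau> j) \<longlonglongrightarrow> 4 * 0 + 0"
      by (intro tendsto_intros summable_LIMSEQ_zero sum_B sum_tau)
    show "(\<lambda>n. l2_norm M (orbit_sum \<theta> (\<lambda>x. X (\<theta> x) - D x) n) / sqrt (real n)) \<longlonglongrightarrow> 0"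
    proof (rule LIMSEQ_I)
      fix \<epsilon> :: real assume \<epsilon>: "0 < \<epsilon>"
      from LIMSEQ_D[OF lim \<epsilon>]
      obtain r0 where r0: "\<And>r. r0 \<le> r \<Longrightarrow> norm (4 * (B r / sqrt (2 ^ r)) + \<tau> r) < \<epsilon>" by auto
      show "\<exists>no. \<forall>n\<ge>no. norm (l2_norm M (orbit_sum \<theta> (\<lambda>x. X (\<theta> x) - D x) n) / sqrt (real n) - 0) < \<epsilon>"
      proof (intro exI[of _ "2 ^ r0"] allI impI)
        fix n :: nat assume n: "2 ^ r0 \<le> n"
        then have "1 \<le> n" using order_trans[of 1 "2 ^ r0" n] by simp
        then obtain r where r: "2 ^ r \<le> n" "n < 2 ^ (r + 1)" using ex_power_ivl1[of 2 n] by auto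
        then have "(2::nat) ^ r0 < 2 ^ (r + 1)" using n by linarith
        then have "r0 < r + 1" by (rule power_less_imp_less_exp[rotated]) simp
        then have "r0 \<le> r" by simp
        have r': "2 ^ r \<le> real n" "real n \<le> 2 * 2 ^ r"
        proof -
          have "real (2 ^ r) \<le> real n" "real n \<le> real (2 ^ (r + 1))" using r by (simp_all only: of_nat_le_iff less_imp_le)
          then show "2 ^ r \<le> real n" "real n \<le> 2 * 2 ^ r" by simp_all
        qed
        have "real n / 2 ^ r * B r \<le> 2 * B r"
          using r' B_nonneg[of r] by (intro mult_right_mono) (auto simp: field_simps)
        then have "l2_norm M (R n) / sqrt n \<le> (4 * B r + sqrt n * \<tau> r) / sqrt n"
          using R_le[of n r] by (intro divide_right_mono) auto
        also have "\<dots> = 4 * B r / sqrt n + \<tau> r" using \<open>1 \<le> n\<close> by (simp add: field_simps)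
        also have "\<dots> \<le> 4 * B r / sqrt (2 ^ r) + \<tau> r"
          using r' B_nonneg[of r] \<open>1 \<le> n\<close> by (intro add_mono divide_left_mono) auto
        also have "\<dots> < \<epsilon>" using r0[OF \<open>r0 \<le> r\<close>] by simp
        finally show "norm (l2_norm M (orbit_sum \<theta> (\<lambda>x. X (\<theta> x) - D x) n) / sqrt (real n) - 0) < \<epsilon>"
          by (simp add: R_def)
      qed
    qed
  qed
qed

end

subsection \<open>The conditional central limit theorem for martingale differences\<close>

lemma abs_cos_diff_le: "\<bar>cos a - cos b\<bar> \<le> \<bar>a - b\<bar>" for a b :: real
  using field_differentiable_bound[of UNIV cos "\<lambda>x. - sin x" 1 a b]
  by (auto intro: DERIV_subset[OF DERIV_cos])

lemma abs_sin_diff_le: "\<bar>sin a - sin b\<bar> \<le> \<bar>a - b\<bar>" for a b :: real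
  using field_differentiable_bound[of UNIV sin cos 1 a b]
  by (auto intro: DERIV_subset[OF DERIV_sin])

lemma cmod_one_plus_le: "cmod (1 + \<i> * y) \<le> exp (y\<^sup>2 / 2)"
proof (rule power2_le_imp_le)
  have "(cmod (1 + \<i> * y))\<^sup>2 = 1 + y\<^sup>2" by (simp add: cmod_power2)
  also have "\<dots> \<le> exp (y\<^sup>2)" by (rule exp_ge_add_one_self)
  also have "\<dots> = (exp (y\<^sup>2 / 2))\<^sup>2" by (simp add: exp_double[symmetric])
  finally show "(cmod (1 + \<i> * y))\<^sup>2 \<le> (exp (y\<^sup>2 / 2))\<^sup>2" .
qed simp

lemma exp_minus_le_quadratic:
  fixes v :: real
  assumes "0 \<le> v"
  shows "exp (- v) \<le> 1 - v + v\<^sup>2 / 2"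
proof -
  have p: "0 < 1 + v + v\<^sup>2 / 2" using assms by (simp add: add_pos_nonneg)
  have "exp (- v) \<le> 1 / (1 + v + v\<^sup>2 / 2)"
    using exp_lower_Taylor_quadratic[OF assms] p by (simp add: exp_minus inverse_eq_divide frac_le)
  also have "\<dots> \<le> 1 - v + v\<^sup>2 / 2"
  proof -
    have "(1 - v + v\<^sup>2 / 2) * (1 + v + v\<^sup>2 / 2) = 1 + (v\<^sup>2)\<^sup>2 / 4"
      by (simp add: power2_eq_square algebra_simps)
    then show ?thesis using p by (simp add: divide_le_eq)
  qed
  finally show ?thesis .
qed

text \<open>For small \<open>y\<close> both expressions equal 1 + i y - y^2 / 2 up to third order.
  For |y| > 1 both have modulus at most 1, and this case dictates the constant 2.\<close>

lemma norm_iexp_minus_le: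
  fixes y :: real
  shows "cmod (iexp y - (1 + \<i> * y) * exp (- (y\<^sup>2) / 2)) \<le> 2 * \<bar>y\<bar> ^ 3"
proof (cases "\<bar>y\<bar> \<le> 1")
  case True
  define u where "u = exp (- (y\<^sup>2) / 2) - 1 + y\<^sup>2 / 2"
  have u: "\<bar>u\<bar> \<le> y\<^sup>2 * \<bar>y\<bar> / 4"
  proof -
    have "0 \<le> u" using exp_ge_add_one_self[of "- (y\<^sup>2) / 2"] by (simp add: u_def)
    moreover have "u \<le> (y\<^sup>2 / 2)\<^sup>2 / 2"
      using exp_minus_le_quadratic[of "y\<^sup>2 / 2"] by (simp add: u_def)
    moreover have "(y\<^sup>2 / 2)\<^sup>2 / 2 \<le> y\<^sup>2 * \<bar>y\<bar> / 4"
    proof -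
      have "(z\<^sup>2 / 2)\<^sup>2 / 2 \<le> z\<^sup>2 * z / 4" if "0 \<le> z" "z \<le> 1" for z :: real
      proof -
        have "z * (z\<^sup>2 * z) \<le> 1 * (z\<^sup>2 * z)" using that by (intro mult_right_mono) auto
        moreover have "0 \<le> z\<^sup>2 * z" using that by simp
        ultimately show ?thesis by (simp add: power2_eq_square mult_ac)
      qed
      from this[of "\<bar>y\<bar>"] True show ?thesis by simp
    qed
    ultimately show ?thesis by linarith
  qed
  have "cmod (iexp y - (\<Sum>k\<le>2. (\<i> * y) ^ k / fact k)) \<le> \<bar>y\<bar> ^ 3 / fact 3"
    using iexp_approx1[of y 2] by (simp add: numeral_3_eq_3)
  then have 1: "cmod (iexp y - (1 + \<i> * y - y\<^sup>2 / 2)) \<le> \<bar>y\<bar> ^ 3 / 6"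
    by (simp add: numeral_2_eq_2 power_mult_distrib fact_numeral)
  have 2: "cmod ((1 + \<i> * y) * u) \<le> 2 * (y\<^sup>2 * \<bar>y\<bar> / 4)"
    unfolding norm_mult
  proof (rule mult_mono)
    show "cmod (1 + \<i> * y) \<le> 2"
      using norm_triangle_ineq[of 1 "\<i> * y"] True by (simp add: norm_mult)
  qed (use u in auto)
  have 3: "cmod (\<i> * y ^ 3 / 2) = \<bar>y\<bar> ^ 3 / 2" by (simp add: norm_mult norm_divide norm_power)
  have "iexp y - (1 + \<i> * y) * exp (- (y\<^sup>2) / 2)
    = (iexp y - (1 + \<i> * y - y\<^sup>2 / 2)) + \<i> * y ^ 3 / 2 - (1 + \<i> * y) * u"
    by (simp add: u_def algebra_simps power2_eq_square power3_eq_cube)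
  also have "cmod \<dots> \<le> \<bar>y\<bar> ^ 3 / 6 + \<bar>y\<bar> ^ 3 / 2 + 2 * (y\<^sup>2 * \<bar>y\<bar> / 4)"
    using norm_triangle_ineq4[of "(iexp y - (1 + \<i> * y - y\<^sup>2 / 2)) + \<i> * y ^ 3 / 2" "(1 + \<i> * y) * u"]
      norm_triangle_ineq[of "iexp y - (1 + \<i> * y - y\<^sup>2 / 2)" "\<i> * y ^ 3 / 2"] 1 2 3 by linarith
  also have "\<dots> \<le> 2 * \<bar>y\<bar> ^ 3"
  proof -
    have "\<bar>y\<bar> ^ 3 = y\<^sup>2 * \<bar>y\<bar>" by (simp add: power3_eq_cube power2_eq_square)
    moreover have "0 \<le> y\<^sup>2 * \<bar>y\<bar>" by simp
    ultimately show ?thesis by linarith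
  qed
  finally show ?thesis .
next
  case False
  have "cmod ((1 + \<i> * y) * exp (- (y\<^sup>2) / 2)) \<le> exp (y\<^sup>2 / 2) * exp (- (y\<^sup>2) / 2)"
    unfolding norm_mult using cmod_one_plus_le[of y] by (intro mult_mono) auto
  also have "\<dots> = 1" by (simp add: exp_add[symmetric])
  finally have "cmod ((1 + \<i> * y) * exp (- (y\<^sup>2) / 2)) \<le> 1" .
  moreover have "cmod (iexp y) = 1" by simp
  ultimately have "cmod (iexp y - (1 + \<i> * y) * exp (- (y\<^sup>2) / 2)) \<le> 2"
    using norm_triangle_ineq4[of "iexp y" "(1 + \<i> * y) * exp (- (y\<^sup>2) / 2)"] by linarith
  moreover have "1 \<le> \<bar>y\<bar> ^ 3" using False by (intro one_le_power) auto
  ultimately show ?thesis by linarith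
qed

section \<open>Conditional dominated convergence, McLeish's products, Hopf's inequality and
  truncation\<close>

context filtered_system
begin

text \<open>Almost sure convergence is obtained through the decreasing majorants \<open>Z n\<close>,
  the suprema of the later terms. The conditional expectation of \<open>Z n\<close> bounds those of
  all later terms, so a single \<open>n\<close> with \<open>ce (Z n) x\<close> small suffices;
  Markov's inequality and \<open>AE_exists_small\<close> provide it.\<close>

lemma ce_bounded_convergence:
  fixes Y :: "nat \<Rightarrow> 'a \<Rightarrow> real"
  assumes [measurable]: "\<And>n. Y n \<in> borel_measurable M" and C: "\<And>n x. \<bar>Y n x\<bar> \<le> C"
    and lim: "AE x in M. (\<lambda>n. Y n x) \<longlonglongrightarrow> 0"
  shows "AE x in M. (\<lambda>n. ce (Y n) x) \<longlonglongrightarrow> 0"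
proof -
  define Z where "Z n x = (SUP k. \<bar>Y (n + k) x\<bar>)" for n x
  have bdd: "bdd_above (range (\<lambda>k. \<bar>Y (n + k) x\<bar>))" for n x
    by (rule bdd_aboveI2[where M = C]) (rule C)
  have [measurable]: "Z n \<in> borel_measurable M" for n
    unfolding Z_def using bdd by (intro borel_measurable_cSUP) auto
  have Z_ge: "\<bar>Y (n + k) x\<bar> \<le> Z n x" for n k x
    unfolding Z_def using bdd by (rule cSUP_upper[rotated]) simp
  have Z_nonneg: "0 \<le> Z n x" for n x using Z_ge[of n 0 x] by simp
  have Z_le: "Z n x \<le> C" for n x unfolding Z_def using C by (intro cSUP_least) auto
  have Z_lim: "AE x in M. (\<lambda>n. Z n x) \<longlonglongrightarrow> 0"
    using lim
  proof eventually_elim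
    case (elim x)
    show ?case
    proof (rule LIMSEQ_I)
      fix r :: real assume r: "0 < r"
      from LIMSEQ_D[OF elim, of "r / 2"] r obtain N where N: "\<And>n. N \<le> n \<Longrightarrow> \<bar>Y n x\<bar> < r / 2" by auto
      have "Z n x \<le> r / 2" if "N \<le> n" for n
      proof -
        have "\<bar>Y (n + k) x\<bar> \<le> r / 2" for k using N[of "n + k"] that by simp
        then show ?thesis unfolding Z_def by (intro cSUP_least) auto
      qed
      then have "norm (Z n x - 0) < r" if "N \<le> n" for n
        using r Z_nonneg[of n x] that by fastforce
      then show "\<exists>N. \<forall>n\<ge>N. norm (Z n x - 0) < r" by blast
    qed
  qed
  have int_Z: "integrable M (Z n)" for n
    by (rule integrable_const_bound[of _ C]) (use Z_nonneg Z_le in auto)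
  have int_Y: "integrable M (Y n)" for n
    by (rule integrable_const_bound[of _ C]) (use C in auto)
  have "(\<lambda>n. \<integral>x. Z n x \<partial>M) \<longlonglongrightarrow> (\<integral>x. 0 \<partial>M)"
    by (rule integral_dominated_convergence[where w = "\<lambda>_. C"]) (use Z_lim Z_nonneg Z_le in auto)
  then have int_lim: "(\<lambda>n. \<integral>x. Z n x \<partial>M) \<longlonglongrightarrow> 0" by simp
  have "AE x in M. \<exists>n\<ge>0. ce (Z n) x < 1 / real (Suc m)" for m
  proof (rule AE_exists_small)
    have "prob {x \<in> space M. \<not> ce (Z n) x < 1 / real (Suc m)} \<le> real (Suc m) * (\<integral>x. Z n x \<partial>M)" for n
    proof -
      have "AE x in M. 0 \<le> ce (Z n) x" by (rule real_cond_exp_pos) (use Z_nonneg in auto)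
      then have "prob {x \<in> space M. 1 / real (Suc m) \<le> ce (Z n) x} \<le> (\<integral>x. ce (Z n) x \<partial>M) / (1 / real (Suc m))"
        by (intro integral_Markov_inequality_measure[where A = "{}"]) (use real_cond_exp_int[OF int_Z] in auto)
      then show ?thesis using real_cond_exp_int(2)[OF int_Z] by (simp add: not_less mult.commute)
    qed
    then show "(\<lambda>n. prob {x \<in> space M. \<not> ce (Z n) x < 1 / real (Suc m)}) \<longlonglongrightarrow> 0"
      by (intro tendsto_sandwich[OF _ _ tendsto_const tendsto_mult_right_zero[OF int_lim, of "real (Suc m)"]]) auto
  qed auto
  then have "AE x in M. \<forall>m. \<exists>n. ce (Z n) x < 1 / real (Suc m)" by (simp add: AE_all_countable)
  moreover have "AE x in M. \<forall>n. \<bar>ce (Y n) x\<bar> \<le> ce (\<lambda>x. \<bar>Y n x\<bar>) x"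
    unfolding AE_all_countable using int_Y by (intro allI ce_abs)
  moreover have "AE x in M. \<forall>n k. ce (\<lambda>x. \<bar>Y (n + k) x\<bar>) x \<le> ce (Z n) x"
    unfolding AE_all_countable using int_Y int_Z Z_ge by (intro allI real_cond_exp_mono) auto
  ultimately show ?thesis
  proof eventually_elim
    case (elim x)
    show ?case
    proof (rule LIMSEQ_I)
      fix r :: real assume "0 < r"
      then obtain m where m: "1 / real (Suc m) < r" using nat_approx_posE by blast
      obtain n where n: "ce (Z n) x < 1 / real (Suc m)" using elim(1) by blast
      have "\<bar>ce (Y k) x\<bar> < r" if nk: "n \<le> k" for k
      proof -
        obtain i where "k = n + i" using le_Suc_ex[OF nk] by blast
        then show ?thesis using elim(2)[rule_format, of k] elim(3)[rule_format, of n i] n m by simp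
      qed
      then show "\<exists>n. \<forall>k\<ge>n. norm (ce (Y k) x - 0) < r" by auto
    qed
  qed
qed

text \<open>Each new factor has conditional mean 1 given the preceding times. With \<open>s\<close>
  of order 1 / sqrt n the modulus bound is uniform in \<open>n\<close>.\<close>

lemma martingale_exponential:
  fixes s :: real
  assumes D: "martingale_difference D" and K: "\<And>x. \<bar>D x\<bar> \<le> K"
  defines "P \<equiv> \<lambda>n x. \<Prod>k<n. 1 + \<i> * (s * D ((\<theta> ^^ k) x))"
  shows "AE x in M. ce (\<lambda>x. Re (P n x)) x = 1"
    and "AE x in M. ce (\<lambda>x. Im (P n x)) x = 0"
    and "cmod (P n x) \<le> exp (real n * (s * K)\<^sup>2 / 2)"
    and "(\<lambda>x. P n x) \<in> borel_measurable M"
proof -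
  note D' = martingale_differenceD[OF D]
  have "0 \<le> K" using K[of undefined] by simp
  have P_le: "cmod (P n x) \<le> exp (real n * (s * K)\<^sup>2 / 2)" for n x
  proof -
    have "cmod (P n x) \<le> (\<Prod>k<n. exp ((s * K)\<^sup>2 / 2))"
      unfolding P_def prod_norm[symmetric]
    proof (intro prod_mono conjI)
      fix k
      have "\<bar>s * D ((\<theta> ^^ k) x)\<bar> \<le> \<bar>s * K\<bar>"
        using K[of "(\<theta> ^^ k) x"] \<open>0 \<le> K\<close> by (simp add: abs_mult mult_left_mono)
      then have "(s * D ((\<theta> ^^ k) x))\<^sup>2 \<le> (s * K)\<^sup>2" by (simp only: abs_le_square_iff)
      then show "cmod (1 + \<i> * (s * D ((\<theta> ^^ k) x))) \<le> exp ((s * K)\<^sup>2 / 2)"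
        using cmod_one_plus_le[of "s * D ((\<theta> ^^ k) x)"] by (intro order_trans[OF cmod_one_plus_le]) auto
    qed simp
    then show ?thesis by (simp add: exp_of_nat_mult[symmetric])
  qed
  then show "cmod (P n x) \<le> exp (real n * (s * K)\<^sup>2 / 2)" .
  have P_Fn: "P n \<in> borel_measurable (Fn n)" for n
  proof -
    have "(\<lambda>x. D ((\<theta> ^^ k) x)) \<in> borel_measurable (Fn n)" if "k < n" for k
      using iter_Fn_measurable[OF D'(1), of k] that by (intro Fn_measurable_mono[of "Suc k" n]) auto
    then have "(\<lambda>x. 1 + \<i> * (s * D ((\<theta> ^^ k) x))) \<in> borel_measurable (Fn n)" if "k < n" for k
      using that by (intro borel_measurable_add borel_measurable_const borel_measurable_times
          borel_measurable_of_real) auto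
    then show ?thesis unfolding P_def by (intro borel_measurable_prod) auto
  qed
  have P_M [measurable]: "P n \<in> borel_measurable M" for n
    by (rule measurable_from_subalg[OF subalgebra_Fn P_Fn])
  then show "(\<lambda>x. P n x) \<in> borel_measurable M" by simp
  have [measurable]: "D \<in> borel_measurable M" by (rule D')
  have int_Re: "integrable M (\<lambda>x. Re (P n x))" and int_Im: "integrable M (\<lambda>x. Im (P n x))" for n
    using order_trans[OF abs_Re_le_cmod P_le[of n]] order_trans[OF abs_Im_le_cmod P_le[of n]]
    by (auto intro!: integrable_const_bound[of _ "exp (real n * (s * K)\<^sup>2 / 2)"])
  have ind_A: "(\<integral>x. indicator A x * Re (P n x) \<partial>M) = prob A \<and> (\<integral>x. indicator A x * Im (P n x) \<partial>M) = 0"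
    if A: "A \<in> sets F" for A
  proof (induction n)
    case 0
    show ?case using sets_F[OF A] by (simp add: P_def)
  next
    case (Suc n)
    note [measurable] = sets_F[OF A]
    have A_Fn: "indicator A \<in> borel_measurable (Fn n)" using A by (intro F_measurable_Fn) auto
    have meas: "(\<lambda>x. indicator A x * (s * Re (P n x))) \<in> borel_measurable (Fn n)"
      "(\<lambda>x. indicator A x * (s * Im (P n x))) \<in> borel_measurable (Fn n)"
      using A_Fn P_Fn[of n] by measurable
    define C where "C = \<bar>s\<bar> * exp (real n * (s * K)\<^sup>2 / 2) * K"
    have bd: "\<bar>indicator A x * (s * v) * D y\<bar> \<le> C" if "\<bar>v\<bar> \<le> cmod (P n x)" for x y v
    proof -
      have "\<bar>indicator A x * (s * v) * D y\<bar> \<le> 1 * (\<bar>s\<bar> * exp (real n * (s * K)\<^sup>2 / 2)) * K"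
        unfolding abs_mult using that P_le[of n x] K[of y] by (intro mult_mono) (auto simp: indicator_def)
      then show ?thesis by (simp add: C_def)
    qed
    have int: "integrable M (\<lambda>x. indicator A x * (s * Re (P n x)) * D ((\<theta> ^^ n) x))"
      "integrable M (\<lambda>x. indicator A x * (s * Im (P n x)) * D ((\<theta> ^^ n) x))"
      by (auto intro!: integrable_const_bound[of _ C] bd abs_Re_le_cmod abs_Im_le_cmod)
    have zero: "(\<integral>x. indicator A x * (s * Re (P n x)) * D ((\<theta> ^^ n) x) \<partial>M) = 0"
      "(\<integral>x. indicator A x * (s * Im (P n x)) * D ((\<theta> ^^ n) x) \<partial>M) = 0"
      by (rule martingale_difference_orthogonal[OF D meas(1) int(1)],
          rule martingale_difference_orthogonal[OF D meas(2) int(2)])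
    have intA: "integrable M (\<lambda>x. indicator A x * Re (P n x))" "integrable M (\<lambda>x. indicator A x * Im (P n x))"
      using integrable_mult_indicator[OF sets_F[OF A] int_Re] integrable_mult_indicator[OF sets_F[OF A] int_Im] by simp_all
    \<comment> \<open>Multiplication by 1 + i s D couples the real and the imaginary part, so the
      induction carries both; each correction is an increment times a quantity known at time
      \<open>n\<close> and integrates to zero.\<close>
    have step: "indicator A x * Re (P (Suc n) x) = indicator A x * Re (P n x) - indicator A x * (s * Im (P n x)) * D ((\<theta> ^^ n) x)"
      "indicator A x * Im (P (Suc n) x) = indicator A x * Im (P n x) + indicator A x * (s * Re (P n x)) * D ((\<theta> ^^ n) x)" for x
      by (simp_all add: P_def algebra_simps)
    show ?case unfolding step using Suc int zero intA by simp
  qed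
  show "AE x in M. ce (\<lambda>x. Re (P n x)) x = 1"
    by (rule real_cond_exp_charact) (use ind_A int_Re sets_F in \<open>auto simp: set_lebesgue_integral_def\<close>)
  show "AE x in M. ce (\<lambda>x. Im (P n x)) x = 0"
    by (rule real_cond_exp_charact) (use ind_A int_Im sets_F in \<open>auto simp: set_lebesgue_integral_def\<close>)
qed

text \<open>By ergodicity the limit \<open>c\<close> of the Gaussian factor is a constant, so the
  conditional expectation of \<open>c * P n\<close> is exactly \<open>c\<close>. Only the difference
  \<open>W n\<close> remains; it is uniformly bounded and tends to zero almost surely.\<close>

lemma conditional_clt_bounded:
  fixes t :: real
  assumes D: "martingale_difference D" and K: "\<And>x. \<bar>D x\<bar> \<le> K"
  defines "c \<equiv> exp (- (t\<^sup>2 * (\<integral>x. (D x)\<^sup>2 \<partial>M)) / 2)"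
  shows "AE x in M. (\<lambda>n. ce (\<lambda>x. cos (t * (orbit_sum \<theta> D n x / sqrt (real n)))) x) \<longlonglongrightarrow> c"
    and "AE x in M. (\<lambda>n. ce (\<lambda>x. sin (t * (orbit_sum \<theta> D n x / sqrt (real n)))) x) \<longlonglongrightarrow> 0"
proof -
  note D' = martingale_differenceD[OF D]
  have [measurable]: "D \<in> borel_measurable M" by (rule D')
  have "0 \<le> K" using K[of undefined] by simp
  define s where "s n = t / sqrt (real n)" for n
  define P where "P n x = (\<Prod>k<n. 1 + \<i> * (s n * D ((\<theta> ^^ k) x)))" for n x
  note expo = martingale_exponential[OF D K, where s = "s n" and n = n for n, folded P_def]
  have [measurable]: "P n \<in> borel_measurable M" for n using expo(4) by simp
  have P_le: "cmod (P n x) \<le> exp ((t * K)\<^sup>2 / 2)" for n x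
  proof -
    have "real n * (s n * K)\<^sup>2 \<le> (t * K)\<^sup>2"
      by (cases "n = 0") (auto simp: s_def power_mult_distrib power_divide)
    then have "exp (real n * (s n * K)\<^sup>2 / 2) \<le> exp ((t * K)\<^sup>2 / 2)" by simp
    with expo(3)[of n x] show ?thesis by (rule order_trans)
  qed
  define W where "W n x = iexp (t * (orbit_sum \<theta> D n x / sqrt (real n))) - c * P n x" for n x
  have [measurable]: "W n \<in> borel_measurable M" for n unfolding W_def by measurable
  have c: "0 < c" by (simp add: c_def)
  define C where "C = 1 + c * exp ((t * K)\<^sup>2 / 2)"
  have W_le: "cmod (W n x) \<le> C" for n x
  proof -
    have "cmod (W n x) \<le> cmod (iexp (t * (orbit_sum \<theta> D n x / sqrt (real n)))) + cmod (c * P n x)"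
      unfolding W_def by (rule norm_triangle_ineq4)
    also have "\<dots> \<le> 1 + c * exp ((t * K)\<^sup>2 / 2)"
      using P_le[of n x] c by (intro add_mono) (auto simp: norm_mult)
    finally show ?thesis by (simp add: C_def)
  qed
  define v where "v = (\<integral>x. (D x)\<^sup>2 \<partial>M)"
  have "AE x in M. (\<lambda>n. (\<Sum>i<n. (D ((\<theta> ^^ i) x))\<^sup>2) / real n) \<longlonglongrightarrow> v"
    unfolding v_def using D' by (intro birkhoff[of "\<lambda>x. (D x)\<^sup>2"]) auto
  then have W_lim: "AE x in M. (\<lambda>n. W n x) \<longlonglongrightarrow> 0"
  proof eventually_elim
    case (elim x)
    define d where "d k = D ((\<theta> ^^ k) x)" for k
    define V where "V n = (\<Sum>k<n. (d k)\<^sup>2) / real n" for n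
    have V: "V \<longlonglongrightarrow> v" unfolding V_def[abs_def] d_def by (rule elim)
    \<comment> \<open>Replacing the exponentials costs a multiple of the sum of |y_k|^3, of order n
      n^(-3/2). Replacing the empirical variance \<open>V n\<close> by its limit costs the second
      term, \<open>P n\<close> being uniformly bounded.\<close>
    have bound: "cmod (W n x) \<le> 2 * (\<bar>t\<bar> * K) ^ 3 * (1 / sqrt (real n)) + exp ((t * K)\<^sup>2 / 2) * \<bar>exp (- (t\<^sup>2 * V n) / 2) - c\<bar>" for n
    proof (cases "n = 0")
      case True
      \<comment> \<open>With division by zero the first term of the bound is 0 and
        \<open>V 0 = 0\<close>, which leaves |1 - c| times a factor at least 1.\<close>
      have "W 0 x = of_real (1 - c)" by (simp add: W_def orbit_sum_def P_def)
      then have "cmod (W 0 x) = 1 * \<bar>1 - c\<bar>" by (simp only: norm_of_real mult_1)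
      also have "\<dots> \<le> exp ((t * K)\<^sup>2 / 2) * \<bar>1 - c\<bar>" by (intro mult_right_mono) auto
      finally show ?thesis using True by (simp add: V_def)
    next
      case False
      define y where "y k = s n * d k" for k
      have sq: "(\<Sum>k<n. (y k)\<^sup>2) = t\<^sup>2 * V n"
        using False by (simp add: y_def V_def s_def power_mult_distrib power_divide sum_distrib_left sum_divide_distrib)
      have "t * (orbit_sum \<theta> D n x / sqrt (real n)) = (\<Sum>k<n. y k)"
        by (simp add: y_def d_def orbit_sum_def s_def sum_distrib_left sum_divide_distrib)
      then have 1: "iexp (t * (orbit_sum \<theta> D n x / sqrt (real n))) = (\<Prod>k<n. iexp (y k))"
        by (simp add: exp_sum sum_distrib_left)
      have "complex_of_real (exp (- (t\<^sup>2 * V n) / 2)) = (\<Prod>k<n. of_real (exp (- ((y k)\<^sup>2) / 2)))"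
        by (simp add: sq[symmetric] exp_sum[symmetric] sum_negf[symmetric] sum_divide_distrib flip: of_real_prod)
      then have 2: "P n x * exp (- (t\<^sup>2 * V n) / 2) = (\<Prod>k<n. (1 + \<i> * y k) * exp (- ((y k)\<^sup>2) / 2))"
        by (simp add: P_def y_def d_def prod.distrib)
      have y_le: "\<bar>y k\<bar> \<le> \<bar>t\<bar> * K / sqrt (real n)" for k
        using K[of "(\<theta> ^^ k) x"] by (simp add: y_def d_def s_def abs_mult mult_left_mono divide_right_mono)
      have "cmod (iexp (t * (orbit_sum \<theta> D n x / sqrt (real n))) - P n x * exp (- (t\<^sup>2 * V n) / 2))
        \<le> (\<Sum>k<n. cmod (iexp (y k) - (1 + \<i> * y k) * exp (- ((y k)\<^sup>2) / 2)))"
        unfolding 1 2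
      \<comment> \<open>This comparison requires factors of modulus at most 1, which is why the
        Gaussian factor is distributed over the single terms 1 + i y_k.\<close>
      proof (rule norm_prod_diff)
        fix k
        have "cmod ((1 + \<i> * y k) * exp (- ((y k)\<^sup>2) / 2)) \<le> exp ((y k)\<^sup>2 / 2) * exp (- ((y k)\<^sup>2) / 2)"
          unfolding norm_mult using cmod_one_plus_le[of "y k"] by (intro mult_mono) auto
        also have "\<dots> = 1" by (simp add: exp_add[symmetric])
        finally show "cmod ((1 + \<i> * y k) * exp (- ((y k)\<^sup>2) / 2)) \<le> 1" .
      qed simp
      also have "\<dots> \<le> (\<Sum>k<n. 2 * (\<bar>t\<bar> * K / sqrt (real n)) ^ 3)"
        using y_le by (intro sum_mono order_trans[OF norm_iexp_minus_le] mult_left_mono power_mono) auto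
      also have "\<dots> = 2 * (\<bar>t\<bar> * K) ^ 3 * (real n / sqrt (real n) ^ 3)"
        by (simp add: power_divide)
      also have "real n / sqrt (real n) ^ 3 = 1 / sqrt (real n)"
        using False by (simp add: power3_eq_cube field_simps)
      finally have "cmod (iexp (t * (orbit_sum \<theta> D n x / sqrt (real n))) - P n x * exp (- (t\<^sup>2 * V n) / 2))
        \<le> 2 * (\<bar>t\<bar> * K) ^ 3 * (1 / sqrt (real n))" .
      moreover have "cmod (P n x * (exp (- (t\<^sup>2 * V n) / 2) - c)) \<le> exp ((t * K)\<^sup>2 / 2) * \<bar>exp (- (t\<^sup>2 * V n) / 2) - c\<bar>"
        unfolding norm_mult using P_le[of n x] by (intro mult_mono) (auto simp flip: of_real_diff)
      moreover have "W n x = (iexp (t * (orbit_sum \<theta> D n x / sqrt (real n))) - P n x * exp (- (t\<^sup>2 * V n) / 2))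
          + P n x * (exp (- (t\<^sup>2 * V n) / 2) - c)"
        by (simp add: W_def algebra_simps)
      ultimately show ?thesis
        using norm_triangle_ineq[of "iexp (t * (orbit_sum \<theta> D n x / sqrt (real n))) - P n x * exp (- (t\<^sup>2 * V n) / 2)"
            "P n x * (exp (- (t\<^sup>2 * V n) / 2) - c)"] by (simp only:)
    qed
    have "(\<lambda>n. 2 * (\<bar>t\<bar> * K) ^ 3 * (1 / sqrt (real n)) + exp ((t * K)\<^sup>2 / 2) * \<bar>exp (- (t\<^sup>2 * V n) / 2) - c\<bar>)
      \<longlonglongrightarrow> 2 * (\<bar>t\<bar> * K) ^ 3 * 0 + exp ((t * K)\<^sup>2 / 2) * \<bar>exp (- (t\<^sup>2 * v) / 2) - c\<bar>"
      by (intro tendsto_intros V) (auto intro!: real_tendsto_divide_at_top filterlim_compose[OF sqrt_at_top filterlim_real_sequentially])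
    then have "(\<lambda>n. 2 * (\<bar>t\<bar> * K) ^ 3 * (1 / sqrt (real n)) + exp ((t * K)\<^sup>2 / 2) * \<bar>exp (- (t\<^sup>2 * V n) / 2) - c\<bar>) \<longlonglongrightarrow> 0"
      by (simp add: c_def v_def)
    then show ?case by (rule Lim_null_comparison[rotated]) (use bound in auto)
  qed
  have Re_lim: "AE x in M. (\<lambda>n. ce (\<lambda>x. Re (W n x)) x) \<longlonglongrightarrow> 0"
  proof (rule ce_bounded_convergence[where C = C])
    show "\<bar>Re (W n x)\<bar> \<le> C" for n x using order_trans[OF abs_Re_le_cmod W_le] .
    show "AE x in M. (\<lambda>n. Re (W n x)) \<longlonglongrightarrow> 0"
      using W_lim by eventually_elim (drule tendsto_Re, simp)
  qed measurable
  have Im_lim: "AE x in M. (\<lambda>n. ce (\<lambda>x. Im (W n x)) x) \<longlonglongrightarrow> 0"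
  proof (rule ce_bounded_convergence[where C = C])
    show "\<bar>Im (W n x)\<bar> \<le> C" for n x using order_trans[OF abs_Im_le_cmod W_le] .
    show "AE x in M. (\<lambda>n. Im (W n x)) \<longlonglongrightarrow> 0"
      using W_lim by eventually_elim (drule tendsto_Im, simp)
  qed measurable
  have int_W: "integrable M (\<lambda>x. Re (W n x))" "integrable M (\<lambda>x. Im (W n x))" for n
    using order_trans[OF abs_Re_le_cmod W_le] order_trans[OF abs_Im_le_cmod W_le]
    by (auto intro!: integrable_const_bound[of _ C])
  have int_P: "integrable M (\<lambda>x. Re (P n x))" "integrable M (\<lambda>x. Im (P n x))" for n
    using order_trans[OF abs_Re_le_cmod P_le] order_trans[OF abs_Im_le_cmod P_le]
    by (auto intro!: integrable_const_bound[of _ "exp ((t * K)\<^sup>2 / 2)"])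
  note int = int_W int_P
  have cos_eq: "cos (t * (orbit_sum \<theta> D n x / sqrt (real n))) = Re (W n x) + c * Re (P n x)"
    and sin_eq: "sin (t * (orbit_sum \<theta> D n x / sqrt (real n))) = Im (W n x) + c * Im (P n x)" for n x
    by (simp_all add: W_def Re_exp Im_exp)
  have cos_ce: "AE x in M. \<forall>n. ce (\<lambda>x. cos (t * (orbit_sum \<theta> D n x / sqrt (real n)))) x = ce (\<lambda>x. Re (W n x)) x + c"
    unfolding AE_all_countable
  proof
    fix n
    have "AE x in M. ce (\<lambda>x. Re (W n x) + c * Re (P n x)) x = ce (\<lambda>x. Re (W n x)) x + ce (\<lambda>x. c * Re (P n x)) x"
      using int by (intro real_cond_exp_add) auto
    moreover have "AE x in M. ce (\<lambda>x. c * Re (P n x)) x = c * ce (\<lambda>x. Re (P n x)) x"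
      using int by (intro real_cond_exp_cmult)
    ultimately show "AE x in M. ce (\<lambda>x. cos (t * (orbit_sum \<theta> D n x / sqrt (real n)))) x = ce (\<lambda>x. Re (W n x)) x + c"
      unfolding cos_eq using expo(1)[of n] by eventually_elim simp
  qed
  have sin_ce: "AE x in M. \<forall>n. ce (\<lambda>x. sin (t * (orbit_sum \<theta> D n x / sqrt (real n)))) x = ce (\<lambda>x. Im (W n x)) x"
    unfolding AE_all_countable
  proof
    fix n
    have "AE x in M. ce (\<lambda>x. Im (W n x) + c * Im (P n x)) x = ce (\<lambda>x. Im (W n x)) x + ce (\<lambda>x. c * Im (P n x)) x"
      using int by (intro real_cond_exp_add) auto
    moreover have "AE x in M. ce (\<lambda>x. c * Im (P n x)) x = c * ce (\<lambda>x. Im (P n x)) x"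
      using int by (intro real_cond_exp_cmult)
    ultimately show "AE x in M. ce (\<lambda>x. sin (t * (orbit_sum \<theta> D n x / sqrt (real n)))) x = ce (\<lambda>x. Im (W n x)) x"
      unfolding sin_eq using expo(2)[of n] by eventually_elim simp
  qed
  show "AE x in M. (\<lambda>n. ce (\<lambda>x. cos (t * (orbit_sum \<theta> D n x / sqrt (real n)))) x) \<longlonglongrightarrow> c"
    using cos_ce Re_lim
  proof eventually_elim
    case (elim x)
    from tendsto_add[OF elim(2) tendsto_const, of c] show ?case using elim(1) by simp
  qed
  show "AE x in M. (\<lambda>n. ce (\<lambda>x. sin (t * (orbit_sum \<theta> D n x / sqrt (real n)))) x) \<longlonglongrightarrow> 0"
    using sin_ce Im_lim by eventually_elim simp
qed

text \<open>Garsia's argument with T g = \<open>ce\<close> (g o \<open>\<theta>\<close>): by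
  \<open>ce_tower\<close>, T maps \<open>\<phi> i\<close> to \<open>\<phi> (Suc i)\<close>, so the
  sums satisfy the required recursion. For f = D^2 this controls the conditional variance of the
  martingale at all times simultaneously.\<close>

lemma hopf_maximal_weak_type:
  assumes f: "integrable M f" "\<And>x. 0 \<le> f x" and c: "0 < c"
  shows "prob {x \<in> space M. \<exists>k. real k * c < (\<Sum>i<k. ce (\<lambda>x. f ((\<theta> ^^ i) x)) x)} \<le> (\<integral>x. f x \<partial>M) / c"
proof -
  define \<phi> where "\<phi> i = ce (\<lambda>x. f ((\<theta> ^^ i) x))" for i
  have int_\<phi>: "integrable M (\<phi> i)" for i
    unfolding \<phi>_def by (rule real_cond_exp_int[OF integrable_iter[OF f(1)]])
  have [measurable]: "f \<in> borel_measurable M" "\<phi> i \<in> borel_measurable M" for i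
    using f int_\<phi> by auto
  define s where "s k x = (\<Sum>i<k. \<phi> i x) - real k * c" for k x
  have \<phi>_shift: "AE x in M. ce (\<lambda>x. \<phi> i (\<theta> x)) x = \<phi> (Suc i) x" for i
    using ce_tower[OF integrable_iter[OF f(1), of i], of 1]
    by (simp add: \<phi>_def funpow_swap1)
  have int_\<phi>': "integrable M (\<lambda>x. \<phi> i (\<theta> x))" for i
    using integrable_iter[OF int_\<phi>[of i], of 1] by simp
  define A where "A N = {x \<in> space M. \<exists>k\<le>N. 0 < s k x}" for N :: nat
  have [measurable]: "s k \<in> borel_measurable M" for k unfolding s_def by measurable
  have [measurable]: "A N \<in> sets M" for N unfolding A_def by measurable
  have max: "0 \<le> (\<integral>x. indicator (A N) x * (\<phi> 0 x - c) \<partial>M)" for N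
    unfolding A_def
  proof (rule garsia_maximal[where T = "\<lambda>g. ce (\<lambda>x. g (\<theta> x))"])
    show "integrable M (s k)" for k unfolding s_def using int_\<phi> by simp
    show "AE x in M. s (Suc k) x \<le> \<phi> 0 x - c + ce (\<lambda>x. s k (\<theta> x)) x" for k
    proof -
      have "AE x in M. ce (\<lambda>x. (\<Sum>i<k. \<phi> i (\<theta> x)) - real k * c) x = ce (\<lambda>x. \<Sum>i<k. \<phi> i (\<theta> x)) x - ce (\<lambda>_. real k * c) x"
        using int_\<phi>' by (intro real_cond_exp_diff) auto
      moreover have "AE x in M. ce (\<lambda>x. \<Sum>i<k. \<phi> i (\<theta> x)) x = (\<Sum>i<k. ce (\<lambda>x. \<phi> i (\<theta> x)) x)"
        using int_\<phi>' by (rule real_cond_exp_sum)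
      moreover have "AE x in M. ce (\<lambda>_. real k * c) x = real k * c" by (rule real_cond_exp_F_meas) auto
      moreover have "AE x in M. \<forall>i. ce (\<lambda>x. \<phi> i (\<theta> x)) x = \<phi> (Suc i) x"
        using \<phi>_shift by (simp add: AE_all_countable)
      ultimately show ?thesis
      proof eventually_elim
        case (elim x)
        have "s (Suc k) x = \<phi> 0 x + (\<Sum>i<k. \<phi> (Suc i) x) - real (Suc k) * c"
          unfolding s_def sum.lessThan_Suc_shift by simp
        then show ?case using elim by (simp add: s_def algebra_simps)
      qed
    qed
    show "AE x in M. ce (\<lambda>x. g (\<theta> x)) x \<le> ce (\<lambda>x. h (\<theta> x)) x"
      if "integrable M g" "integrable M h" "\<And>x. g x \<le> h x" for g h :: "'a \<Rightarrow> real"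
      using integrable_iter[OF that(1), of 1] integrable_iter[OF that(2), of 1] that(3)
      by (intro real_cond_exp_mono) auto
    show "AE x in M. 0 \<le> ce (\<lambda>x. g (\<theta> x)) x" if "integrable M g" "\<And>x. 0 \<le> g x" for g :: "'a \<Rightarrow> real"
      using integrable_iter[OF that(1), of 1] that(2) by (intro real_cond_exp_pos) auto
    show "integrable M (ce (\<lambda>x. g (\<theta> x)))" if "integrable M g" for g :: "'a \<Rightarrow> real"
      using integrable_iter[OF that, of 1] by (intro real_cond_exp_int) simp
    show "(\<integral>x. ce (\<lambda>x. g (\<theta> x)) x \<partial>M) = (\<integral>x. g x \<partial>M)" if "integrable M g" for g :: "'a \<Rightarrow> real"
      using real_cond_exp_int(2)[OF integrable_iter[OF that, of 1]] integral_iter[of g 1] that by auto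
  qed (use int_\<phi> in \<open>auto simp: s_def\<close>)
  have A_le: "prob (A N) \<le> (\<integral>x. f x \<partial>M) / c" for N
  proof -
    have int: "integrable M (\<lambda>x. indicator (A N) x * \<phi> 0 x)"
      using integrable_mult_indicator[OF \<open>A N \<in> sets M\<close> int_\<phi>[of 0]] by simp
    have ind: "integrable M (indicat_real (A N))"
      by (intro integrable_real_indicator) (auto simp: less_top[symmetric])
    have "AE x in M. 0 \<le> \<phi> 0 x" unfolding \<phi>_def using f by (intro real_cond_exp_pos) auto
    then have "AE x in M. indicator (A N) x * \<phi> 0 x \<le> \<phi> 0 x" by eventually_elim (auto simp: indicator_def)
    then have "(\<integral>x. indicator (A N) x * \<phi> 0 x \<partial>M) \<le> (\<integral>x. \<phi> 0 x \<partial>M)"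
      using int int_\<phi> by (intro integral_mono_AE)
    also have "\<dots> = (\<integral>x. f x \<partial>M)" unfolding \<phi>_def using real_cond_exp_int(2)[OF f(1)] by simp
    finally have "(\<integral>x. indicator (A N) x * \<phi> 0 x \<partial>M) \<le> (\<integral>x. f x \<partial>M)" .
    moreover have "(\<integral>x. indicator (A N) x * (\<phi> 0 x - c) \<partial>M) = (\<integral>x. indicator (A N) x * \<phi> 0 x \<partial>M) - c * prob (A N)"
      using int ind by (simp add: right_diff_distrib mult.commute[of _ c])
    ultimately show ?thesis using c max[of N] by (simp add: field_simps)
  qed
  have "(\<lambda>N. prob (A N)) \<longlonglongrightarrow> prob (\<Union>N. A N)"
    by (rule finite_Lim_measure_incseq) (auto simp: incseq_def A_def intro: order_trans)
  then have "prob (\<Union>N. A N) \<le> (\<integral>x. f x \<partial>M) / c"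
    by (rule LIMSEQ_le_const2) (use A_le in auto)
  also have "(\<Union>N. A N) = {x \<in> space M. \<exists>k. real k * c < (\<Sum>i<k. ce (\<lambda>x. f ((\<theta> ^^ i) x)) x)}"
    by (auto simp: A_def s_def \<phi>_def)
  finally show ?thesis .
qed

text \<open>Truncation destroys the conditional centring, so the conditional mean is subtracted
  again. As \<open>D\<close> itself is centred, the total error is (D - Y) minus its conditional
  expectation, of norm at most twice that of D - Y.\<close>

lemma martingale_difference_truncate:
  assumes D: "martingale_difference D" and \<eta>: "0 < \<eta>"
  obtains D' K where "martingale_difference D'" "\<And>x. \<bar>D' x\<bar> \<le> K" "l2_norm M (\<lambda>x. D x - D' x) \<le> \<eta>"
proof -
  note D' = martingale_differenceD[OF D]
  have [measurable]: "D \<in> borel_measurable M" by (rule D')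
  define Y where "Y K x = (if \<bar>D x\<bar> \<le> real K then D x else 0)" for K x
  have Y_Fn: "Y K \<in> borel_measurable (Fn 1)" for K
    unfolding Y_def using D'(1) by measurable
  have [measurable]: "Y K \<in> borel_measurable M" for K unfolding Y_def by measurable
  have Y_le: "\<bar>Y K x\<bar> \<le> real K" for K x by (simp add: Y_def)
  have int_Y: "integrable M (Y K)" for K
    by (rule integrable_const_bound[of _ "real K"]) (use Y_le in auto)
  have DY_sq: "square_integrable M (\<lambda>x. D x - Y K x)" for K
    by (rule square_integrable_bound[OF D'(3)]) (auto simp: Y_def)
  have "(\<lambda>K. \<integral>x. (D x - Y K x)\<^sup>2 \<partial>M) \<longlonglongrightarrow> (\<integral>x. 0 \<partial>M)"
  proof (rule integral_dominated_convergence[where w = "\<lambda>x. (D x)\<^sup>2"])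
    show "AE x in M. (\<lambda>K. (D x - Y K x)\<^sup>2) \<longlonglongrightarrow> 0"
    proof (rule AE_I2)
      fix x
      obtain k :: nat where "\<bar>D x\<bar> < real k" using reals_Archimedean2 by blast
      then have "eventually (\<lambda>K. (D x - Y K x)\<^sup>2 = 0) sequentially"
        by (intro eventually_sequentiallyI[of k]) (auto simp: Y_def)
      then show "(\<lambda>K. (D x - Y K x)\<^sup>2) \<longlonglongrightarrow> 0" by (rule tendsto_eventually)
    qed
    show "AE x in M. norm ((D x - Y K x)\<^sup>2) \<le> (D x)\<^sup>2" for K by (auto simp: Y_def)
  qed (use D' in auto)
  then have "(\<lambda>K. sqrt (\<integral>x. (D x - Y K x)\<^sup>2 \<partial>M)) \<longlonglongrightarrow> sqrt 0"
    by (intro tendsto_real_sqrt) simp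
  then have "eventually (\<lambda>K. sqrt (\<integral>x. (D x - Y K x)\<^sup>2 \<partial>M) < \<eta> / 2) sequentially"
    using \<eta> by (intro order_tendstoD) auto
  then obtain K where "sqrt (\<integral>x. (D x - Y K x)\<^sup>2 \<partial>M) < \<eta> / 2"
    using eventually_happens'[OF sequentially_bot] by blast
  then have K: "l2_norm M (\<lambda>x. D x - Y K x) < \<eta> / 2" by (simp add: l2_norm_def)
  \<comment> \<open>The conditional expectation is bounded by \<open>K\<close> almost everywhere
    only. Clamping yields a version bounded at every point and still measurable for
    \<open>F\<close>.\<close>
  define E where "E x = max (- real K) (min (real K) (ce (Y K) x))" for x
  have E_F [measurable]: "E \<in> borel_measurable F" unfolding E_def by measurable
  have [measurable]: "E \<in> borel_measurable M" by (rule F_measurable[OF E_F])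
  have E_le: "\<bar>E x\<bar> \<le> real K" for x by (auto simp: E_def)
  have int_E: "integrable M E"
    by (rule integrable_const_bound[of _ "real K"]) (use E_le in auto)
  have E_eq: "AE x in M. E x = ce (Y K) x"
  proof -
    have "AE x in M. ce (Y K) x \<le> real K" using Y_le[of K] by (intro real_cond_exp_le_c int_Y) (auto simp: abs_le_iff)
    moreover have "AE x in M. - real K \<le> ce (Y K) x"
    proof (intro real_cond_exp_ge_c int_Y AE_I2)
      show "- real K \<le> Y K x" for x using Y_le[of K x] by linarith
    qed
    ultimately show ?thesis by eventually_elim (simp add: E_def)
  qed
  define D1 where "D1 x = Y K x - E x" for x
  have D1_le: "\<bar>D1 x\<bar> \<le> 2 * real K" for x
    using Y_le[of K x] E_le[of x] by (simp add: D1_def)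
  have [measurable]: "D1 \<in> borel_measurable M" unfolding D1_def by measurable
  have "AE x in M. ce D1 x = ce (Y K) x - ce E x"
    unfolding D1_def by (rule real_cond_exp_diff[OF int_Y int_E])
  moreover have "AE x in M. ce E x = E x" by (rule real_cond_exp_F_meas[OF int_E E_F])
  ultimately have "AE x in M. ce D1 x = 0" using E_eq by eventually_elim simp
  moreover have "square_integrable M (\<lambda>_. 2 * real K)" by (simp add: square_integrable_def)
  then have "square_integrable M D1" by (rule square_integrable_bound) (use D1_le in auto)
  moreover have "D1 \<in> borel_measurable (Fn 1)"
    unfolding D1_def using Y_Fn[of K] F_measurable_Fn[OF E_F, of 1] by measurable
  ultimately have md: "martingale_difference D1" by (simp add: martingale_difference_def)
  have "AE x in M. D x - D1 x = (D x - Y K x) - ce (\<lambda>x. D x - Y K x) x"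
    using real_cond_exp_diff[OF D'(4) int_Y[of K]] D'(5) E_eq by eventually_elim (simp add: D1_def)
  then have "l2_norm M (\<lambda>x. D x - D1 x) = l2_norm M (\<lambda>x. (D x - Y K x) - ce (\<lambda>x. D x - Y K x) x)"
    by (rule l2_norm_cong_AE) auto
  also have "\<dots> \<le> l2_norm M (\<lambda>x. D x - Y K x) + l2_norm M (ce (\<lambda>x. D x - Y K x))"
    by (rule l2_norm_diff[OF DY_sq square_integrable_ce[OF DY_sq]])
  also have "\<dots> \<le> \<eta>" using K l2_norm_ce[OF DY_sq[of K]] by simp
  finally show thesis by (rule that[OF md D1_le])
qed

text \<open>The inequality |a - b| <= \<open>\<epsilon>\<close> / 2 + (a - b)^2 / (2
  \<open>\<epsilon>\<close>) replaces a conditional Cauchy-Schwarz inequality: for deterministic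
  \<open>\<epsilon>\<close> the bound is linear in the conditional second moment, and
  \<open>\<epsilon>\<close> can be matched to its size afterwards.\<close>

lemma ce_lipschitz_diff:
  fixes \<phi> :: "real \<Rightarrow> real"
  assumes [measurable]: "\<phi> \<in> borel_measurable borel" and bd: "\<And>a. \<bar>\<phi> a\<bar> \<le> 1" and lip: "\<And>a b. \<bar>\<phi> a - \<phi> b\<bar> \<le> \<bar>a - b\<bar>"
    and U: "square_integrable M U" and V: "square_integrable M V" and \<epsilon>: "0 < \<epsilon>"
  shows "AE x in M. \<bar>ce (\<lambda>x. \<phi> (U x)) x - ce (\<lambda>x. \<phi> (V x)) x\<bar> \<le> \<epsilon> / 2 + ce (\<lambda>x. (U x - V x)\<^sup>2) x / (2 * \<epsilon>)"
proof -
  have [measurable]: "U \<in> borel_measurable M" "V \<in> borel_measurable M" using U V by auto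
  have int: "integrable M (\<lambda>x. \<phi> (U x))" "integrable M (\<lambda>x. \<phi> (V x))"
    using bd by (auto intro!: integrable_const_bound[of _ 1])
  have int2: "integrable M (\<lambda>x. (U x - V x)\<^sup>2)" using square_integrable_diff[OF U V] by auto
  have pt: "\<bar>\<phi> a - \<phi> b\<bar> \<le> \<epsilon> / 2 + (a - b)\<^sup>2 / (2 * \<epsilon>)" for a b
  proof -
    have "0 \<le> (\<epsilon> - \<bar>a - b\<bar>)\<^sup>2 / (2 * \<epsilon>)" using \<epsilon> by simp
    also have "\<dots> = \<epsilon> / 2 + (a - b)\<^sup>2 / (2 * \<epsilon>) - \<bar>a - b\<bar>"
      using \<epsilon> by (simp add: power2_diff field_simps power2_eq_square)
    finally show ?thesis using lip[of a b] by linarith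
  qed
  have "AE x in M. ce (\<lambda>x. \<phi> (U x) - \<phi> (V x)) x = ce (\<lambda>x. \<phi> (U x)) x - ce (\<lambda>x. \<phi> (V x)) x"
    by (rule real_cond_exp_diff[OF int])
  moreover have "AE x in M. \<bar>ce (\<lambda>x. \<phi> (U x) - \<phi> (V x)) x\<bar> \<le> ce (\<lambda>x. \<bar>\<phi> (U x) - \<phi> (V x)\<bar>) x"
    using int by (intro ce_abs) auto
  moreover have "AE x in M. ce (\<lambda>x. \<bar>\<phi> (U x) - \<phi> (V x)\<bar>) x \<le> ce (\<lambda>x. \<epsilon> / 2 + (U x - V x)\<^sup>2 / (2 * \<epsilon>)) x"
    using int int2 pt by (intro real_cond_exp_mono) auto
  moreover have "AE x in M. ce (\<lambda>x. \<epsilon> / 2 + (U x - V x)\<^sup>2 / (2 * \<epsilon>)) x = ce (\<lambda>_. \<epsilon> / 2) x + ce (\<lambda>x. (U x - V x)\<^sup>2 / (2 * \<epsilon>)) x"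
    using int2 by (intro real_cond_exp_add) auto
  moreover have "AE x in M. ce (\<lambda>_. \<epsilon> / 2) x = \<epsilon> / 2" by (rule real_cond_exp_F_meas) auto
  moreover have "AE x in M. ce (\<lambda>x. (U x - V x)\<^sup>2 / (2 * \<epsilon>)) x = ce (\<lambda>x. (U x - V x)\<^sup>2) x / (2 * \<epsilon>)"
    by (rule real_cond_exp_cdiv[OF int2])
  ultimately show ?thesis by eventually_elim simp
qed

text \<open>Abstracting from cosine and sine treats both at once; \<open>L\<close> gives the limit
  as a function of the variance. The truncation level may depend on the point, but at that level the
  error must be small for all \<open>n\<close>.\<close>

lemma conditional_clt_from_bounded:
  fixes \<phi> L :: "real \<Rightarrow> real"
  assumes D: "martingale_difference D"
    and \<phi>: "\<phi> \<in> borel_measurable borel" "\<And>a. \<bar>\<phi> a\<bar> \<le> 1" "\<And>a b. \<bar>\<phi> a - \<phi> b\<bar> \<le> \<bar>a - b\<bar>"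
    and L: "\<And>v. isCont L v"
    and bounded: "\<And>D' K. martingale_difference D' \<Longrightarrow> (\<And>x. \<bar>D' x\<bar> \<le> K) \<Longrightarrow>
      AE x in M. (\<lambda>n. ce (\<lambda>x. \<phi> (t * (orbit_sum \<theta> D' n x / sqrt (real n)))) x) \<longlonglongrightarrow> L (\<integral>x. (D' x)\<^sup>2 \<partial>M)"
  shows "AE x in M. (\<lambda>n. ce (\<lambda>x. \<phi> (t * (orbit_sum \<theta> D n x / sqrt (real n)))) x) \<longlonglongrightarrow> L (\<integral>x. (D x)\<^sup>2 \<partial>M)"
proof -
  note D' = martingale_differenceD[OF D]
  have "\<exists>D' C. martingale_difference D' \<and> (\<forall>x. \<bar>D' x\<bar> \<le> C) \<and> l2_norm M (\<lambda>x. D x - D' x) \<le> 1 / real (Suc K)" for K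
    using martingale_difference_truncate[OF D, of "1 / real (Suc K)"] by (metis of_nat_0_less_iff zero_less_Suc zero_less_divide_1_iff)
  then obtain Ds C where Ds: "\<And>K. martingale_difference (Ds K)" "\<And>K x. \<bar>Ds K x\<bar> \<le> C K"
    and close: "\<And>K. l2_norm M (\<lambda>x. D x - Ds K x) \<le> 1 / real (Suc K)"
    by metis
  have Ds_sq: "square_integrable M (Ds K)" for K using martingale_differenceD(3)[OF Ds(1)] .
  have DDs: "martingale_difference (\<lambda>x. D x - Ds K x)" for K by (rule martingale_difference_diff[OF D Ds(1)])
  have DDs_sq: "square_integrable M (\<lambda>x. D x - Ds K x)" for K by (rule martingale_differenceD(3)[OF DDs])
  have inv: "(\<lambda>K. 1 / real (Suc K)) \<longlonglongrightarrow> 0"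
    using LIMSEQ_inverse_real_of_nat by (simp add: inverse_eq_divide)
  have "(\<lambda>K. l2_norm M (Ds K)) \<longlonglongrightarrow> l2_norm M D"
  proof (rule Lim_transform[OF tendsto_const], rule Lim_null_comparison[OF _ inv], rule always_eventually, rule allI)
    fix K
    have "l2_norm M (\<lambda>x. D x - (D x - Ds K x)) \<le> l2_norm M D + l2_norm M (\<lambda>x. D x - Ds K x)"
      by (rule l2_norm_diff[OF D'(3) DDs_sq])
    moreover have "l2_norm M (\<lambda>x. (D x - Ds K x) + Ds K x) \<le> l2_norm M (\<lambda>x. D x - Ds K x) + l2_norm M (Ds K)"
      by (rule l2_norm_add[OF DDs_sq Ds_sq])
    ultimately show "norm (l2_norm M (Ds K) - l2_norm M D) \<le> 1 / real (Suc K)" using close[of K] by simp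
  qed
  then have "(\<lambda>K. (l2_norm M (Ds K))\<^sup>2) \<longlonglongrightarrow> (l2_norm M D)\<^sup>2" by (rule tendsto_power)
  then have L_lim: "(\<lambda>K. L (\<integral>x. (Ds K x)\<^sup>2 \<partial>M)) \<longlonglongrightarrow> L (\<integral>x. (D x)\<^sup>2 \<partial>M)"
    unfolding l2_norm_power2 using L isCont_tendsto_compose by blast
  define G where "G K n x = (\<Sum>i<n. ce (\<lambda>x. (D ((\<theta> ^^ i) x) - Ds K ((\<theta> ^^ i) x))\<^sup>2) x)" for K n x
  have [measurable]: "G K n \<in> borel_measurable M" for K n unfolding G_def by measurable
  \<comment> \<open>At precision \<open>m\<close> the exceptional set, taken over all
    \<open>n\<close> at once, has probability at most (m + 1) / (K + 1). The lower bound
    \<open>k0\<close> leaves room to bring the variance of \<open>Ds K\<close> close to that of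
    \<open>D\<close> as well.\<close>
  have "AE x in M. \<exists>K\<ge>k0. \<forall>n. \<not> real n * (1 / real (Suc m)) < G K n x" for m k0
  proof (rule AE_exists_small)
    have "prob {x \<in> space M. \<not> (\<forall>n. \<not> real n * (1 / real (Suc m)) < G K n x)} \<le> real (Suc m) * (1 / real (Suc K))" for K
    proof -
      have "prob {x \<in> space M. \<not> (\<forall>n. \<not> real n * (1 / real (Suc m)) < G K n x)} \<le> (\<integral>x. (D x - Ds K x)\<^sup>2 \<partial>M) / (1 / real (Suc m))"
        using hopf_maximal_weak_type[of "\<lambda>x. (D x - Ds K x)\<^sup>2" "1 / real (Suc m)"] DDs_sq[of K] by (auto simp: G_def)
      also have "\<dots> = real (Suc m) * (l2_norm M (\<lambda>x. D x - Ds K x))\<^sup>2" by (simp add: l2_norm_power2)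
      also have "\<dots> \<le> real (Suc m) * (1 / real (Suc K))"
      proof (intro mult_left_mono)
        have "(l2_norm M (\<lambda>x. D x - Ds K x))\<^sup>2 \<le> (1 / real (Suc K))\<^sup>2" using close by (intro power_mono) auto
        also have "\<dots> \<le> 1 / real (Suc K)"
          unfolding power2_eq_square by (rule mult_left_le_one_le) auto
        finally show "(l2_norm M (\<lambda>x. D x - Ds K x))\<^sup>2 \<le> 1 / real (Suc K)" .
      qed simp
      finally show ?thesis .
    qed
    then show "(\<lambda>K. prob {x \<in> space M. \<not> (\<forall>n. \<not> real n * (1 / real (Suc m)) < G K n x)}) \<longlonglongrightarrow> 0"
      by (intro tendsto_sandwich[OF _ _ tendsto_const tendsto_mult_right_zero[OF inv, of "real (Suc m)"]]) auto
  qed measurable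
  then have good: "AE x in M. \<forall>m k0. \<exists>K\<ge>k0. \<forall>n. G K n x \<le> real n * (1 / real (Suc m))"
    by (simp add: AE_all_countable not_less)
  \<comment> \<open>The choice 1 / sqrt(m + 1) for \<open>\<epsilon>\<close> balances the two terms:
    once \<open>G K n x\<close> is at most n / (m + 1), both are of the order of 1 / sqrt(m +
    1).\<close>
  have diff: "AE x in M. \<forall>K n m. \<bar>ce (\<lambda>x. \<phi> (t * (orbit_sum \<theta> D n x / sqrt (real n)))) x
      - ce (\<lambda>x. \<phi> (t * (orbit_sum \<theta> (Ds K) n x / sqrt (real n)))) x\<bar>
      \<le> (1 / sqrt (real (Suc m))) / 2 + (t\<^sup>2 / real n * G K n x) / (2 * (1 / sqrt (real (Suc m))))"
    unfolding AE_all_countable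
  proof (intro allI)
    fix K n m
    define U where "U x = t * (orbit_sum \<theta> D n x / sqrt (real n))" for x
    define V where "V x = t * (orbit_sum \<theta> (Ds K) n x / sqrt (real n))" for x
    have sq: "square_integrable M U" "square_integrable M V"
      unfolding U_def V_def
      by (intro square_integrable_cmult square_integrable_divide square_integrable_orbit_sum D' Ds_sq)+
    have UV: "(U x - V x)\<^sup>2 = t\<^sup>2 / real n * (orbit_sum \<theta> (\<lambda>x. D x - Ds K x) n x)\<^sup>2" for x
    proof -
      have "U x - V x = t * (orbit_sum \<theta> (\<lambda>x. D x - Ds K x) n x / sqrt (real n))"
        by (simp add: U_def V_def orbit_sum_def sum_subtractf diff_divide_distrib right_diff_distrib)
      then show ?thesis by (simp add: power_mult_distrib power_divide)
    qed
    have "AE x in M. ce (\<lambda>x. t\<^sup>2 / real n * (orbit_sum \<theta> (\<lambda>x. D x - Ds K x) n x)\<^sup>2) x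
      = t\<^sup>2 / real n * ce (\<lambda>x. (orbit_sum \<theta> (\<lambda>x. D x - Ds K x) n x)\<^sup>2) x"
      using square_integrable_orbit_sum[OF DDs_sq[of K], of n] by (intro real_cond_exp_cmult) auto
    moreover have "AE x in M. ce (\<lambda>x. (orbit_sum \<theta> (\<lambda>x. D x - Ds K x) n x)\<^sup>2) x = G K n x"
      unfolding G_def by (rule ce_square_martingale[OF DDs])
    moreover have "AE x in M. \<bar>ce (\<lambda>x. \<phi> (U x)) x - ce (\<lambda>x. \<phi> (V x)) x\<bar>
      \<le> (1 / sqrt (real (Suc m))) / 2 + ce (\<lambda>x. (U x - V x)\<^sup>2) x / (2 * (1 / sqrt (real (Suc m))))"
      by (rule ce_lipschitz_diff[OF \<phi> sq]) simp
    ultimately show "AE x in M. \<bar>ce (\<lambda>x. \<phi> (t * (orbit_sum \<theta> D n x / sqrt (real n)))) x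
      - ce (\<lambda>x. \<phi> (t * (orbit_sum \<theta> (Ds K) n x / sqrt (real n)))) x\<bar>
      \<le> (1 / sqrt (real (Suc m))) / 2 + (t\<^sup>2 / real n * G K n x) / (2 * (1 / sqrt (real (Suc m))))"
      unfolding UV unfolding U_def V_def by eventually_elim simp
  qed
  have "AE x in M. \<forall>K. (\<lambda>n. ce (\<lambda>x. \<phi> (t * (orbit_sum \<theta> (Ds K) n x / sqrt (real n)))) x) \<longlonglongrightarrow> L (\<integral>x. (Ds K x)\<^sup>2 \<partial>M)"
    unfolding AE_all_countable using bounded[OF Ds] by blast
  with good diff show ?thesis
  proof eventually_elim
    case (elim x)
    define u where "u n = ce (\<lambda>x. \<phi> (t * (orbit_sum \<theta> D n x / sqrt (real n)))) x" for n
    define w where "w K n = ce (\<lambda>x. \<phi> (t * (orbit_sum \<theta> (Ds K) n x / sqrt (real n)))) x" for K n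
    have "u \<longlonglongrightarrow> L (\<integral>x. (D x)\<^sup>2 \<partial>M)"
    proof (rule LIMSEQ_I)
      fix r :: real assume r: "0 < r"
      obtain m :: nat where "((1 + t\<^sup>2) / (2 * (r / 3)))\<^sup>2 < real m" using reals_Archimedean2 by blast
      then have "(1 + t\<^sup>2) / (2 * (r / 3)) < sqrt (real (Suc m))" by (intro real_less_rsqrt) simp
      then have m: "(1 + t\<^sup>2) / (2 * sqrt (real (Suc m))) < r / 3"
        using r by (simp add: field_simps)
      from LIMSEQ_D[OF L_lim, of "r / 3"] r
      obtain k0 where k0: "\<And>K. k0 \<le> K \<Longrightarrow> \<bar>L (\<integral>x. (Ds K x)\<^sup>2 \<partial>M) - L (\<integral>x. (D x)\<^sup>2 \<partial>M)\<bar> < r / 3" by auto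
      obtain K where K: "k0 \<le> K" "\<And>n. G K n x \<le> real n * (1 / real (Suc m))" using elim(1) by blast
      have "w K \<longlonglongrightarrow> L (\<integral>x. (Ds K x)\<^sup>2 \<partial>M)" unfolding w_def[abs_def] using elim(3) by blast
      from LIMSEQ_D[OF this, of "r / 3"] r
      obtain n0 where n0: "\<And>n. n0 \<le> n \<Longrightarrow> \<bar>w K n - L (\<integral>x. (Ds K x)\<^sup>2 \<partial>M)\<bar> < r / 3" by auto
      have uw: "\<bar>u n - w K n\<bar> < r / 3" for n
      proof -
        have "t\<^sup>2 / real n * G K n x \<le> t\<^sup>2 / real n * (real n * (1 / real (Suc m)))"
          using K(2) by (intro mult_left_mono) auto
        also have "\<dots> \<le> t\<^sup>2 / real (Suc m)" by (cases "n = 0") auto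
        finally have "(t\<^sup>2 / real n * G K n x) / (2 * (1 / sqrt (real (Suc m)))) \<le> (t\<^sup>2 / real (Suc m)) / (2 * (1 / sqrt (real (Suc m))))"
          by (intro divide_right_mono) auto
        then have "\<bar>u n - w K n\<bar> \<le> (1 / sqrt (real (Suc m))) / 2 + (t\<^sup>2 / real (Suc m)) / (2 * (1 / sqrt (real (Suc m))))"
          using elim(2)[rule_format, of n K m] unfolding u_def w_def by linarith
        also have "(t\<^sup>2 / real (Suc m)) / (2 * (1 / sqrt (real (Suc m)))) = t\<^sup>2 / (2 * sqrt (real (Suc m)))"
        proof -
          have "T / (y * y) / (2 * (1 / y)) = T / (2 * y)" if "0 < y" for T y :: real
            using that by (simp add: field_simps)
          from this[of "sqrt (real (Suc m))" "t\<^sup>2"] show ?thesis by (simp del: of_nat_Suc)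
        qed
        also have "(1 / sqrt (real (Suc m))) / 2 + t\<^sup>2 / (2 * sqrt (real (Suc m))) = (1 + t\<^sup>2) / (2 * sqrt (real (Suc m)))"
          by (simp add: add_divide_distrib)
        finally show ?thesis using m by linarith
      qed
      have "\<bar>u n - L (\<integral>x. (D x)\<^sup>2 \<partial>M)\<bar> < r" if "n0 \<le> n" for n
        using uw[of n] n0[OF that] k0[OF K(1)] by linarith
      then show "\<exists>no. \<forall>n\<ge>no. norm (u n - L (\<integral>x. (D x)\<^sup>2 \<partial>M)) < r" by auto
    qed
    then show ?case by (simp add: u_def[abs_def])
  qed
qed

theorem conditional_clt_martingale:
  fixes t :: real
  assumes D: "martingale_difference D"
  shows "AE x in M. (\<lambda>n. ce (\<lambda>x. cos (t * (orbit_sum \<theta> D n x / sqrt (real n)))) x) \<longlonglongrightarrow> exp (- (t\<^sup>2 * (\<integral>x. (D x)\<^sup>2 \<partial>M)) / 2)"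
    and "AE x in M. (\<lambda>n. ce (\<lambda>x. sin (t * (orbit_sum \<theta> D n x / sqrt (real n)))) x) \<longlonglongrightarrow> 0"
proof -
  show "AE x in M. (\<lambda>n. ce (\<lambda>x. cos (t * (orbit_sum \<theta> D n x / sqrt (real n)))) x) \<longlonglongrightarrow> exp (- (t\<^sup>2 * (\<integral>x. (D x)\<^sup>2 \<partial>M)) / 2)"
  proof (rule conditional_clt_from_bounded[where L = "\<lambda>v. exp (- (t\<^sup>2 * v) / 2)", OF D])
    show "\<bar>cos a - cos b\<bar> \<le> \<bar>a - b\<bar>" for a b :: real
      by (rule abs_cos_diff_le)
    show "isCont (\<lambda>v. exp (- (t\<^sup>2 * v) / 2)) v" for v by (intro continuous_intros) auto
    show "AE x in M. (\<lambda>n. ce (\<lambda>x. cos (t * (orbit_sum \<theta> D' n x / sqrt (real n)))) x)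
      \<longlonglongrightarrow> exp (- (t\<^sup>2 * (\<integral>x. (D' x)\<^sup>2 \<partial>M)) / 2)"
      if "martingale_difference D'" "\<And>x. \<bar>D' x\<bar> \<le> K" for D' K
      using that by (rule conditional_clt_bounded(1))
  qed auto
  show "AE x in M. (\<lambda>n. ce (\<lambda>x. sin (t * (orbit_sum \<theta> D n x / sqrt (real n)))) x) \<longlonglongrightarrow> 0"
  proof (rule conditional_clt_from_bounded[where L = "\<lambda>_. 0", OF D])
    show "\<bar>sin a - sin b\<bar> \<le> \<bar>a - b\<bar>" for a b :: real
      by (rule abs_sin_diff_le)
    show "AE x in M. (\<lambda>n. ce (\<lambda>x. sin (t * (orbit_sum \<theta> D' n x / sqrt (real n)))) x) \<longlonglongrightarrow> 0"
      if "martingale_difference D'" "\<And>x. \<bar>D' x\<bar> \<le> K" for D' K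
      using that by (rule conditional_clt_bounded(2))
  qed auto
qed

end

section \<open>From the martingale to the partial sums\<close>

context adapted_system
begin

text \<open>The null sets for cosine and sine depend on \<open>t\<close>; the last conclusion is the
  tightness that lets countably many \<open>t\<close> suffice. Its \<open>L\<close> depends on the
  point but not on \<open>n\<close>.\<close>

theorem conditional_clt:
  assumes sum_a: "summable (\<lambda>n. real (Suc n) powr (-3/2) * ln (real (Suc n)) * a (Suc n))"
  obtains v where "0 \<le> v" "(\<lambda>n. (\<integral>x. (S n x)\<^sup>2 \<partial>M) / real n) \<longlonglongrightarrow> v"
    and "\<And>t. AE x in M. (\<lambda>n. ce (\<lambda>x. cos (t * (S n x / sqrt (real n)))) x) \<longlonglongrightarrow> exp (- (t\<^sup>2 * v) / 2)"
    and "\<And>t. AE x in M. (\<lambda>n. ce (\<lambda>x. sin (t * (S n x / sqrt (real n)))) x) \<longlonglongrightarrow> 0"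
    and "AE x in M. \<forall>m::nat. \<exists>L::nat. \<forall>n.
           ce (indicator {x \<in> space M. real L < \<bar>S n x / sqrt (real n)\<bar>}) x \<le> 1 / real (Suc m)"
proof -
  obtain D where D: "martingale_difference D"
    and sum_R: "summable (\<lambda>j. l2_norm M (orbit_sum \<theta> (\<lambda>x. X (\<theta> x) - D x) (2 ^ j)) / sqrt (2 ^ j))"
    and R_norm: "(\<lambda>n. l2_norm M (orbit_sum \<theta> (\<lambda>x. X (\<theta> x) - D x) n) / sqrt (real n)) \<longlonglongrightarrow> 0"
    using martingale_approximation[OF sum_a] by blast
  note D' = martingale_differenceD[OF D]
  define U where "U = orbit_sum \<theta> D"
  define R where "R = orbit_sum \<theta> (\<lambda>x. X (\<theta> x) - D x)"
  have S_eq: "S n x = U n x + R n x" for n x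
    by (simp add: S_def U_def R_def orbit_sum_def sum_subtractf)
  have rho_sq: "square_integrable M (\<lambda>x. X (\<theta> x) - D x)" by (rule square_integrable_diff[OF X_shift_sq D'(3)])
  have R_sq: "square_integrable M (R n)" for n unfolding R_def by (rule square_integrable_orbit_sum[OF rho_sq])
  have U_sq: "square_integrable M (U n)" for n unfolding U_def by (rule square_integrable_orbit_sum[OF D'(3)])
  have [measurable]: "R n \<in> borel_measurable M" "U n \<in> borel_measurable M" "S n \<in> borel_measurable M" for n
    using R_sq U_sq S_sq by auto
  have R_lim: "AE x in M. (\<lambda>n. R n x / sqrt (real n)) \<longlonglongrightarrow> 0"
    unfolding R_def by (rule orbit_sum_over_sqrt_tendsto_0[OF rho_sq sum_R])
  define v where "v = (\<integral>x. (D x)\<^sup>2 \<partial>M)"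
  show thesis
  proof (rule that)
    show "0 \<le> v" by (simp add: v_def)
    have "(\<lambda>n. l2_norm M (S n) / sqrt (real n) - l2_norm M D) \<longlonglongrightarrow> 0"
    proof (rule Lim_null_comparison[OF _ R_norm], rule eventually_sequentiallyI)
      fix n :: nat assume n: "1 \<le> n"
      have "l2_norm M (S n) \<le> l2_norm M (U n) + l2_norm M (R n)"
        using l2_norm_add[OF U_sq[of n] R_sq[of n]] by (simp add: S_eq[abs_def])
      moreover have "l2_norm M (U n) \<le> l2_norm M (S n) + l2_norm M (R n)"
        using l2_norm_diff[OF S_sq[of n] R_sq[of n]] by (simp add: S_eq[abs_def])
      moreover have U_norm: "l2_norm M (U n) = sqrt (real n) * l2_norm M D"
        unfolding U_def by (rule l2_norm_martingale[OF D])
      ultimately have "\<bar>l2_norm M (S n) - sqrt (real n) * l2_norm M D\<bar> \<le> l2_norm M (R n)" by linarith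
      then have "\<bar>l2_norm M (S n) - sqrt (real n) * l2_norm M D\<bar> / sqrt (real n) \<le> l2_norm M (R n) / sqrt (real n)"
        by (rule divide_right_mono) simp
      moreover have "l2_norm M (S n) / sqrt (real n) - l2_norm M D = (l2_norm M (S n) - sqrt (real n) * l2_norm M D) / sqrt (real n)"
        using n by (simp add: field_simps)
      ultimately show "norm (l2_norm M (S n) / sqrt (real n) - l2_norm M D)
          \<le> l2_norm M (orbit_sum \<theta> (\<lambda>x. X (\<theta> x) - D x) n) / sqrt (real n)"
        by (simp add: R_def)
    qed
    then have "(\<lambda>n. l2_norm M (S n) / sqrt (real n)) \<longlonglongrightarrow> l2_norm M D" by (simp add: LIM_zero_iff)
    then have "(\<lambda>n. (l2_norm M (S n) / sqrt (real n))\<^sup>2) \<longlonglongrightarrow> (l2_norm M D)\<^sup>2" by (rule tendsto_power)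
    then show "(\<lambda>n. (\<integral>x. (S n x)\<^sup>2 \<partial>M) / real n) \<longlonglongrightarrow> v"
      by (simp add: power_divide l2_norm_power2 v_def)
    \<comment> \<open>The Lipschitz bound turns R_n / sqrt n -> 0 into pointwise convergence of a
      bounded difference, so conditional dominated convergence applies.\<close>
    have transfer: "AE x in M. (\<lambda>n. ce (\<lambda>x. \<phi> (t * (S n x / sqrt (real n)))) x) \<longlonglongrightarrow> l"
      if \<phi>: "\<phi> \<in> borel_measurable borel" "\<And>a. \<bar>\<phi> a\<bar> \<le> 1" "\<And>a b. \<bar>\<phi> a - \<phi> b\<bar> \<le> \<bar>a - b\<bar>"
        and lim: "AE x in M. (\<lambda>n. ce (\<lambda>x. \<phi> (t * (U n x / sqrt (real n)))) x) \<longlonglongrightarrow> l"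
      for \<phi> :: "real \<Rightarrow> real" and t l
    proof -
      note [measurable] = \<phi>(1)
      define Y where "Y n x = \<phi> (t * (S n x / sqrt (real n))) - \<phi> (t * (U n x / sqrt (real n)))" for n x
      have "AE x in M. (\<lambda>n. ce (Y n) x) \<longlonglongrightarrow> 0"
      proof (rule ce_bounded_convergence[where C = 2])
        show "\<bar>Y n x\<bar> \<le> 2" for n x
          using \<phi>(2)[of "t * (S n x / sqrt (real n))"] \<phi>(2)[of "t * (U n x / sqrt (real n))"]
          unfolding Y_def by linarith
        show "AE x in M. (\<lambda>n. Y n x) \<longlonglongrightarrow> 0"
          using R_lim
        proof eventually_elim
          case (elim x)
          have "(\<lambda>n. \<bar>t\<bar> * \<bar>R n x / sqrt (real n)\<bar>) \<longlonglongrightarrow> \<bar>t\<bar> * \<bar>0\<bar>" by (intro tendsto_intros elim)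
          then have lim0: "(\<lambda>n. \<bar>t\<bar> * \<bar>R n x / sqrt (real n)\<bar>) \<longlonglongrightarrow> 0" by simp
          have "norm (Y n x) \<le> \<bar>t\<bar> * \<bar>R n x / sqrt (real n)\<bar>" for n
          proof -
            have "t * (S n x / sqrt (real n)) - t * (U n x / sqrt (real n)) = t * (R n x / sqrt (real n))"
              by (simp add: S_eq add_divide_distrib distrib_left)
            then show ?thesis
              using \<phi>(3)[of "t * (S n x / sqrt (real n))" "t * (U n x / sqrt (real n))"]
              by (simp add: Y_def abs_mult)
          qed
          then show ?case by (intro Lim_null_comparison[OF always_eventually lim0]) auto
        qed
        show "Y n \<in> borel_measurable M" for n unfolding Y_def by measurable
      qed
      moreover have "AE x in M. \<forall>n. ce (Y n) x = ce (\<lambda>x. \<phi> (t * (S n x / sqrt (real n)))) x - ce (\<lambda>x. \<phi> (t * (U n x / sqrt (real n)))) x"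
        unfolding AE_all_countable Y_def using \<phi>(2)
        by (intro allI real_cond_exp_diff integrable_const_bound[of _ 1]) auto
      ultimately show ?thesis
        using lim
      proof eventually_elim
        case (elim x)
        from tendsto_add[OF elim(1) elim(3)] show ?case using elim(2) by simp
      qed
    qed
    fix t :: real
    show "AE x in M. (\<lambda>n. ce (\<lambda>x. cos (t * (S n x / sqrt (real n)))) x) \<longlonglongrightarrow> exp (- (t\<^sup>2 * v) / 2)"
    proof (rule transfer)
      show "\<bar>cos a - cos b\<bar> \<le> \<bar>a - b\<bar>" for a b :: real
        by (rule abs_cos_diff_le)
      show "AE x in M. (\<lambda>n. ce (\<lambda>x. cos (t * (U n x / sqrt (real n)))) x) \<longlonglongrightarrow> exp (- (t\<^sup>2 * v) / 2)"
        unfolding U_def v_def by (rule conditional_clt_martingale(1)[OF D])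
    qed auto
    show "AE x in M. (\<lambda>n. ce (\<lambda>x. sin (t * (S n x / sqrt (real n)))) x) \<longlonglongrightarrow> 0"
    proof (rule transfer)
      show "\<bar>sin a - sin b\<bar> \<le> \<bar>a - b\<bar>" for a b :: real
        by (rule abs_sin_diff_le)
      show "AE x in M. (\<lambda>n. ce (\<lambda>x. sin (t * (U n x / sqrt (real n)))) x) \<longlonglongrightarrow> 0"
        unfolding U_def by (rule conditional_clt_martingale(2)[OF D])
    qed auto
    define G where "G n x = (\<Sum>i<n. ce (\<lambda>x. (D ((\<theta> ^^ i) x))\<^sup>2) x)" for n x
    have [measurable]: "G n \<in> borel_measurable M" for n unfolding G_def by measurable
    \<comment> \<open>Here \<open>b\<close> is both the index and the level: exceeding the level b +
      1 at some time has probability at most v / (b + 1).\<close>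
    have "AE x in M. \<exists>b\<ge>0. \<forall>n. \<not> real n * real (Suc b) < G n x"
    proof (rule AE_exists_small)
      have bd: "prob {x \<in> space M. \<not> (\<forall>n. \<not> real n * real (Suc b) < G n x)} \<le> v * (1 / real (Suc b))" for b
        using hopf_maximal_weak_type[of "\<lambda>x. (D x)\<^sup>2" "real (Suc b)"] D' by (auto simp: G_def v_def)
      have "(\<lambda>b. 1 / real (Suc b)) \<longlonglongrightarrow> 0"
        using LIMSEQ_inverse_real_of_nat by (simp add: inverse_eq_divide)
      then have lim0: "(\<lambda>b. v * (1 / real (Suc b))) \<longlonglongrightarrow> 0" by (rule tendsto_mult_right_zero)
      show "(\<lambda>b. prob {x \<in> space M. \<not> (\<forall>n. \<not> real n * real (Suc b) < G n x)}) \<longlonglongrightarrow> 0"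
        by (rule tendsto_sandwich[OF always_eventually always_eventually tendsto_const lim0])
          (use bd in \<open>simp_all only: measure_nonneg simp_thms\<close>)
    qed measurable
    then have G_bdd: "AE x in M. \<exists>b. \<forall>n. G n x \<le> real n * real (Suc b)" by (auto simp: not_less)
    \<comment> \<open>A convergent sequence is bounded, so almost every point leaves
      \<open>B L\<close> for large \<open>L\<close>; the conditional probabilities of
      \<open>B L\<close> then tend to zero.\<close>
    define B where "B L = {x \<in> space M. \<exists>n. real L / 2 < \<bar>R n x / sqrt (real n)\<bar>}" for L :: nat
    have [measurable]: "B L \<in> sets M" for L unfolding B_def by measurable
    have B_lim: "AE x in M. (\<lambda>L. ce (indicator (B L)) x) \<longlonglongrightarrow> 0"
    proof (rule ce_bounded_convergence[where C = 1])
      show "AE x in M. (\<lambda>L. indicator (B L) x) \<longlonglongrightarrow> (0::real)"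
        using R_lim
      proof eventually_elim
        case (elim x)
        then have "Bseq (\<lambda>n. R n x / sqrt (real n))" by (intro convergent_imp_Bseq convergentI)
        then obtain c where c: "\<And>n. \<bar>R n x / sqrt (real n)\<bar> \<le> c"
          unfolding Bseq_def real_norm_def by blast
        obtain L0 :: nat where L0: "2 * c < real L0" using reals_Archimedean2 by blast
        have "indicator (B L) x = (0::real)" if "L0 \<le> L" for L
        proof -
          have "real L0 \<le> real L" using that by simp
          then have "\<bar>R n x / sqrt (real n)\<bar> \<le> real L / 2" for n using c[of n] L0 by linarith
          then show ?thesis by (auto simp: B_def indicator_def not_less)
        qed
        then have "eventually (\<lambda>L. indicator (B L) x = (0::real)) sequentially"
          by (intro eventually_sequentiallyI[of L0])
        then show ?case by (rule tendsto_eventually)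
      qed
    qed (auto simp: indicator_def)
    define A where "A L n = {x \<in> space M. real L < \<bar>S n x / sqrt (real n)\<bar>}" for L n :: nat
    have [measurable]: "A L n \<in> sets M" for L n unfolding A_def by measurable
    have ind: "integrable M (indicat_real C)" if "C \<in> sets M" for C
      using that by (intro integrable_real_indicator) (auto simp: less_top[symmetric])
    \<comment> \<open>Off \<open>B (Suc L)\<close> the remainder is at most half the level, so the
      martingale part accounts for the other half, and Chebyshev's inequality gives the factor 4.
      \<open>Suc L\<close> keeps the level positive.\<close>
    have "AE x in M. \<forall>L n. ce (indicator (A (Suc L) n)) x \<le> 4 / (real (Suc L))\<^sup>2 / real n * G n x + ce (indicator (B (Suc L))) x"
      unfolding AE_all_countable
    proof (intro allI)
      fix L n
      define c where "c = 4 / (real (Suc L))\<^sup>2 / real n"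
      have int: "integrable M (\<lambda>x. c * (U n x)\<^sup>2)" using U_sq[of n] by auto
      have pt: "indicator (A (Suc L) n) x \<le> c * (U n x)\<^sup>2 + indicator (B (Suc L)) x" for x
      proof (cases "x \<in> A (Suc L) n - B (Suc L)")
        case True
        then have x: "real (Suc L) < \<bar>S n x / sqrt (real n)\<bar>" "\<bar>R n x / sqrt (real n)\<bar> \<le> real (Suc L) / 2"
          by (auto simp: A_def B_def not_less)
        then have "real (Suc L) / 2 \<le> \<bar>U n x / sqrt (real n)\<bar>"
          using abs_triangle_ineq[of "U n x / sqrt (real n)" "R n x / sqrt (real n)"]
          by (simp add: S_eq add_divide_distrib)
        then have "(real (Suc L) / 2)\<^sup>2 \<le> \<bar>U n x / sqrt (real n)\<bar>\<^sup>2" by (intro power_mono) auto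
        then have "(real (Suc L))\<^sup>2 \<le> 4 * ((U n x)\<^sup>2 / real n)" by (simp add: power_divide mult.commute del: of_nat_Suc)
        then have "(real (Suc L))\<^sup>2 / (real (Suc L))\<^sup>2 \<le> 4 * ((U n x)\<^sup>2 / real n) / (real (Suc L))\<^sup>2"
          by (rule divide_right_mono) simp
        then have "1 \<le> c * (U n x)\<^sup>2" by (simp add: c_def mult_ac del: of_nat_Suc)
        then show ?thesis using True by simp
      next
        case False
        have "0 \<le> c * (U n x)\<^sup>2" by (simp add: c_def)
        then show ?thesis using False by (auto simp: indicator_def)
      qed
      have "AE x in M. ce (indicator (A (Suc L) n)) x \<le> ce (\<lambda>x. c * (U n x)\<^sup>2 + indicator (B (Suc L)) x) x"
        using int ind pt by (intro real_cond_exp_mono) auto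
      moreover have "AE x in M. ce (\<lambda>x. c * (U n x)\<^sup>2 + indicator (B (Suc L)) x) x = ce (\<lambda>x. c * (U n x)\<^sup>2) x + ce (indicator (B (Suc L))) x"
        using int ind by (intro real_cond_exp_add) auto
      moreover have "AE x in M. ce (\<lambda>x. c * (U n x)\<^sup>2) x = c * ce (\<lambda>x. (U n x)\<^sup>2) x"
        using U_sq[of n] by (intro real_cond_exp_cmult) auto
      moreover have "AE x in M. ce (\<lambda>x. (U n x)\<^sup>2) x = G n x"
        unfolding U_def G_def by (rule ce_square_martingale[OF D])
      ultimately show "AE x in M. ce (indicator (A (Suc L) n)) x \<le> 4 / (real (Suc L))\<^sup>2 / real n * G n x + ce (indicator (B (Suc L))) x"
        by eventually_elim (simp add: c_def)
    qed
    with G_bdd B_lim have "AE x in M. \<forall>m::nat. \<exists>L::nat. \<forall>n. ce (indicator (A L n)) x \<le> 1 / real (Suc m)"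
    proof eventually_elim
      case (elim x)
      show ?case
      proof
        fix m :: nat
        obtain b :: nat where b: "\<And>n. G n x \<le> real n * real (Suc b)" using elim(1) by blast
        from LIMSEQ_D[OF elim(2), of "1 / (2 * real (Suc m))"]
        obtain L0 where L0: "\<And>L. L0 \<le> L \<Longrightarrow> \<bar>ce (indicator (B L)) x\<bar> < 1 / (2 * real (Suc m))" by auto
        obtain L1 :: nat where L1: "8 * real (Suc b) * real (Suc m) < real L1" using reals_Archimedean2 by blast
        define L where "L = max L0 L1"
        have L: "8 * real (Suc b) * real (Suc m) \<le> real (Suc L)" using L1 by (simp add: L_def)
        have "ce (indicator (A (Suc L) n)) x \<le> 1 / real (Suc m)" for n
        proof -
          have "4 / (real (Suc L))\<^sup>2 / real n * G n x \<le> 4 / (real (Suc L))\<^sup>2 / real n * (real n * real (Suc b))"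
            by (intro mult_left_mono b) auto
          also have "\<dots> \<le> 4 * real (Suc b) / (real (Suc L))\<^sup>2" by (cases "n = 0") (auto simp del: of_nat_Suc)
          also have "\<dots> \<le> 4 * real (Suc b) / real (Suc L)"
            by (intro divide_left_mono) (auto simp: power2_eq_square)
          also have "\<dots> \<le> 1 / (2 * real (Suc m))"
            using L by (simp add: field_simps)
          finally have s1: "4 / (real (Suc L))\<^sup>2 / real n * G n x \<le> 1 / (2 * real (Suc m))" .
          have s2: "ce (indicator (B (Suc L))) x \<le> 1 / (2 * real (Suc m))"
          proof -
            have "L0 \<le> Suc L" by (simp add: L_def)
            from L0[OF this] show ?thesis by linarith
          qed
          have "1 / (2 * real (Suc m)) + 1 / (2 * real (Suc m)) = 1 / real (Suc m)" by (simp add: field_simps)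
          with order_trans[OF elim(3)[rule_format, of L n] add_mono[OF s1 s2]] show ?thesis by (simp only:)
        qed
        then show "\<exists>L. \<forall>n. ce (indicator (A L n)) x \<le> 1 / real (Suc m)" by blast
      qed
    qed
    then show "AE x in M. \<forall>m::nat. \<exists>L::nat. \<forall>n.
        ce (indicator {x \<in> space M. real L < \<bar>S n x / sqrt (real n)\<bar>}) x \<le> 1 / real (Suc m)"
      by (simp add: A_def)
  qed
qed

end

subsection \<open>Regular conditional distribution functions\<close>

text \<open>Only the existence of a law is given. Choosing one as a function of \<open>H\<close>
  turns a family of distribution functions into a kernel; distribution functions determine laws, so
  the choice is harmless.\<close>

definition cdf_law :: "(real \<Rightarrow> real) \<Rightarrow> real measure" where
  "cdf_law H = (SOME \<mu>. real_distribution \<mu> \<and> H = cdf \<mu>)"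

lemma cdf_law:
  assumes "\<exists>\<mu>. real_distribution \<mu> \<and> H = cdf \<mu>"
  shows "real_distribution (cdf_law H)" "cdf (cdf_law H) = H"
  using someI_ex[OF assms] by (auto simp: cdf_law_def)

lemma real_distribution_integrable:
  fixes f :: "real \<Rightarrow> real"
  assumes "real_distribution \<mu>" and [measurable]: "f \<in> borel_measurable borel" and "\<And>y. \<bar>f y\<bar> \<le> C"
  shows "integrable \<mu> f"
proof -
  interpret real_distribution \<mu> by fact
  show ?thesis by (rule integrable_const_bound[of _ C]) (use assms in auto)
qed

lemma real_distribution_integral_const:
  "real_distribution \<mu> \<Longrightarrow> (\<integral>y. c \<partial>\<mu>) = (c::real)"
  using prob_space.prob_space real_distribution.axioms(1) by fastforce

lemma real_distribution_atMost:
  assumes "real_distribution \<mu>"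
  shows "emeasure \<mu> {..z} = ennreal (cdf \<mu> z)" "0 \<le> cdf \<mu> z" "cdf \<mu> z \<le> 1"
proof -
  interpret real_distribution \<mu> by fact
  show "emeasure \<mu> {..z} = ennreal (cdf \<mu> z)" "0 \<le> cdf \<mu> z" "cdf \<mu> z \<le> 1"
    by (simp_all add: emeasure_eq_measure cdf_def)
qed

lemma finite_measure_density_indicator:
  assumes "finite_measure M" "A \<in> sets M"
  shows "finite_measure (density M (indicator A))"
proof -
  interpret finite_measure M by fact
  show ?thesis
    using assms(2) by (intro finite_measureI) (simp add: emeasure_density)
qed

text \<open>The given identity concerns half-lines, with a null set depending on the endpoint.
  Instead of approximating \<open>f\<close>, fix an event \<open>A\<close> of \<open>G\<close> and
  compare two finite measures on the line: the law of \<open>Y\<close> on \<open>A\<close> and the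
  mixture of the kernel over \<open>A\<close>. Integration over \<open>A\<close> absorbs the null
  sets, so their distribution functions agree at every point and the measures coincide; then
  \<open>f\<close> is integrated.\<close>

lemma regular_cond_cdf_integral_nonneg:
  fixes f :: "real \<Rightarrow> real"
  assumes "prob_space M" and sub: "subalgebra M G" and [measurable]: "Y \<in> borel_measurable M"
    and F: "regular_cond_cdf M G Y F"
    and [measurable]: "f \<in> borel_measurable borel" and f: "\<And>y. 0 \<le> f y" "\<And>y. f y \<le> C"
  shows "AE x in M. real_cond_exp M G (\<lambda>x. f (Y x)) x = (\<integral>y. f y \<partial>cdf_law (F x))"
proof -
  interpret prob_space M by fact
  interpret finite_measure_subalgebra M G by unfold_locales (rule sub)
  have space_G: "space G = space M" using sub by (simp add: subalgebra_def)
  define \<kappa> where "\<kappa> x = cdf_law (F x)" for x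
  have law: "real_distribution (\<kappa> x)" "cdf (\<kappa> x) = F x" if "x \<in> space M" for x
    using F that cdf_law[of "F x"] by (auto simp: regular_cond_cdf_def \<kappa>_def)
  have atMost: "emeasure (\<kappa> x) {..z} = ennreal (F x z)" if "x \<in> space M" for x z
    using real_distribution_atMost(1)[OF law(1)[OF that]] law(2)[OF that] by simp
  have F_meas: "(\<lambda>x. F x z) \<in> borel_measurable G" for z
    using F by (simp add: regular_cond_cdf_def)
  \<comment> \<open>Half-lines form an intersection stable generator of the Borel sets, so
    measurability in the point for each fixed endpoint suffices.\<close>
  have "\<kappa> \<in> measurable G (prob_algebra borel)"
  proof (rule measurable_prob_algebra_generated[where \<Omega> = UNIV and G = "range (\<lambda>a. {..a})"])
    show "sets borel = sigma_sets UNIV (range (\<lambda>a::real. {..a}))"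
      by (subst borel_eq_atMost) simp
    show "Int_stable (range (\<lambda>a::real. {..a}))" by (auto simp: Int_stable_def)
    show "prob_space (\<kappa> x)" if "x \<in> space G" for x
      using law(1) that real_distribution.axioms(1) by (auto simp: space_G)
    show "sets (\<kappa> x) = sets borel" if "x \<in> space G" for x
      using law(1) that by (auto simp: space_G real_distribution.events_eq_borel)
    show "(\<lambda>x. emeasure (\<kappa> x) A) \<in> borel_measurable G" if A: "A \<in> range (\<lambda>a::real. {..a})" for A
    proof -
      obtain z where "A = {..z}" using A by auto
      then have "(\<lambda>x. emeasure (\<kappa> x) A) \<in> borel_measurable G \<longleftrightarrow> (\<lambda>x. ennreal (F x z)) \<in> borel_measurable G"
        using atMost by (intro measurable_cong) (auto simp: space_G)
      then show ?thesis using F_meas[of z] by simp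
    qed
  qed simp
  then have \<kappa>_G: "\<kappa> \<in> measurable G (subprob_algebra borel)" by (rule measurable_prob_algebraD)
  then have \<kappa>_M [measurable]: "\<kappa> \<in> measurable M (subprob_algebra borel)"
    by (rule measurable_from_subalg[OF sub])
  have int_\<kappa>: "(\<integral>\<^sup>+y. ennreal (f y) \<partial>\<kappa> x) = ennreal (\<integral>y. f y \<partial>\<kappa> x)" "(\<integral>y. f y \<partial>\<kappa> x) \<le> C" "0 \<le> (\<integral>y. f y \<partial>\<kappa> x)"
    if "x \<in> space M" for x
  proof -
    have int: "integrable (\<kappa> x) f"
      by (rule real_distribution_integrable[OF law(1)[OF that], of _ C]) (use f in auto)
    then show "(\<integral>\<^sup>+y. ennreal (f y) \<partial>\<kappa> x) = ennreal (\<integral>y. f y \<partial>\<kappa> x)"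
      using f by (intro nn_integral_eq_integral) auto
    have "integrable (\<kappa> x) (\<lambda>_. C)"
      by (rule real_distribution_integrable[OF law(1)[OF that], of _ "\<bar>C\<bar>"]) auto
    then have "(\<integral>y. f y \<partial>\<kappa> x) \<le> (\<integral>y. C \<partial>\<kappa> x)" using int f by (intro integral_mono) auto
    then show "(\<integral>y. f y \<partial>\<kappa> x) \<le> C" by (simp only: real_distribution_integral_const[OF law(1)[OF that]])
    show "0 \<le> (\<integral>y. f y \<partial>\<kappa> x)" using f by simp
  qed
  have "(\<lambda>x. \<integral>\<^sup>+y. ennreal (f y) \<partial>\<kappa> x) \<in> borel_measurable G"
    by (rule measurable_compose[OF \<kappa>_G nn_integral_measurable_subprob_algebra]) measurable
  then have "(\<lambda>x. enn2real (\<integral>\<^sup>+y. ennreal (f y) \<partial>\<kappa> x)) \<in> borel_measurable G" by measurable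
  then have h_G: "(\<lambda>x. \<integral>y. f y \<partial>\<kappa> x) \<in> borel_measurable G"
    by (rule measurable_cong[THEN iffD1, rotated]) (use int_\<kappa> in \<open>auto simp: space_G\<close>)
  then have h_M [measurable]: "(\<lambda>x. \<integral>y. f y \<partial>\<kappa> x) \<in> borel_measurable M"
    by (rule measurable_from_subalg[OF sub])
  have eq: "(\<integral>\<^sup>+x. indicator A x * ennreal (f (Y x)) \<partial>M) = (\<integral>\<^sup>+x. indicator A x * ennreal (\<integral>y. f y \<partial>\<kappa> x) \<partial>M)"
    if A: "A \<in> sets G" for A
  proof -
    have A_M [measurable]: "A \<in> sets M" using A sub by (auto simp: subalgebra_def)
    define M' where "M' = density M (indicator A)"
    interpret M': finite_measure M' unfolding M'_def
      by (rule finite_measure_density_indicator) (auto intro: finite_measure_axioms)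
    have [measurable_cong]: "sets M' = sets M" by (simp add: M'_def)
    have ne: "space M' \<noteq> {}" using not_empty by (simp add: M'_def)
    define N1 where "N1 = distr M' borel Y"
    define N2 where "N2 = M' \<bind> \<kappa>"
    have \<kappa>_M' [measurable]: "\<kappa> \<in> measurable M' (subprob_algebra borel)" by measurable
    have sets_N2: "sets N2 = sets borel"
      unfolding N2_def using ne by (intro sets_bind) (auto simp: sets_kernel[OF \<kappa>_M'])
    have em1: "emeasure N1 {..z} = ennreal (\<integral>x. indicator A x * indicator {x \<in> space M. Y x \<le> z} x \<partial>M)" for z
    proof -
      have "emeasure N1 {..z} = (\<integral>\<^sup>+x. indicator A x * indicator {x \<in> space M. Y x \<le> z} x \<partial>M)"
        unfolding N1_def M'_def
        by (subst emeasure_distr) (auto simp: emeasure_density intro!: nn_integral_cong split: split_indicator)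
      also have "\<dots> = (\<integral>\<^sup>+x. ennreal (indicator A x * indicator {x \<in> space M. Y x \<le> z} x) \<partial>M)"
        by (intro nn_integral_cong) (auto split: split_indicator)
      also have "\<dots> = ennreal (\<integral>x. indicator A x * indicator {x \<in> space M. Y x \<le> z} x \<partial>M)"
        by (intro nn_integral_eq_integral integrable_const_bound[of _ 1]) (auto split: split_indicator)
      finally show ?thesis .
    qed
    have em2: "emeasure N2 {..z} = ennreal (\<integral>x. indicator A x * indicator {x \<in> space M. Y x \<le> z} x \<partial>M)" for z
    proof -
      have [measurable]: "(\<lambda>x. F x z) \<in> borel_measurable M" by (rule measurable_from_subalg[OF sub F_meas])
      have F01: "0 \<le> F x z" "F x z \<le> 1" if "x \<in> space M" for x
        using real_distribution_atMost(2,3)[OF law(1)[OF that], of z] law(2)[OF that] by simp_all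
      have "emeasure N2 {..z} = (\<integral>\<^sup>+x. emeasure (\<kappa> x) {..z} \<partial>M')"
        unfolding N2_def by (rule emeasure_bind[OF ne \<kappa>_M']) simp
      also have "\<dots> = (\<integral>\<^sup>+x. indicator A x * emeasure (\<kappa> x) {..z} \<partial>M)"
        unfolding M'_def by (rule nn_integral_density) auto
      also have "\<dots> = (\<integral>\<^sup>+x. ennreal (indicator A x * F x z) \<partial>M)"
        using atMost by (intro nn_integral_cong) (auto split: split_indicator)
      also have "\<dots> = ennreal (\<integral>x. indicator A x * F x z \<partial>M)"
        using F01 by (intro nn_integral_eq_integral integrable_const_bound[of _ 1]) (auto split: split_indicator)
      also have "(\<integral>x. indicator A x * F x z \<partial>M)
        = (\<integral>x. indicator A x * real_cond_exp M G (indicator {x \<in> space M. Y x \<le> z}) x \<partial>M)"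
      proof (rule integral_cong_AE)
        have "AE x in M. F x z = real_cond_exp M G (indicator {x \<in> space M. Y x \<le> z}) x"
          using F by (simp add: regular_cond_cdf_def real_cond_prob_def)
        then show "AE x in M. indicator A x * F x z = indicator A x * real_cond_exp M G (indicator {x \<in> space M. Y x \<le> z}) x"
          by eventually_elim simp
      qed auto
      also have "\<dots> = (\<integral>x. indicator A x * indicator {x \<in> space M. Y x \<le> z} x \<partial>M)"
        using A by (intro real_cond_exp_intg integrable_const_bound[of _ 1]) (auto split: split_indicator)
      finally show ?thesis .
    qed
    have "N1 = N2"
    proof (rule cdf_unique')
      show "finite_borel_measure N1"
        unfolding finite_borel_measure_def finite_borel_measure_axioms_def
        using M'.finite_measure_distr[of Y borel] by (auto simp: N1_def)
      have "emeasure N2 UNIV = (\<integral>\<^sup>+x. emeasure (\<kappa> x) UNIV \<partial>M')"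
        unfolding N2_def by (rule emeasure_bind[OF ne \<kappa>_M']) simp
      also have "\<dots> \<le> (\<integral>\<^sup>+x. 1 \<partial>M')"
        using subprob_space.subprob_emeasure_le_1[OF subprob_space_kernel[OF \<kappa>_M']] by (intro nn_integral_mono) auto
      also have "\<dots> < \<infinity>" using M'.emeasure_finite by (simp add: less_top[symmetric])
      finally show "finite_borel_measure N2"
        unfolding finite_borel_measure_def finite_borel_measure_axioms_def
        using sets_N2 sets_eq_imp_space_eq[OF sets_N2] by (auto intro!: finite_measureI)
      show "cdf N1 = cdf N2"
        by (rule ext) (simp add: cdf_def measure_def em1 em2)
    qed
    have "(\<integral>\<^sup>+x. indicator A x * ennreal (f (Y x)) \<partial>M) = (\<integral>\<^sup>+y. ennreal (f y) \<partial>N1)"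
      unfolding N1_def M'_def by (subst nn_integral_distr) (auto simp: nn_integral_density)
    also have "\<dots> = (\<integral>\<^sup>+x. \<integral>\<^sup>+y. ennreal (f y) \<partial>\<kappa> x \<partial>M')"
      unfolding \<open>N1 = N2\<close> N2_def by (rule nn_integral_bind[OF _ \<kappa>_M']) simp
    also have "\<dots> = (\<integral>\<^sup>+x. indicator A x * (\<integral>\<^sup>+y. ennreal (f y) \<partial>\<kappa> x) \<partial>M)"
      unfolding M'_def
      by (rule nn_integral_density) (auto intro!: measurable_compose[OF \<kappa>_M nn_integral_measurable_subprob_algebra])
    also have "\<dots> = (\<integral>\<^sup>+x. indicator A x * ennreal (\<integral>y. f y \<partial>\<kappa> x) \<partial>M)"
      using int_\<kappa> by (intro nn_integral_cong) auto
    finally show ?thesis .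
  qed
  have "AE x in M. real_cond_exp M G (\<lambda>x. f (Y x)) x = (\<integral>y. f y \<partial>\<kappa> x)"
  proof (rule real_cond_exp_charact)
    fix A assume A: "A \<in> sets G"
    have A_M [measurable]: "A \<in> sets M" using A sub by (auto simp: subalgebra_def)
    have "(\<integral>x\<in>A. f (Y x) \<partial>M) = enn2real (\<integral>\<^sup>+x. indicator A x * ennreal (f (Y x)) \<partial>M)"
      unfolding set_lebesgue_integral_def using f
      by (subst integral_eq_nn_integral) (auto intro!: arg_cong[where f = enn2real] nn_integral_cong split: split_indicator)
    also have "\<dots> = enn2real (\<integral>\<^sup>+x. indicator A x * ennreal (\<integral>y. f y \<partial>\<kappa> x) \<partial>M)"
      by (simp only: eq[OF A])
    also have "\<dots> = (\<integral>x\<in>A. (\<integral>y. f y \<partial>\<kappa> x) \<partial>M)"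
      unfolding set_lebesgue_integral_def using int_\<kappa>
      by (subst integral_eq_nn_integral) (auto intro!: arg_cong[where f = enn2real] nn_integral_cong split: split_indicator)
    finally show "(\<integral>x\<in>A. f (Y x) \<partial>M) = (\<integral>x\<in>A. (\<integral>y. f y \<partial>\<kappa> x) \<partial>M)" .
  next
    show "integrable M (\<lambda>x. f (Y x))"
      by (rule integrable_const_bound[of _ C]) (use f in auto)
    show "integrable M (\<lambda>x. \<integral>y. f y \<partial>\<kappa> x)"
      by (rule integrable_const_bound[of _ C]) (use int_\<kappa> in auto)
  qed (rule h_G)
  then show ?thesis by (simp add: \<kappa>_def)
qed

lemma regular_cond_cdf_integral:
  fixes f :: "real \<Rightarrow> real"
  assumes M: "prob_space M" and sub: "subalgebra M G" and Y [measurable]: "Y \<in> borel_measurable M"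
    and F: "regular_cond_cdf M G Y F"
    and [measurable]: "f \<in> borel_measurable borel" and f: "\<And>y. \<bar>f y\<bar> \<le> C"
  shows "AE x in M. real_cond_exp M G (\<lambda>x. f (Y x)) x = (\<integral>y. f y \<partial>cdf_law (F x))"
proof -
  interpret prob_space M by fact
  interpret finite_measure_subalgebra M G by unfold_locales (rule sub)
  have f': "0 \<le> f y + C" "f y + C \<le> 2 * C" for y using f[of y] by linarith+
  have int: "integrable M (\<lambda>x. f (Y x))" by (rule integrable_const_bound[of _ C]) (use f in auto)
  have "AE x in M. real_cond_exp M G (\<lambda>x. f (Y x) + C) x = (\<integral>y. f y + C \<partial>cdf_law (F x))"
    by (rule regular_cond_cdf_integral_nonneg[OF M sub Y F, of "\<lambda>y. f y + C" "2 * C"]) (use f' in auto)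
  moreover have "AE x in M. real_cond_exp M G (\<lambda>x. f (Y x) + C) x = real_cond_exp M G (\<lambda>x. f (Y x)) x + real_cond_exp M G (\<lambda>_. C) x"
    using int by (intro real_cond_exp_add) auto
  moreover have "AE x in M. real_cond_exp M G (\<lambda>_. C) x = C" by (rule real_cond_exp_F_meas) auto
  ultimately show ?thesis
    using AE_space
  proof eventually_elim
    case (elim x)
    have law: "real_distribution (cdf_law (F x))"
      using F elim(4) by (intro cdf_law) (auto simp: regular_cond_cdf_def)
    have "integrable (cdf_law (F x)) f" "integrable (cdf_law (F x)) (\<lambda>_. C)"
      using f by (auto intro: real_distribution_integrable[OF law, of _ C] real_distribution_integrable[OF law, of _ "\<bar>C\<bar>"])
    then have "(\<integral>y. f y + C \<partial>cdf_law (F x)) = (\<integral>y. f y \<partial>cdf_law (F x)) + C"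
      by (simp only: Bochner_Integration.integral_add real_distribution_integral_const[OF law])
    then show ?case using elim by simp
  qed
qed

subsection \<open>Convergence of characteristic functions at rational points\<close>

lemma cmod_iexp_diff_le: "cmod (iexp a - iexp b) \<le> \<bar>a - b\<bar>"
proof -
  have "iexp a = iexp b * iexp (a - b)"
    unfolding exp_add[symmetric] by (simp add: algebra_simps)
  then have "iexp a - iexp b = iexp b * (iexp (a - b) - 1)"
    by (simp only: right_diff_distrib mult_1_right)
  then have "cmod (iexp a - iexp b) = cmod (iexp (a - b) - 1)" by (simp add: norm_mult)
  also have "\<dots> \<le> \<bar>a - b\<bar>" using iexp_approx1[of "a - b" 0] by simp
  finally show ?thesis .
qed

text \<open>Inside [-L, L] the exponentials differ by at most |t - s| L, outside by at most 2. The
  law enters only through its tail, so the bound is uniform over a tight family.\<close>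

lemma (in real_distribution) cmod_char_diff_le:
  assumes L: "0 \<le> L"
  shows "cmod (char M t - char M s) \<le> \<bar>t - s\<bar> * L + 2 * measure M {y. L < \<bar>y\<bar>}"
proof -
  have int: "integrable M (\<lambda>x. iexp (t * x))" for t by (rule integrable_iexp) auto
  have "char M t - char M s = (CLINT x|M. iexp (t * x) - iexp (s * x))"
    unfolding char_def using int by simp
  also have "cmod \<dots> \<le> (\<integral>x. cmod (iexp (t * x) - iexp (s * x)) \<partial>M)"
    by (rule integral_norm_bound)
  also have "\<dots> \<le> (\<integral>x. \<bar>t - s\<bar> * L + 2 * indicator {y. L < \<bar>y\<bar>} x \<partial>M)"
  proof (rule integral_mono)
    show "integrable M (\<lambda>x. cmod (iexp (t * x) - iexp (s * x)))" using int by (intro integrable_norm) simp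
    show "integrable M (\<lambda>x. \<bar>t - s\<bar> * L + 2 * indicator {y. L < \<bar>y\<bar>} x)"
      by (auto intro!: integrable_const_bound[of _ "\<bar>t - s\<bar> * L + 2"] simp: indicator_def L)
    fix x
    show "cmod (iexp (t * x) - iexp (s * x)) \<le> \<bar>t - s\<bar> * L + 2 * indicator {y. L < \<bar>y\<bar>} x"
    proof (cases "L < \<bar>x\<bar>")
      case True
      have "cmod (iexp (t * x) - iexp (s * x)) \<le> 2"
        using norm_triangle_ineq4[of "iexp (t * x)" "iexp (s * x)"] by simp
      moreover have "0 \<le> \<bar>t - s\<bar> * L" using L by simp
      ultimately show ?thesis using True by simp
    next
      case False
      have "cmod (iexp (t * x) - iexp (s * x)) \<le> \<bar>t * x - s * x\<bar>" by (rule cmod_iexp_diff_le)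
      also have "\<dots> = \<bar>t - s\<bar> * \<bar>x\<bar>" by (simp add: left_diff_distrib[symmetric] abs_mult)
      also have "\<dots> \<le> \<bar>t - s\<bar> * L" using False by (intro mult_left_mono) auto
      finally show ?thesis using False by simp
    qed
  qed
  also have "\<dots> = \<bar>t - s\<bar> * L + 2 * measure M {y. L < \<bar>y\<bar>}"
  proof -
    have "integrable M (indicat_real {y. L < \<bar>y\<bar>})"
      by (intro integrable_real_indicator) (auto simp: less_top[symmetric])
    then show ?thesis using prob_space by simp
  qed
  finally show ?thesis .
qed

text \<open>Tightness cannot be dropped: the point masses at \<open>2 \<pi> n!\<close> have characteristic functions
  converging to \<open>1\<close> at every rational.\<close>

lemma weak_conv_m_of_rational_char:
  fixes \<mu> :: "nat \<Rightarrow> real measure"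
  assumes \<mu>: "\<And>n. real_distribution (\<mu> n)" and \<nu>: "real_distribution \<nu>"
    and conv: "\<And>t. t \<in> \<rat> \<Longrightarrow> (\<lambda>n. char (\<mu> n) t) \<longlonglongrightarrow> char \<nu> t"
    and tight: "\<And>m::nat. \<exists>L::nat. \<forall>n. measure (\<mu> n) {y. real L < \<bar>y\<bar>} \<le> 1 / real (Suc m)"
  shows "weak_conv_m \<mu> \<nu>"
proof (rule levy_continuity[OF \<mu> \<nu>])
  fix t
  show "(\<lambda>n. char (\<mu> n) t) \<longlonglongrightarrow> char \<nu> t"
  proof (rule LIMSEQ_I)
    fix r :: real assume r: "0 < r"
    \<comment> \<open>The budget: twice the tail is below r / 4 and |t - s| L is at most r / 4, so
      \<open>\<mu> n\<close> costs r / 2; continuity of the limit and convergence at the rational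
      point cost r / 4 each.\<close>
    obtain m :: nat where m: "1 / real (Suc m) < r / 8" using nat_approx_posE[of "r / 8"] r by auto
    obtain L :: nat where L: "\<And>n. measure (\<mu> n) {y. real L < \<bar>y\<bar>} \<le> 1 / real (Suc m)" using tight by blast
    have "isCont (char \<nu>) t" using \<nu> by (rule real_distribution.isCont_char)
    then have "\<exists>d>0. \<forall>s. dist s t < d \<longrightarrow> dist (char \<nu> s) (char \<nu> t) < r / 4"
      unfolding continuous_at_eps_delta using r by (meson divide_pos_pos zero_less_numeral)
    then obtain d where d: "0 < d" "\<And>s. \<bar>s - t\<bar> < d \<Longrightarrow> cmod (char \<nu> s - char \<nu> t) < r / 4"
      by (auto simp: dist_norm)
    \<comment> \<open>L + 1 in place of \<open>L\<close> avoids a zero denominator.\<close>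
    define d' where "d' = min d (r / (4 * (real L + 1)))"
    have "0 < d'" using d r by (simp add: d'_def)
    then obtain s where s: "s \<in> \<rat>" "t < s" "s < t + d'" using Rats_dense_in_real[of t "t + d'"] by auto
    have s_L: "\<bar>t - s\<bar> * real L \<le> r / 4"
    proof -
      have "\<bar>t - s\<bar> * real L \<le> r / (4 * (real L + 1)) * (real L + 1)"
        using s r by (intro mult_mono) (auto simp: d'_def)
      moreover have "r / (4 * (real L + 1)) * (real L + 1) = r / 4"
        by (simp add: add_nonneg_eq_0_iff divide_simps)
      ultimately show ?thesis by (simp only:)
    qed
    have 1: "cmod (char (\<mu> n) t - char (\<mu> n) s) < r / 2" for n
    proof -
      have "cmod (char (\<mu> n) t - char (\<mu> n) s) \<le> \<bar>t - s\<bar> * real L + 2 * measure (\<mu> n) {y. real L < \<bar>y\<bar>}"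
        by (rule real_distribution.cmod_char_diff_le[OF \<mu>]) simp
      then show ?thesis using s_L L[of n] m by linarith
    qed
    have 2: "cmod (char \<nu> s - char \<nu> t) < r / 4" using s by (intro d) (auto simp: d'_def)
    from LIMSEQ_D[OF conv[OF s(1)], of "r / 4"] r
    obtain n0 where n0: "\<And>n. n0 \<le> n \<Longrightarrow> cmod (char (\<mu> n) s - char \<nu> s) < r / 4" by auto
    have "cmod (char (\<mu> n) t - char \<nu> t) < r" if "n0 \<le> n" for n
    proof -
      have "char (\<mu> n) t - char \<nu> t = (char (\<mu> n) t - char (\<mu> n) s) + (char (\<mu> n) s - char \<nu> s) + (char \<nu> s - char \<nu> t)" by simp
      then have "cmod (char (\<mu> n) t - char \<nu> t)
        \<le> cmod (char (\<mu> n) t - char (\<mu> n) s) + cmod (char (\<mu> n) s - char \<nu> s) + cmod (char \<nu> s - char \<nu> t)"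
        by (simp only:) (intro order_trans[OF norm_triangle_ineq] add_mono norm_triangle_ineq order_refl)
      then show ?thesis using 1[of n] 2 n0[OF that] by linarith
    qed
    then show "\<exists>no. \<forall>n\<ge>no. norm (char (\<mu> n) t - char \<nu> t) < r" by blast
  qed
qed

text \<open>For positive \<open>v\<close> the law is the image of the standard normal law under
  multiplication by sqrt v. At \<open>v = 0\<close> the point mass has characteristic function 1, in
  agreement with the same formula.\<close>

lemma centred_normal:
  assumes "0 \<le> v"
  shows "real_distribution (centred_normal v)" "char (centred_normal v) t = exp (- (t\<^sup>2 * v) / 2)"
proof -
  have "real_distribution (centred_normal v) \<and> char (centred_normal v) t = exp (- (t\<^sup>2 * v) / 2)"
  proof (cases "v = 0")
    case True
    have "real_distribution (return borel (0::real))"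
      unfolding real_distribution_def real_distribution_axioms_def by (auto intro: prob_space_return)
    moreover have "char (return borel 0) t = 1"
      unfolding char_def by (subst integral_return) auto
    ultimately show ?thesis using True by (simp add: centred_normal_def)
  next
    case False
    define s where "s = sqrt v"
    have s: "0 < s" using False assms by (simp add: s_def)
    interpret std: prob_space std_normal_distribution by (rule prob_space_normal_density) simp
    have "distributed std_normal_distribution lborel (\<lambda>x. x) std_normal_density"
      unfolding distributed_def by (auto simp: distr_id2 cong: distr_cong)
    from std.normal_density_affine[OF this, of s 0] s
    have "distributed std_normal_distribution lborel (\<lambda>x. s * x) (normal_density 0 s)" by simp
    then have eq: "density lborel (\<lambda>x. ennreal (normal_density 0 s x)) = distr std_normal_distribution lborel (\<lambda>x. s * x)"
      by (simp add: distributed_def)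
    have "real_distribution (density lborel (\<lambda>x. ennreal (normal_density 0 s x)))"
      unfolding real_distribution_def real_distribution_axioms_def
      using prob_space_normal_density[OF s, of 0] by auto
    moreover have "char (density lborel (\<lambda>x. ennreal (normal_density 0 s x))) t = char std_normal_distribution (t * s)"
      unfolding eq char_def by (subst integral_distr) (auto simp: mult.assoc)
    moreover have "char std_normal_distribution (t * s) = exp (- (t\<^sup>2 * v) / 2)"
      using assms by (simp add: char_std_normal_distribution s_def power_mult_distrib)
    ultimately show ?thesis using False by (simp add: centred_normal_def s_def)
  qed
  then show "real_distribution (centred_normal v)" "char (centred_normal v) t = exp (- (t\<^sup>2 * v) / 2)"
    by auto
qed

lemma (in real_distribution) char_eq_Complex:
  "char M t = Complex (\<integral>y. cos (t * y) \<partial>M) (\<integral>y. sin (t * y) \<partial>M)"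
proof -
  have int: "integrable M (\<lambda>x. iexp (t * x))" by (rule integrable_iexp) auto
  have "Re (char M t) = (\<integral>y. cos (t * y) \<partial>M)" "Im (char M t) = (\<integral>y. sin (t * y) \<partial>M)"
    unfolding char_def integral_Re[OF int, symmetric] integral_Im[OF int, symmetric]
    by (simp_all add: Re_exp Im_exp)
  then show ?thesis by (simp add: complex_eq_iff)
qed

subsection \<open>The past of a process\<close>

lemma space_past [simp]: "space (past M N W k) = space M"
  unfolding past_def by (simp add: space_measure_of_conv)

lemma sets_past:
  "sets (past M N W k) = sigma_sets (space M) {W j -` A \<inter> space M | j A. j \<le> k \<and> A \<in> sets N}"
  unfolding past_def by (rule sets_measure_of) auto

lemma subalgebra_past:
  assumes "\<And>k. W k \<in> measurable M N"
  shows "subalgebra M (past M N W k)"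
proof -
  have "{W j -` A \<inter> space M | j A. j \<le> k \<and> A \<in> sets N} \<subseteq> sets M"
    using measurable_sets[OF assms] by blast
  then show ?thesis
    unfolding subalgebra_def sets_past by (simp add: sets.sigma_sets_subset)
qed

lemma measurable_past:
  assumes "W j \<in> measurable M N" "j \<le> k"
  shows "W j \<in> measurable (past M N W k) N"
proof (rule measurableI)
  show "W j x \<in> space N" if "x \<in> space (past M N W k)" for x
    using that measurable_space[OF assms(1)] by simp
  show "W j -` A \<inter> space (past M N W k) \<in> sets (past M N W k)" if "A \<in> sets N" for A
    using that assms(2) unfolding sets_past by (auto intro!: sigma_sets.Basic)
qed

text \<open>For a generator, W_j in C is the preimage under \<open>\<theta>\<close> of W_(j-1) in C,
  and the past, having no first index, contains time j - 1 along with j. Complements and countable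
  unions commute with preimages.\<close>

lemma past_increasing:
  assumes \<theta>: "\<And>x. x \<in> space M \<Longrightarrow> \<theta> x \<in> space M"
    and shift: "\<And>k x. x \<in> space M \<Longrightarrow> W k (\<theta> x) = W (k + 1) x"
    and A: "A \<in> sets (past M N W k)"
  shows "\<exists>B\<in>sets (past M N W k). A = \<theta> -` B \<inter> space M"
  using A unfolding sets_past
proof (induction A rule: sigma_sets.induct)
  case (Basic A)
  then obtain j C where C: "j \<le> k" "C \<in> sets N" "A = W j -` C \<inter> space M" by auto
  have "A = \<theta> -` (W (j - 1) -` C \<inter> space M) \<inter> space M"
    using C \<theta> shift[of _ "j - 1"] by auto
  moreover have "W (j - 1) -` C \<inter> space M \<in> sigma_sets (space M) {W j -` A \<inter> space M | j A. j \<le> k \<and> A \<in> sets N}"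
    using C by (intro sigma_sets.Basic CollectI exI[of _ "j - 1"] exI[of _ C]) auto
  ultimately show ?case by blast
next
  case Empty
  show ?case by (intro bexI[of _ "{}"] sigma_sets.Empty) auto
next
  case (Compl A)
  then obtain B where B: "B \<in> sigma_sets (space M) {W j -` A \<inter> space M | j A. j \<le> k \<and> A \<in> sets N}"
    "A = \<theta> -` B \<inter> space M" by blast
  then show ?case
    using \<theta> by (intro bexI[of _ "space M - B"] sigma_sets.Compl) auto
next
  case (Union A)
  from Union.IH have "\<exists>B. \<forall>i::nat. B i \<in> sigma_sets (space M) {W j -` A \<inter> space M | j A. j \<le> k \<and> A \<in> sets N}
      \<and> A i = \<theta> -` B i \<inter> space M"
    by (intro choice allI) blast
  then obtain B where B: "\<And>i::nat. B i \<in> sigma_sets (space M) {W j -` A \<inter> space M | j A. j \<le> k \<and> A \<in> sets N}"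
    "\<And>i. A i = \<theta> -` B i \<inter> space M" by blast
  then show ?case
    by (intro bexI[of _ "\<Union>i. B i"] sigma_sets.Union) auto
qed

lemma shift_iter:
  assumes \<theta>: "\<And>x. x \<in> space M \<Longrightarrow> \<theta> x \<in> space M"
    and shift: "\<And>k x. x \<in> space M \<Longrightarrow> W k (\<theta> x) = W (k + 1) x"
    and x: "x \<in> space M"
  shows "W k ((\<theta> ^^ n) x) = W (k + int n) x"
proof (induction n arbitrary: k)
  case (Suc n)
  have "(\<theta> ^^ n) x \<in> space M" by (induction n) (use x \<theta> in auto)
  then show ?case using shift[of "(\<theta> ^^ n) x" k] Suc[of "k + 1"] by (simp add: add_ac)
qed simp

section \<open>Application to the chain and its past\<close>

theorem corollary2:
  fixes M :: "'a measure" and N :: "'s measure"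
    and \<theta> :: "'a \<Rightarrow> 'a" and W :: "int \<Rightarrow> 'a \<Rightarrow> 's"
    and g :: "'s \<Rightarrow> real" and l :: "real \<Rightarrow> real"
    and F :: "nat \<Rightarrow> 'a \<Rightarrow> real \<Rightarrow> real"
  assumes "prob_space M"
    and "ergodic_mpt M \<theta>"
    and "stationary_ergodic_process M N W"
    and "markov_chain M N W"
    and "\<And>k \<omega>. \<omega> \<in> space M \<Longrightarrow> W k (\<theta> \<omega>) = W (k + 1) \<omega>"
    and "g \<in> borel_measurable N"
    and "integrable M (\<lambda>\<omega>. (g (W 0 \<omega>))\<^sup>2)"
    and "(\<integral>\<omega>. g (W 0 \<omega>) \<partial>M) = 0"
    and "\<And>x. x > 0 \<Longrightarrow> l x > 0"
    and "mono_on {0<..} l"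
    and "slowly_varying l"
    and "summable (\<lambda>n. 1 / (real (Suc n) * l (real (Suc n))))"
    and "summable (\<lambda>n. real (Suc n) powr (-3/2) * sqrt (l (real (Suc n))) * ln (real (Suc n)) *
            l2_norm M (real_cond_exp M (past M N W 0) (partial_sum g W (Suc n))))"
    and "\<And>n. n \<ge> 1 \<Longrightarrow>
            regular_cond_cdf M (past M N W 0) (\<lambda>\<omega>. partial_sum g W n \<omega> / sqrt (real n)) (F n)"
  shows "convergent (\<lambda>n. (\<integral>\<omega>. (partial_sum g W n \<omega>)\<^sup>2 \<partial>M) / real n) \<and>
    (AE \<omega> in M. weak_conv (\<lambda>n. F n \<omega>)
       (cdf (centred_normal (lim (\<lambda>n. (\<integral>\<omega>. (partial_sum g W n \<omega>)\<^sup>2 \<partial>M) / real n)))))"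
proof -
  interpret prob_space M by fact
  note shift = assms(5) and regular = assms(14)
  have W [measurable]: "W k \<in> measurable M N" for k
    using assms(3) by (simp add: stationary_ergodic_process_def)
  have \<theta>: "\<theta> \<in> measurable M M" "distr M M \<theta> = M"
    and erg: "\<And>A. A \<in> sets M \<Longrightarrow> \<theta> -` A \<inter> space M = A \<Longrightarrow> prob A = 0 \<or> prob A = 1"
    using assms(2) by (auto simp: ergodic_mpt_def)
  have \<theta>_space: "\<theta> x \<in> space M" if "x \<in> space M" for x using measurable_space[OF \<theta>(1) that] .
  note [measurable] = assms(6)
  define G where "G = past M N W 0"
  have sub: "subalgebra M G" unfolding G_def by (rule subalgebra_past) (rule W)
  have X_G: "(\<lambda>\<omega>. g (W 0 \<omega>)) \<in> borel_measurable G"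
    unfolding G_def by (rule measurable_compose[OF measurable_past[OF W order_refl] assms(6)])
  interpret adapted_system M \<theta> G "\<lambda>\<omega>. g (W 0 \<omega>)"
  proof unfold_locales
    show "\<exists>B\<in>sets G. A = \<theta> -` B \<inter> space M" if "A \<in> sets G" for A
      using that unfolding G_def
      by (rule past_increasing[where \<theta> = \<theta> and W = W, rotated 2]) (rule \<theta>_space shift, assumption)+
    show "square_integrable M (\<lambda>\<omega>. g (W 0 \<omega>))"
      using assms(7) by (simp add: square_integrable_def)
  qed (use \<theta> erg sub X_G in auto)
  have S_eq: "S n x = partial_sum g W n x" if x: "x \<in> space M" for n x
  proof -
    have "g (W 0 (\<theta> ((\<theta> ^^ k) x))) = g (W (int (Suc k)) x)" for k
      using shift_iter[where \<theta> = \<theta> and W = W and n = "Suc k" and k = 0, OF \<theta>_space shift x] by simp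
    then show ?thesis
      by (simp add: S_def orbit_sum_def partial_sum_def sum.atLeast1_atMost_eq del: of_nat_Suc)
  qed
  have [measurable]: "S n \<in> borel_measurable M" for n using S_sq by auto
  have [measurable]: "partial_sum g W n \<in> borel_measurable M" for n
    unfolding partial_sum_def by measurable
  have a_eq: "a n = l2_norm M (real_cond_exp M G (partial_sum g W n))" for n
    unfolding a_def e_def
    by (intro l2_norm_cong_AE real_cond_exp_cong AE_I2) (auto simp: S_eq)
  have l1: "0 < l 1" using assms(9) by simp
  have "summable (\<lambda>n. real (Suc n) powr (-3/2) * ln (real (Suc n)) * a (Suc n))"
  proof (rule summable_comparison_test'[OF summable_divide[OF assms(13), of "sqrt (l 1)"], of 0])
    fix n :: nat
    let ?q = "real (Suc n) powr (-3/2) * ln (real (Suc n)) * a (Suc n)"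
    have q: "0 \<le> ?q" by (intro mult_nonneg_nonneg a_nonneg) auto
    \<comment> \<open>Monotonicity bounds sqrt(l(n)) below by the positive constant sqrt(l(1)), so
      the assumed series, divided by this constant, dominates.\<close>
    have "l 1 \<le> l (real (Suc n))" using assms(10) by (rule mono_onD) auto
    then have "?q * sqrt (l 1) \<le> ?q * sqrt (l (real (Suc n)))" using q by (intro mult_left_mono) auto
    then have "?q \<le> ?q * sqrt (l (real (Suc n))) / sqrt (l 1)" using l1 by (subst pos_le_divide_eq) auto
    then have "norm ?q \<le> ?q * sqrt (l (real (Suc n))) / sqrt (l 1)"
      using q by (simp only: real_norm_def abs_of_nonneg)
    then show "norm ?q \<le> real (Suc n) powr (-3/2) * sqrt (l (real (Suc n))) * ln (real (Suc n)) *
            l2_norm M (real_cond_exp M (past M N W 0) (partial_sum g W (Suc n))) / sqrt (l 1)"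
      unfolding G_def[symmetric] a_eq[symmetric] by (simp only: mult_ac)
  qed
  from conditional_clt[OF this] obtain v where v: "0 \<le> v" "(\<lambda>n. (\<integral>x. (S n x)\<^sup>2 \<partial>M) / real n) \<longlonglongrightarrow> v"
    and cos_lim: "\<And>t. AE x in M. (\<lambda>n. ce (\<lambda>x. cos (t * (S n x / sqrt (real n)))) x) \<longlonglongrightarrow> exp (- (t\<^sup>2 * v) / 2)"
    and sin_lim: "\<And>t. AE x in M. (\<lambda>n. ce (\<lambda>x. sin (t * (S n x / sqrt (real n)))) x) \<longlonglongrightarrow> 0"
    and tight: "AE x in M. \<forall>m::nat. \<exists>L::nat. \<forall>n.
           ce (indicator {x \<in> space M. real L < \<bar>S n x / sqrt (real n)\<bar>}) x \<le> 1 / real (Suc m)"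
    by blast
  have "(\<integral>\<omega>. (partial_sum g W n \<omega>)\<^sup>2 \<partial>M) = (\<integral>x. (S n x)\<^sup>2 \<partial>M)" for n
    by (rule Bochner_Integration.integral_cong) (auto simp: S_eq)
  with v have lim: "(\<lambda>n. (\<integral>\<omega>. (partial_sum g W n \<omega>)\<^sup>2 \<partial>M) / real n) \<longlonglongrightarrow> v" by simp
  have reg: "regular_cond_cdf M G (\<lambda>x. S n x / sqrt (real n)) (F n)" if "1 \<le> n" for n
  proof -
    have eq: "{x \<in> space M. S n x / sqrt (real n) \<le> z} = {x \<in> space M. partial_sum g W n x / sqrt (real n) \<le> z}" for z
      by (auto simp: S_eq)
    show ?thesis
      using regular[OF that] unfolding regular_cond_cdf_def real_cond_prob_def eq G_def[symmetric] .
  qed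
  have law: "real_distribution (cdf_law (F n x))" "cdf (cdf_law (F n x)) = F n x"
    if "x \<in> space M" "1 \<le> n" for n x
    using reg[OF that(2)] that(1) by (auto simp: regular_cond_cdf_def intro: cdf_law)
  have ident: "AE x in M. ce (\<lambda>x. f (S n x / sqrt (real n))) x = (\<integral>y. f y \<partial>cdf_law (F n x))"
    if "1 \<le> n" "f \<in> borel_measurable borel" "\<And>y. \<bar>f y\<bar> \<le> 1" for f :: "real \<Rightarrow> real" and n
    by (rule regular_cond_cdf_integral[OF prob_space_axioms sub _ reg[OF that(1)] that(2,3)]) measurable
  \<comment> \<open>The distribution functions are given for n >= 1 only, hence
    \<open>Suc n\<close>. Restricting \<open>t\<close> to the rationals leaves a single null
    set.\<close>
  have cos_ident: "AE x in M. \<forall>n. \<forall>t\<in>\<rat>. ce (\<lambda>x. cos (t * (S (Suc n) x / sqrt (real (Suc n))))) x = (\<integral>y. cos (t * y) \<partial>cdf_law (F (Suc n) x))"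
    unfolding AE_all_countable AE_ball_countable[OF countable_rat]
    by (intro allI ballI ident[of _ "\<lambda>y. cos (t * y)" for t]) auto
  have sin_ident: "AE x in M. \<forall>n. \<forall>t\<in>\<rat>. ce (\<lambda>x. sin (t * (S (Suc n) x / sqrt (real (Suc n))))) x = (\<integral>y. sin (t * y) \<partial>cdf_law (F (Suc n) x))"
    unfolding AE_all_countable AE_ball_countable[OF countable_rat]
    by (intro allI ballI ident[of _ "\<lambda>y. sin (t * y)" for t]) auto
  have tail_ident: "AE x in M. \<forall>n. \<forall>L::nat. ce (indicator {x \<in> space M. real L < \<bar>S (Suc n) x / sqrt (real (Suc n))\<bar>}) x
      = measure (cdf_law (F (Suc n) x)) {y. real L < \<bar>y\<bar>}"
    unfolding AE_all_countable
  proof (intro allI)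
    fix n L :: nat
    have "AE x in M. ce (\<lambda>x. indicator {y. real L < \<bar>y\<bar>} (S (Suc n) x / sqrt (real (Suc n)))) x
      = (\<integral>y. indicator {y. real L < \<bar>y\<bar>} y \<partial>cdf_law (F (Suc n) x))"
      by (rule ident) (auto simp: indicator_def)
    moreover have "AE x in M. ce (indicator {x \<in> space M. real L < \<bar>S (Suc n) x / sqrt (real (Suc n))\<bar>}) x
      = ce (\<lambda>x. indicator {y. real L < \<bar>y\<bar>} (S (Suc n) x / sqrt (real (Suc n)))) x"
    proof (rule real_cond_exp_cong)
      show "AE x in M. indicat_real {x \<in> space M. real L < \<bar>S (Suc n) x / sqrt (real (Suc n))\<bar>} x
        = indicator {y. real L < \<bar>y\<bar>} (S (Suc n) x / sqrt (real (Suc n)))"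
        by (rule AE_I2) (simp only: indicator_def mem_Collect_eq simp_thms)
    qed measurable
    ultimately show "AE x in M. ce (indicator {x \<in> space M. real L < \<bar>S (Suc n) x / sqrt (real (Suc n))\<bar>}) x
      = measure (cdf_law (F (Suc n) x)) {y. real L < \<bar>y\<bar>}"
      using AE_space
    proof eventually_elim
      case (elim x)
      have "real_distribution (cdf_law (F (Suc n) x))" using law(1)[OF elim(3)] by simp
      then have "space (cdf_law (F (Suc n) x)) = UNIV"
        using sets_eq_imp_space_eq real_distribution.events_eq_borel space_borel by metis
      then show ?case using elim by simp
    qed
  qed
  have conv: "AE x in M. \<forall>t\<in>\<rat>. (\<lambda>n. ce (\<lambda>x. cos (t * (S n x / sqrt (real n)))) x) \<longlonglongrightarrow> exp (- (t\<^sup>2 * v) / 2)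
      \<and> (\<lambda>n. ce (\<lambda>x. sin (t * (S n x / sqrt (real n)))) x) \<longlonglongrightarrow> 0"
    unfolding AE_ball_countable[OF countable_rat]
    by (intro ballI AE_conjI cos_lim sin_lim)
  have "AE x in M. weak_conv (\<lambda>n. F n x) (cdf (centred_normal v))"
    using cos_ident sin_ident tail_ident conv tight AE_space
  proof eventually_elim
    case (elim x)
    define \<mu> where "\<mu> n = cdf_law (F (Suc n) x)" for n
    have \<mu>: "real_distribution (\<mu> n)" "cdf (\<mu> n) = F (Suc n) x" for n
      using law[OF elim(6)] by (simp_all add: \<mu>_def)
    have "weak_conv_m \<mu> (centred_normal v)"
    proof (rule weak_conv_m_of_rational_char[OF \<mu>(1) centred_normal(1)[OF v(1)]])
      fix t :: real assume t: "t \<in> \<rat>"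
      have "char (\<mu> n) t = Complex (ce (\<lambda>x. cos (t * (S (Suc n) x / sqrt (real (Suc n))))) x)
          (ce (\<lambda>x. sin (t * (S (Suc n) x / sqrt (real (Suc n))))) x)" for n
        using elim(1,2) t unfolding real_distribution.char_eq_Complex[OF \<mu>(1)] unfolding \<mu>_def by (simp del: of_nat_Suc)
      moreover have "(\<lambda>n. Complex (ce (\<lambda>x. cos (t * (S (Suc n) x / sqrt (real (Suc n))))) x)
          (ce (\<lambda>x. sin (t * (S (Suc n) x / sqrt (real (Suc n))))) x)) \<longlonglongrightarrow> Complex (exp (- (t\<^sup>2 * v) / 2)) 0"
        using elim(4) t by (intro tendsto_Complex) (auto intro: LIMSEQ_Suc simp del: of_nat_Suc)
      moreover have "char (centred_normal v) t = Complex (exp (- (t\<^sup>2 * v) / 2)) 0"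
        unfolding centred_normal(2)[OF v(1)] by (simp add: complex_of_real_def)
      ultimately show "(\<lambda>n. char (\<mu> n) t) \<longlonglongrightarrow> char (centred_normal v) t" by (simp only:)
    next
      fix m :: nat
      obtain L :: nat where L: "\<And>n. ce (indicator {x \<in> space M. real L < \<bar>S n x / sqrt (real n)\<bar>}) x \<le> 1 / real (Suc m)"
        using elim(5) by blast
      have "measure (\<mu> n) {y. real L < \<bar>y\<bar>} \<le> 1 / real (Suc m)" for n
      proof -
        have "measure (\<mu> n) {y. real L < \<bar>y\<bar>}
          = ce (indicator {x \<in> space M. real L < \<bar>S (Suc n) x / sqrt (real (Suc n))\<bar>}) x"
          unfolding \<mu>_def by (rule elim(3)[rule_format, symmetric])
        then show ?thesis using L[of "Suc n"] by (simp only:)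
      qed
      then show "\<exists>L::nat. \<forall>n. measure (\<mu> n) {y. real L < \<bar>y\<bar>} \<le> 1 / real (Suc m)" by blast
    qed
    then have "weak_conv (\<lambda>n. F (Suc n) x) (cdf (centred_normal v))"
      unfolding weak_conv_m_def by (simp only: \<mu>(2))
    then show ?case
      \<comment> \<open>Undoes the index shift: \<open>F 0\<close> is unspecified and does not
        affect the limit.\<close>
      unfolding weak_conv_def by (intro allI impI LIMSEQ_imp_Suc[where f = "\<lambda>n. F n x y" for y]) simp
  qed
  with lim show ?thesis by (auto simp: limI convergent_def)
qed

end
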